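(* Let $U$ be an open neighborhood of the origin in the plane $\mathbb{R}^2$ (coordinates $(x,t)$), let $U_+=U\cap\{t>0\}$, and let $$L=\frac{\partial}{\partial t}+a(x,t)\frac{\partial}{\partial x}$$ be a vector field with smooth complex-valued coefficient $a$ on $U$. Assume that $L$ is locally integrable in $U$. Suppose $f\in C^1(U_+)$ satisfies $Lf=0$ in $U_+$ and, for some integer $N$, $$|f(x,t)|=O(t^{-N})\qquad\text{as } t\to 0^+,$$ uniformly for $x$ in compact subsets of $X=\{x\in\mathbb{R}:(x,0)\in U\}$. If the trace $bf=f(x,0)\in\mathcal{D}'(X)$ is a measure, then it is absolutely continuous with respect to Lebesgue measure.
   Context: A nowhere vanishing smooth complex vector field $L$ in an open set $U$ of the plane is called locally integrable in $U$ if each $p\in U$ is contained in a neighborhood on which there is a smooth complex-valued function $Z$ with $LZ=0$ and $dZ\neq 0$. The trace (weak boundary value) is $bf=\lim_{t\to0^+}f(\cdot,t)$, the limit being taken in $\mathcal{D}'(X)$; under the stated hypotheses ($Lf=0$ and tempered growth) this limit exists. "Is a measure" means that the distribution $bf$ is given by a (complex) Radon measure on $X$. *)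

theory Defs
  imports "HOL-Analysis.Analysis"
begin

text \<open>\<open>k\<close>-fold continuous differentiability, meant for open \<open>S\<close>: \<open>frechet_derivative f (at p) b\<close> is then
  the partial derivative of \<open>f\<close> at \<open>p\<close> in the direction of the basis vector \<open>b\<close>. For plane domains
  the basis of \<open>real \<times> real\<close> is \<open>(1, 0), (0, 1)\<close>.\<close>

primrec Ck_on :: "nat \<Rightarrow> 'a::euclidean_space set \<Rightarrow> ('a \<Rightarrow> 'b::real_normed_vector) \<Rightarrow> bool" where
  "Ck_on 0 S f \<longleftrightarrow> continuous_on S f"
| "Ck_on (Suc k) S f \<longleftrightarrow>
     (\<forall>p\<in>S. f differentiable (at p)) \<and>
     (\<forall>b\<in>Basis. Ck_on k S (\<lambda>p. frechet_derivative f (at p) b))"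

definition smooth_on :: "'a::euclidean_space set \<Rightarrow> ('a \<Rightarrow> 'b::real_normed_vector) \<Rightarrow> bool" where
  "smooth_on S f \<longleftrightarrow> (\<forall>k. Ck_on k S f)"

text \<open>A complex vector field \<open>A \<partial>/\<partial>x + B \<partial>/\<partial>t\<close> is represented by its pair of components
  \<open>L p = (A p, B p)\<close>. Points of the plane are \<open>(x, t)\<close>.\<close>

definition vf_apply ::
  "(real \<times> real \<Rightarrow> complex \<times> complex) \<Rightarrow> (real \<times> real \<Rightarrow> complex) \<Rightarrow> real \<times> real \<Rightarrow> complex" where
  "vf_apply L f p =
     fst (L p) * frechet_derivative f (at p) (1, 0) + snd (L p) * frechet_derivative f (at p) (0, 1)"

definition locally_integrable_vf ::
  "(real \<times> real) set \<Rightarrow> (real \<times> real \<Rightarrow> complex \<times> complex) \<Rightarrow> bool" where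
  "locally_integrable_vf U L \<longleftrightarrow>
     smooth_on U (\<lambda>p. fst (L p)) \<and> smooth_on U (\<lambda>p. snd (L p)) \<and> (\<forall>p\<in>U. L p \<noteq> (0, 0)) \<and>
     (\<forall>p\<in>U. \<exists>V Z. open V \<and> p \<in> V \<and> V \<subseteq> U \<and> smooth_on V Z \<and>
        (\<forall>q\<in>V. vf_apply L Z q = 0 \<and> frechet_derivative Z (at q) \<noteq> (\<lambda>_. 0)))"

definition test_function :: "real set \<Rightarrow> (real \<Rightarrow> complex) \<Rightarrow> bool" where
  "test_function X \<phi> \<longleftrightarrow>
     smooth_on UNIV \<phi> \<and> compact (closure {x. \<phi> x \<noteq> 0}) \<and> closure {x. \<phi> x \<noteq> 0} \<subseteq> X"

text \<open>Convergence \<open>f(\<cdot>, t) \<longrightarrow> T\<close> in \<open>\<D>'(X)\<close> as \<open>t\<close> decreases to \<open>0\<close>. If \<open>U\<close> is open in the plane,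
  \<open>X\<close> is its slice at \<open>t = 0\<close> and \<open>\<phi>\<close> is a test function on \<open>X\<close>, then \<open>supp \<phi> \<times> {t}\<close> lies in \<open>U\<close> for
  all small \<open>t\<close>, and the integrand is \<open>0\<close> off \<open>supp \<phi>\<close>; so only values of \<open>f\<close> on \<open>U \<inter> {t > 0}\<close> matter.\<close>

definition has_trace ::
  "real set \<Rightarrow> (real \<times> real \<Rightarrow> complex) \<Rightarrow> ((real \<Rightarrow> complex) \<Rightarrow> complex) \<Rightarrow> bool" where
  "has_trace X f T \<longleftrightarrow>
     (\<forall>\<phi>. test_function X \<phi> \<longrightarrow>
        ((\<lambda>t. LINT x|lborel. f (x, t) * \<phi> x) \<longlongrightarrow> T \<phi>) (at_right 0))"

text \<open>A positive Radon measure on the open set \<open>X\<close>: a locally finite Borel measure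
  (regularity is automatic on open subsets of the line).\<close>

definition radon_measure_on :: "real set \<Rightarrow> real measure \<Rightarrow> bool" where
  "radon_measure_on X M \<longleftrightarrow>
     sets M = sets (restrict_space borel X) \<and>
     (\<forall>K. compact K \<and> K \<subseteq> X \<longrightarrow> emeasure M K < \<infinity>)"

text \<open>A complex Radon measure on \<open>X\<close> need not be bounded, so it is a set function only on the Borel
  sets that are relatively compact in \<open>X\<close>. It is given by positive Radon measures
  \<open>\<mu> 0, \<mu> 1, \<mu> 2, \<mu> 3\<close> as \<open>\<mu> 0 + \<i> \<mu> 1 - \<mu> 2 - \<i> \<mu> 3\<close>; these are not required to be the
  (mutually singular) Jordan components, so they may partly cancel.\<close>

definition complex_radon_measure_on :: "real set \<Rightarrow> (nat \<Rightarrow> real measure) \<Rightarrow> bool" where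
  "complex_radon_measure_on X \<mu> \<longleftrightarrow> (\<forall>k<4. radon_measure_on X (\<mu> k))"

definition cmeasure :: "(nat \<Rightarrow> real measure) \<Rightarrow> real set \<Rightarrow> complex" where
  "cmeasure \<mu> E = (\<Sum>k<4. \<i> ^ k * complex_of_real (measure (\<mu> k) E))"

definition cintegral :: "(nat \<Rightarrow> real measure) \<Rightarrow> (real \<Rightarrow> complex) \<Rightarrow> complex" where
  "cintegral \<mu> \<phi> = (\<Sum>k<4. \<i> ^ k * (LINT x|\<mu> k. \<phi> x))"

definition distribution_given_by ::
  "real set \<Rightarrow> ((real \<Rightarrow> complex) \<Rightarrow> complex) \<Rightarrow> (nat \<Rightarrow> real measure) \<Rightarrow> bool" where
  "distribution_given_by X T \<mu> \<longleftrightarrow> (\<forall>\<phi>. test_function X \<phi> \<longrightarrow> T \<phi> = cintegral \<mu> \<phi>)"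

definition abs_continuous_on :: "real set \<Rightarrow> (nat \<Rightarrow> real measure) \<Rightarrow> bool" where
  "abs_continuous_on X \<mu> \<longleftrightarrow>
     (\<forall>E\<in>sets borel. compact (closure E) \<and> closure E \<subseteq> X \<and> emeasure lborel E = 0
        \<longrightarrow> cmeasure \<mu> E = 0)"

end

theory Submission
  imports Defs "HOL-Complex_Analysis.Complex_Analysis"
begin

text \<open>
Near a boundary point a first integral \<open>Z\<close> can be scaled so that \<open>Z\<^sub>x\<close> is within a small \<open>\<epsilon>\<close> of \<open>1\<close>.
The level curves \<open>\<Gamma>\<^sub>t = {Z (x, t)}\<close> are then nearly horizontal graphs. If \<open>Lf = 0\<close> and \<open>G\<close> is
holomorphic, the form \<open>f G(Z) dZ\<close> is closed, so that with a cutoff \<open>\<psi>\<close> Stokes' formula compares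
\<open>\<integral> f \<psi> G(Z) Z\<^sub>x dx\<close> at two times up to integrals over the sides, where \<open>\<psi>\<close> is not constant
(\<open>level_identity\<close>). Tempered growth makes the side integrals harmless: a primitive of \<open>f dZ\<close> is again a
solution and is better than \<open>f\<close> by one power of \<open>t\<close> (\<open>primitive\<close>), and after finitely many integrations
by parts all pairings are bounded by finitely many derivatives of \<open>G\<close>, uniformly down to \<open>t = 0\<close>
(\<open>pairing_bound\<close>). Hence \<open>bf\<close> applied to \<open>\<psi> G(\<zeta>) \<zeta>'\<close>, where \<open>\<zeta> = Z(\<cdot>, 0)\<close>, is small as soon as \<open>G\<close> is small
near the sides and on a later curve \<open>\<Gamma>\<^sub>s\<close> (\<open>trace_bound\<close>). Here \<open>G\<close> may have singularities between
\<open>\<Gamma>\<^sub>0\<close> and \<open>\<Gamma>\<^sub>s\<close>, provided that a shift of the argument of \<open>G\<close> moves them out of the way while avoiding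
the two curves and the sides: both members of the identity are holomorphic in the shift
(\<open>level_identity_shift\<close>).

Let \<open>E\<close> be a compact null set. Suppose that functions \<open>G\<^sub>k\<close> of this kind tend to \<open>0\<close> near the sides, tend to
\<open>0\<close> boundedly and almost everywhere on \<open>\<Gamma>\<^sub>s\<close>, and tend to \<open>0\<close> boundedly on \<open>\<Gamma>\<^sub>0\<close> off \<open>\<zeta>(E)\<close>, but are
close to \<open>1\<close> on \<open>\<zeta>(E)\<close>. Then \<open>bf(\<psi> G\<^sub>k(\<zeta>) \<zeta>')\<close> tends to \<open>0\<close>; since \<open>bf\<close> is a measure \<open>\<mu>\<close>, dominated
convergence says that the same integrals over \<open>E\<close> alone tend to \<open>0\<close>, although there the integrand is within
\<open>2\<epsilon>\<close> of \<open>1\<close>. So \<open>\<bar>\<mu>(E)\<bar> \<le> 2\<epsilon> m(E)\<close>, where \<open>m\<close> is the sum of the positive measures of which \<open>\<mu>\<close> is composed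
(\<open>cmeasure_le_of_peaks\<close>). Such peak functions have the form \<open>G = 1 - exp (- q H)\<close> with \<open>Re H\<close> bounded below
on \<open>\<Gamma>\<^sub>0\<close> and \<open>\<Gamma>\<^sub>s\<close>, and bounded below by a positive constant on \<open>\<zeta>(E)\<close>. There are two constructions of \<open>H\<close>.

If every point of \<open>\<zeta>(E)\<close> lies on every \<open>\<Gamma>\<^sub>t\<close> with \<open>t \<le> s\<close>, all these curves stay in a horizontal cone at each
point of \<open>\<zeta>(E)\<close>, and an average of the kernels \<open>\<kappa> / (25 (\<kappa> + d(v, E))\<^sup>2 + (z - \<zeta>(v))\<^sup>2)\<close> does it: their
poles lie above and below the cones (\<open>peaks_two_sided\<close>). If \<open>\<Gamma>\<^sub>s\<close> misses \<open>\<zeta>(e)\<close> for some \<open>s\<close>, it runs strictly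
above or strictly below \<open>\<zeta>\<close> near \<open>e\<close>, and Cauchy kernels with poles just off \<open>\<Gamma>\<^sub>0\<close> on the other side and with
weights that concentrate at \<open>E\<close>, do it (\<open>peaks_one_sided\<close>).

The points of the second kind form an open set, so both kinds form Borel sets. Inner regularity and countable
additivity carry the inequality from compact null sets to all relatively compact Borel null sets in \<open>X\<close>,
for each \<open>\<epsilon>\<close> (\<open>small_on_nbhd\<close>, \<open>small_on_locally\<close>), and \<open>\<epsilon> \<rightarrow> 0\<close> gives the theorem.
\<close>

section \<open>Calculus of \<open>C\<^sup>k\<close> maps\<close>

lemma frechet_derivative_cong_open:
  assumes "open S" "p \<in> S" "\<And>q. q \<in> S \<Longrightarrow> f q = g q" "f differentiable (at p)"
  shows "g differentiable (at p)" "frechet_derivative g (at p) = frechet_derivative f (at p)"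
proof -
  have "(f has_derivative frechet_derivative f (at p)) (at p)"
    using assms(4) frechet_derivative_works by blast
  then have *: "(g has_derivative frechet_derivative f (at p)) (at p)"
    using has_derivative_transform_within_open[OF _ assms(1,2)] assms(3) by blast
  then show "g differentiable (at p)" by (rule differentiableI)
  show "frechet_derivative g (at p) = frechet_derivative f (at p)"
    using frechet_derivative_at[OF *] by simp
qed

lemma Ck_on_Suc_D: "open S \<Longrightarrow> Ck_on (Suc k) S f \<Longrightarrow> Ck_on k S f"
proof (induction k arbitrary: f)
  case 0
  then show ?case
    by (auto intro!: continuous_at_imp_continuous_on differentiable_imp_continuous_within)
next
  case (Suc k)
  then show ?case by (metis Ck_on.simps(2))
qed

lemma Ck_on_cong:
  "open S \<Longrightarrow> (\<And>p. p \<in> S \<Longrightarrow> f p = g p) \<Longrightarrow> Ck_on k S f \<Longrightarrow> Ck_on k S g"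
proof (induction k arbitrary: f g)
  case 0
  then show ?case using continuous_on_cong by force
next
  case (Suc k)
  have d: "f differentiable (at p)" if "p \<in> S" for p using Suc.prems that by simp
  note c = frechet_derivative_cong_open[OF Suc.prems(1) _ Suc.prems(2) d]
  have "Ck_on k S (\<lambda>p. frechet_derivative g (at p) b)" if "b \<in> Basis" for b
    by (rule Suc.IH[OF Suc.prems(1), of "\<lambda>p. frechet_derivative f (at p) b"]) (use Suc.prems(3) that c in auto)
  then show ?case using c by auto
qed

lemma Ck_on_subset: "T \<subseteq> S \<Longrightarrow> Ck_on k S f \<Longrightarrow> Ck_on k T f"
  by (induction k arbitrary: f) (auto intro: continuous_on_subset)

lemma Ck_on_Un: "open S \<Longrightarrow> open T \<Longrightarrow> Ck_on k S f \<Longrightarrow> Ck_on k T f \<Longrightarrow> Ck_on k (S \<union> T) f"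
  by (induction k arbitrary: f) (auto intro: continuous_on_open_Un)

lemma Ck_on_const: "Ck_on k S (\<lambda>_. c)"
  by (induction k arbitrary: c) auto

lemma Ck_on_add:
  "open S \<Longrightarrow> Ck_on k S f \<Longrightarrow> Ck_on k S g \<Longrightarrow> Ck_on k S (\<lambda>p. f p + g p)"
proof (induction k arbitrary: f g)
  case (Suc k)
  have d: "((\<lambda>p. f p + g p) has_derivative (\<lambda>h. frechet_derivative f (at p) h + frechet_derivative g (at p) h)) (at p)"
    if "p \<in> S" for p using Suc.prems that by (auto intro!: has_derivative_add simp: frechet_derivative_works[symmetric])
  have "Ck_on k S (\<lambda>p. frechet_derivative (\<lambda>p. f p + g p) (at p) b)" if b: "b \<in> Basis" for b
  proof (rule Ck_on_cong[OF Suc.prems(1)])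
    show "Ck_on k S (\<lambda>p. frechet_derivative f (at p) b + frechet_derivative g (at p) b)"
      using Suc b by auto
  qed (rule fun_cong[OF frechet_derivative_at[OF d]])
  then show ?case using differentiableI[OF d] by simp
qed (auto intro: continuous_intros)

lemma Ck_on_mult:
  fixes f g :: "_ \<Rightarrow> 'b::real_normed_algebra"
  shows "open S \<Longrightarrow> Ck_on k S f \<Longrightarrow> Ck_on k S g \<Longrightarrow> Ck_on k S (\<lambda>p. f p * g p)"
proof (induction k arbitrary: f g)
  case (Suc k)
  have d: "((\<lambda>p. f p * g p) has_derivative (\<lambda>h. f p * frechet_derivative g (at p) h + frechet_derivative f (at p) h * g p)) (at p)"
    if "p \<in> S" for p using Suc.prems that by (auto intro!: has_derivative_mult simp: frechet_derivative_works[symmetric])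
  have "Ck_on k S (\<lambda>p. frechet_derivative (\<lambda>p. f p * g p) (at p) b)" if b: "b \<in> Basis" for b
  proof (rule Ck_on_cong[OF Suc.prems(1)])
    have "Ck_on k S f" "Ck_on k S g" using Suc.prems Ck_on_Suc_D by blast+
    then show "Ck_on k S (\<lambda>p. f p * frechet_derivative g (at p) b + frechet_derivative f (at p) b * g p)"
      using Suc b by (intro Ck_on_add) auto
  qed (rule fun_cong[OF frechet_derivative_at[OF d]])
  then show ?case using differentiableI[OF d] by simp
qed (auto intro: continuous_intros)

lemma Ck_on_holomorphic:
  fixes g :: "'a::euclidean_space \<Rightarrow> complex"
  shows "open S \<Longrightarrow> open W \<Longrightarrow> G holomorphic_on W \<Longrightarrow> g ` S \<subseteq> W \<Longrightarrow> Ck_on k S g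
    \<Longrightarrow> Ck_on k S (\<lambda>p. G (g p))"
proof (induction k arbitrary: G)
  case 0
  have "continuous_on W G" using 0 holomorphic_on_imp_continuous_on by blast
  moreover have "continuous_on S g" using 0 by simp
  ultimately show ?case using continuous_on_compose2 0(4) by simp
next
  case (Suc k)
  have d: "((\<lambda>p. G (g p)) has_derivative (\<lambda>h. deriv G (g p) * frechet_derivative g (at p) h)) (at p)"
    if "p \<in> S" for p
  proof -
    have "(G has_field_derivative deriv G (g p)) (at (g p))"
      using holomorphic_derivI[OF Suc.prems(3,2)] Suc.prems(4) that by blast
    then have "(G has_derivative (*) (deriv G (g p))) (at (g p))"
      unfolding has_field_derivative_def .
    moreover have "(g has_derivative frechet_derivative g (at p)) (at p)"
      using Suc.prems that unfolding frechet_derivative_works[symmetric] by simp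
    ultimately show ?thesis by (rule has_derivative_compose[rotated])
  qed
  have "Ck_on k S (\<lambda>p. frechet_derivative (\<lambda>p. G (g p)) (at p) b)" if b: "b \<in> Basis" for b
  proof (rule Ck_on_cong[OF Suc.prems(1)])
    have "Ck_on k S g" using Suc.prems Ck_on_Suc_D by blast
    then have "Ck_on k S (\<lambda>p. deriv G (g p))"
      by (rule Suc.IH[OF Suc.prems(1,2) holomorphic_deriv[OF Suc.prems(3,2)] Suc.prems(4)])
    moreover have "Ck_on k S (\<lambda>p. frechet_derivative g (at p) b)" using Suc.prems b by simp
    ultimately show "Ck_on k S (\<lambda>p. deriv G (g p) * frechet_derivative g (at p) b)"
      by (rule Ck_on_mult[OF Suc.prems(1)])
  qed (rule fun_cong[OF frechet_derivative_at[OF d]])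
  then show ?case using differentiableI[OF d] by simp
qed

lemma Ck_on_sum: "open S \<Longrightarrow> (\<And>i. i \<in> I \<Longrightarrow> Ck_on k S (f i)) \<Longrightarrow> Ck_on k S (\<lambda>p. \<Sum>i\<in>I. f i p)"
  by (induction I rule: infinite_finite_induct) (auto intro!: Ck_on_const Ck_on_add)

lemma Ck_on_scaleR: "open S \<Longrightarrow> Ck_on k S f \<Longrightarrow> Ck_on k S (\<lambda>p. c *\<^sub>R f p)"
proof (induction k arbitrary: f)
  case (Suc k)
  have d: "((\<lambda>p. c *\<^sub>R f p) has_derivative (\<lambda>h. c *\<^sub>R frechet_derivative f (at p) h)) (at p)"
    if "p \<in> S" for p using Suc.prems that
    by (auto intro!: has_derivative_scaleR_right simp: frechet_derivative_works[symmetric])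
  have "Ck_on k S (\<lambda>p. frechet_derivative (\<lambda>p. c *\<^sub>R f p) (at p) b)" if b: "b \<in> Basis" for b
  proof (rule Ck_on_cong[OF Suc.prems(1)])
    show "Ck_on k S (\<lambda>p. c *\<^sub>R frechet_derivative f (at p) b)"
      using Suc b by auto
  qed (rule fun_cong[OF frechet_derivative_at[OF d]])
  then show ?case using differentiableI[OF d] by simp
qed (auto intro: continuous_intros)

text \<open>The derivative of \<open>f\<close> in the direction \<open>l b\<close> is a combination of the partial derivatives along the basis
  vectors, to which the induction hypothesis applies.\<close>

lemma Ck_on_affine:
  fixes f :: "'a::euclidean_space \<Rightarrow> 'b::real_normed_vector" and l :: "'c::euclidean_space \<Rightarrow> 'a"
  assumes l: "bounded_linear l" and T: "open T"
  shows "open S \<Longrightarrow> (\<And>q. q \<in> T \<Longrightarrow> l q + c \<in> S) \<Longrightarrow> Ck_on k S f \<Longrightarrow> Ck_on k T (\<lambda>q. f (l q + c))"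
proof (induction k arbitrary: f)
  case 0
  have "continuous_on S f" using 0 by simp
  moreover have "continuous_on T (\<lambda>q. l q + c)"
    by (intro continuous_on_add linear_continuous_on l continuous_on_const)
  ultimately show ?case using continuous_on_compose2[of S f T "\<lambda>q. l q + c"] 0(2) by (simp add: image_subset_iff)
next
  case (Suc k)
  have d: "((\<lambda>q. f (l q + c)) has_derivative (\<lambda>h. frechet_derivative f (at (l p + c)) (l h))) (at p)"
    if "p \<in> T" for p
  proof -
    have "((\<lambda>q. l q + c) has_derivative (\<lambda>h. l h + 0)) (at p)"
      by (intro has_derivative_add bounded_linear_imp_has_derivative l has_derivative_const)
    moreover have "(f has_derivative frechet_derivative f (at (l p + c))) (at (l p + c))"
      using Suc.prems that unfolding frechet_derivative_works[symmetric] by simp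
    ultimately show ?thesis
      using has_derivative_compose[of "\<lambda>q. l q + c" l p UNIV f] by simp
  qed
  have "Ck_on k T (\<lambda>p. frechet_derivative (\<lambda>q. f (l q + c)) (at p) b)" if b: "b \<in> Basis" for b
  proof (rule Ck_on_cong[OF T])
    have "Ck_on k T (\<lambda>p. frechet_derivative f (at (l p + c)) i)" if "i \<in> Basis" for i
      using Suc.IH[OF Suc.prems(1,2), of "\<lambda>p. frechet_derivative f (at p) i"] Suc.prems(3) that by simp
    then show "Ck_on k T (\<lambda>p. \<Sum>i\<in>Basis. (l b \<bullet> i) *\<^sub>R frechet_derivative f (at (l p + c)) i)"
      by (intro Ck_on_sum Ck_on_scaleR T)
    fix p assume p: "p \<in> T"
    have lin: "linear (frechet_derivative f (at (l p + c)))"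
      using Suc.prems p by (intro linear_frechet_derivative) simp
    have "frechet_derivative f (at (l p + c)) (l b)
        = frechet_derivative f (at (l p + c)) (\<Sum>i\<in>Basis. (l b \<bullet> i) *\<^sub>R i)"
      by (simp add: euclidean_representation)
    also have "\<dots> = (\<Sum>i\<in>Basis. (l b \<bullet> i) *\<^sub>R frechet_derivative f (at (l p + c)) i)"
      using lin by (simp add: linear_sum linear_scale)
    finally show "(\<Sum>i\<in>Basis. (l b \<bullet> i) *\<^sub>R frechet_derivative f (at (l p + c)) i)
        = frechet_derivative (\<lambda>q. f (l q + c)) (at p) b"
      using fun_cong[OF frechet_derivative_at[OF d[OF p]], of b] by simp
  qed
  then show ?case using differentiableI[OF d] by simp
qed

section \<open>Partial derivatives in the plane\<close>

abbreviation px :: "(real \<times> real \<Rightarrow> complex) \<Rightarrow> real \<times> real \<Rightarrow> complex" where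
  "px w p \<equiv> frechet_derivative w (at p) (1, 0)"

abbreviation pt :: "(real \<times> real \<Rightarrow> complex) \<Rightarrow> real \<times> real \<Rightarrow> complex" where
  "pt w p \<equiv> frechet_derivative w (at p) (0, 1)"

lemma Basis_plane: "(1, 0) \<in> (Basis :: (real \<times> real) set)" "(0, 1) \<in> (Basis :: (real \<times> real) set)"
  by (auto simp: Basis_prod_def)

lemma smooth_on_px: "smooth_on V w \<Longrightarrow> smooth_on V (px w)"
  and smooth_on_pt: "smooth_on V w \<Longrightarrow> smooth_on V (pt w)"
  unfolding smooth_on_def using Basis_plane by (metis Ck_on.simps(2))+

lemma smooth_on_imp_continuous_on: "smooth_on V w \<Longrightarrow> continuous_on V w"
  unfolding smooth_on_def by (metis Ck_on.simps(1))

lemma smooth_on_imp_differentiable: "smooth_on V w \<Longrightarrow> p \<in> V \<Longrightarrow> w differentiable (at p)"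
  unfolding smooth_on_def by (metis Ck_on.simps(2))

lemma smooth_on_const: "smooth_on V (\<lambda>_. c)"
  by (simp add: smooth_on_def Ck_on_const)

lemma smooth_on_add: "open V \<Longrightarrow> smooth_on V f \<Longrightarrow> smooth_on V g \<Longrightarrow> smooth_on V (\<lambda>p. f p + g p)"
  by (simp add: smooth_on_def Ck_on_add)

lemma smooth_on_mult:
  fixes f g :: "_ \<Rightarrow> 'b::real_normed_algebra"
  shows "open V \<Longrightarrow> smooth_on V f \<Longrightarrow> smooth_on V g \<Longrightarrow> smooth_on V (\<lambda>p. f p * g p)"
  by (simp add: smooth_on_def Ck_on_mult)

lemma smooth_on_diff:
  fixes f g :: "_ \<Rightarrow> 'b::real_normed_algebra_1"
  assumes "open V" "smooth_on V f" "smooth_on V g" shows "smooth_on V (\<lambda>p. f p - g p)"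
  using smooth_on_add[OF assms(1,2) smooth_on_mult[OF assms(1) smooth_on_const[of V "-1"] assms(3)]]
  by simp

lemma smooth_on_cong: "open V \<Longrightarrow> (\<And>p. p \<in> V \<Longrightarrow> f p = g p) \<Longrightarrow> smooth_on V f \<Longrightarrow> smooth_on V g"
  unfolding smooth_on_def using Ck_on_cong by blast

lemma smooth_on_subset: "smooth_on V f \<Longrightarrow> T \<subseteq> V \<Longrightarrow> smooth_on T f"
  unfolding smooth_on_def using Ck_on_subset by blast

lemma smooth_on_Un: "open S \<Longrightarrow> open T \<Longrightarrow> smooth_on S f \<Longrightarrow> smooth_on T f \<Longrightarrow> smooth_on (S \<union> T) f"
  unfolding smooth_on_def using Ck_on_Un by blast

lemma smooth_on_holomorphic:
  fixes g :: "'a::euclidean_space \<Rightarrow> complex"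
  shows "open S \<Longrightarrow> open W \<Longrightarrow> G holomorphic_on W \<Longrightarrow> g ` S \<subseteq> W \<Longrightarrow> smooth_on S g
    \<Longrightarrow> smooth_on S (\<lambda>p. G (g p))"
  unfolding smooth_on_def using Ck_on_holomorphic by blast

lemma smooth_on_affine:
  fixes f :: "'a::euclidean_space \<Rightarrow> 'b::real_normed_vector" and l :: "'c::euclidean_space \<Rightarrow> 'a"
  assumes "bounded_linear l" "open T" "open S" "\<And>q. q \<in> T \<Longrightarrow> l q + c \<in> S" "smooth_on S f"
  shows "smooth_on T (\<lambda>q. f (l q + c))"
  using assms(5) Ck_on_affine[OF assms(1-4)] unfolding smooth_on_def by blast

lemma smooth_on_fst:
  fixes g :: "real \<Rightarrow> complex"
  assumes "open V" "smooth_on UNIV g"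
  shows "smooth_on V (\<lambda>p :: real \<times> real. g (fst p))"
  using smooth_on_affine[OF bounded_linear_fst assms(1) open_UNIV _ assms(2), of 0] by simp

lemma smooth_on_slice:
  fixes w :: "real \<times> real \<Rightarrow> complex"
  assumes "open T" "open V" "\<And>x. x \<in> T \<Longrightarrow> (x, t) \<in> V" "smooth_on V w"
  shows "smooth_on T (\<lambda>x. w (x, t))"
proof -
  have "bounded_linear (\<lambda>x :: real. (x, 0 :: real))"
    by (intro bounded_linear_Pair bounded_linear_ident bounded_linear_zero)
  from smooth_on_affine[OF this assms(1,2) _ assms(4), of "(0, t)"] show ?thesis
    using assms(3) by simp
qed

lemma smooth_on_slice_fst:
  fixes w :: "real \<times> real \<Rightarrow> complex"
  assumes "open T" "open V" "\<And>p. p \<in> T \<Longrightarrow> (fst p, t) \<in> V" "smooth_on V w"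
  shows "smooth_on T (\<lambda>p :: real \<times> real. w (fst p, t))"
proof -
  have "bounded_linear (\<lambda>p :: real \<times> real. (fst p, 0 :: real))"
    by (intro bounded_linear_Pair bounded_linear_fst bounded_linear_zero)
  from smooth_on_affine[OF this assms(1,2) _ assms(4), of "(0, t)"] show ?thesis
    using assms(3) by simp
qed

lemma has_vector_derivative_px:
  assumes "w differentiable (at (x, t))"
  shows "((\<lambda>x. w (x, t)) has_vector_derivative px w (x, t)) (at x within S)"
proof -
  let ?D = "frechet_derivative w (at (x, t))"
  have D: "(w has_derivative ?D) (at (x, t))" using assms frechet_derivative_works by blast
  have "((\<lambda>x. (x, t)) has_derivative (\<lambda>h. (h, 0))) (at x)"
    by (auto intro!: derivative_eq_intros)
  from has_derivative_compose[OF this D]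
  have "((\<lambda>x. w (x, t)) has_derivative (\<lambda>h. ?D (h, 0))) (at x)" by simp
  moreover have "?D (h, 0) = h *\<^sub>R ?D (1, 0)" for h
    using linear_scale[OF has_derivative_linear[OF D], of h "(1, 0)"] by simp
  then have "(\<lambda>h. ?D (h, 0)) = (\<lambda>h. h *\<^sub>R ?D (1, 0))" by (rule ext)
  ultimately show ?thesis
    unfolding has_vector_derivative_def by (metis has_derivative_at_withinI)
qed

lemma has_vector_derivative_pt:
  assumes "w differentiable (at (x, t))"
  shows "((\<lambda>t. w (x, t)) has_vector_derivative pt w (x, t)) (at t within S)"
proof -
  let ?D = "frechet_derivative w (at (x, t))"
  have D: "(w has_derivative ?D) (at (x, t))" using assms frechet_derivative_works by blast
  have "((\<lambda>t. (x, t)) has_derivative (\<lambda>h. (0, h))) (at t)"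
    by (auto intro!: derivative_eq_intros)
  from has_derivative_compose[OF this D]
  have "((\<lambda>t. w (x, t)) has_derivative (\<lambda>h. ?D (0, h))) (at t)" by simp
  moreover have "?D (0, h) = h *\<^sub>R ?D (0, 1)" for h
    using linear_scale[OF has_derivative_linear[OF D], of h "(0, 1)"] by simp
  then have "(\<lambda>h. ?D (0, h)) = (\<lambda>h. h *\<^sub>R ?D (0, 1))" by (rule ext)
  ultimately show ?thesis
    unfolding has_vector_derivative_def by (metis has_derivative_at_withinI)
qed

lemma px_mult:
  assumes "v differentiable (at p)" "w differentiable (at p)"
  shows "px (\<lambda>q. v q * w q) p = v p * px w p + px v p * w p"
    and "pt (\<lambda>q. v q * w q) p = v p * pt w p + pt v p * w p"
proof -
  have "((\<lambda>q. v q * w q) has_derivative (\<lambda>h. v p * frechet_derivative w (at p) h + frechet_derivative v (at p) h * w p)) (at p)"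
    using assms by (intro has_derivative_mult) (simp_all only: frechet_derivative_works[symmetric])
  note eq = fun_cong[OF frechet_derivative_at[OF this]]
  show "px (\<lambda>q. v q * w q) p = v p * px w p + px v p * w p"
    and "pt (\<lambda>q. v q * w q) p = v p * pt w p + pt v p * w p"
    using eq[of "(1, 0)"] eq[of "(0, 1)"] by simp_all
qed

lemma has_integral_pt:
  fixes w :: "real \<times> real \<Rightarrow> complex"
  assumes "c \<le> d" "\<And>t. t \<in> {c..d} \<Longrightarrow> w differentiable (at (x, t))"
  shows "((\<lambda>t. pt w (x, t)) has_integral w (x, d) - w (x, c)) {c..d}"
  using assms by (intro fundamental_theorem_of_calculus has_vector_derivative_pt)

lemma continuous_on_horizontal:
  assumes "continuous_on R w" "\<And>x. x \<in> S \<Longrightarrow> (x, t) \<in> R"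
  shows "continuous_on S (\<lambda>x. w (x, t))"
proof -
  have "continuous_on S (\<lambda>x. (x, t))" by (intro continuous_intros)
  from continuous_on_compose2[OF assms(1) this] show ?thesis using assms(2) by auto
qed

lemma continuous_on_vertical:
  assumes "continuous_on R w" "\<And>t. t \<in> S \<Longrightarrow> (x, t) \<in> R"
  shows "continuous_on S (\<lambda>t. w (x, t))"
proof -
  have "continuous_on S (\<lambda>t. (x, t))" by (intro continuous_intros)
  from continuous_on_compose2[OF assms(1) this] show ?thesis using assms(2) by auto
qed

text \<open>Differentiating \<open>w (x, t) = w (x, b) + (\<integral>\<^sub>b\<^sup>t \<partial>\<^sub>t w)\<close> in \<open>x\<close> under the integral sign and then in \<open>t\<close>
  exchanges the two derivatives.\<close>

lemma mixed_partials:
  assumes V: "open V" "p \<in> V" and w: "smooth_on V w"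
  shows "pt (px w) p = px (pt w) p"
proof -
  obtain x t where p: "p = (x, t)" by force
  obtain d where d: "d > 0" "cball p d \<subseteq> V" using V open_contains_cball by blast
  have box: "(y, s) \<in> V" if "\<bar>y - x\<bar> \<le> d / 2" "\<bar>s - t\<bar> \<le> d / 2" for y s
  proof -
    have "dist p (y, s) \<le> \<bar>x - y\<bar> + \<bar>t - s\<bar>"
      unfolding p dist_prod_def dist_real_def using sqrt_sum_squares_le_sum_abs by simp
    then have "dist p (y, s) \<le> d" using that by linarith
    then show ?thesis using d(2) by auto
  qed
  define b where "b = t - d / 2"
  let ?X = "{x - d / 2..x + d / 2}" and ?T = "{b..t + d / 2}"
  have inV: "(y, s) \<in> V" if "y \<in> ?X" "s \<in> ?T" for y s
    using that by (intro box; unfold abs_le_iff) (auto simp: b_def)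
  note smooth = w smooth_on_px[OF w] smooth_on_pt[OF w] smooth_on_px[OF smooth_on_pt[OF w]]
  have cont: "continuous_on (?X \<times> ?T) v" if "smooth_on V v" for v
    using smooth_on_imp_continuous_on[OF that] by (rule continuous_on_subset) (use inV in auto)
  have diff: "v differentiable (at (y, s))" if "smooth_on V v" "y \<in> ?X" "s \<in> ?T" for v y s
    using smooth_on_imp_differentiable[OF that(1)] inV that by blast
  have x: "x \<in> ?X" and t: "t \<in> ?T" using d by (auto simp: b_def)
  have eq: "px w (x, s) = px w (x, b) + integral {b..s} (\<lambda>\<sigma>. px (pt w) (x, \<sigma>))" if s: "s \<in> ?T" for s
  proof -
    have w_eq: "w (y, s) = w (y, b) + integral (cbox b s) (\<lambda>\<sigma>. pt w (y, \<sigma>))" if "y \<in> ?X" for y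
    proof -
      have "((\<lambda>t. pt w (y, t)) has_integral w (y, s) - w (y, b)) {b..s}"
        using s that by (intro has_integral_pt diff[OF w]) auto
      then show ?thesis by (simp add: integral_unique)
    qed
    have "((\<lambda>y. integral (cbox b s) (\<lambda>\<sigma>. pt w (y, \<sigma>))) has_vector_derivative
        integral (cbox b s) (\<lambda>\<sigma>. px (pt w) (x, \<sigma>))) (at x within ?X)"
    proof (rule leibniz_rule_vector_derivative[where U = ?X and f = "\<lambda>y \<sigma>. pt w (y, \<sigma>)"])
      show "((\<lambda>x. pt w (x, \<sigma>)) has_vector_derivative px (pt w) (y, \<sigma>)) (at y within ?X)"
        if "y \<in> ?X" "\<sigma> \<in> cbox b s" for y \<sigma>
        using that s by (intro has_vector_derivative_px diff[OF smooth(3)]) auto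
      show "(\<lambda>\<sigma>. pt w (y, \<sigma>)) integrable_on cbox b s" if "y \<in> ?X" for y
        using that s by (intro integrable_continuous continuous_on_vertical[OF cont[OF smooth(3)]]) auto
      show "continuous_on (?X \<times> cbox b s) (\<lambda>(x, t). px (pt w) (x, t))"
        using s by (simp add: case_prod_eta) (rule continuous_on_subset[OF cont[OF smooth(4)]], auto)
    qed (use x in auto)
    then have "((\<lambda>y. w (y, b) + integral (cbox b s) (\<lambda>\<sigma>. pt w (y, \<sigma>))) has_vector_derivative
        px w (x, b) + integral (cbox b s) (\<lambda>\<sigma>. px (pt w) (x, \<sigma>))) (at x within ?X)"
      using x d s by (intro has_vector_derivative_add has_vector_derivative_px diff[OF w]) (auto simp: b_def)
    then have "((\<lambda>y. w (y, s)) has_vector_derivative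
        px w (x, b) + integral (cbox b s) (\<lambda>\<sigma>. px (pt w) (x, \<sigma>))) (at x within ?X)"
      by (rule has_vector_derivative_transform[OF x, rotated]) (rule w_eq)
    moreover have "((\<lambda>y. w (y, s)) has_vector_derivative px w (x, s)) (at x within ?X)"
      using x s by (intro has_vector_derivative_px diff[OF w])
    ultimately show ?thesis
      using vector_derivative_unique_within_closed_interval[OF _ x[folded cbox_interval], of "\<lambda>y. w (y, s)"] d
      unfolding cbox_interval by simp
  qed
  have "continuous_on {b..t + d / 2} (\<lambda>\<sigma>. px (pt w) (x, \<sigma>))"
    using x by (intro continuous_on_vertical[OF cont[OF smooth(4)]]) auto
  from integral_has_vector_derivative[OF this t]
  have "((\<lambda>s. px w (x, b) + integral {b..s} (\<lambda>\<sigma>. px (pt w) (x, \<sigma>))) has_vector_derivative 0 + px (pt w) (x, t)) (at t within ?T)"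
    by (intro has_vector_derivative_add has_vector_derivative_const)
  then have "((\<lambda>s. px w (x, s)) has_vector_derivative px (pt w) (x, t)) (at t within ?T)"
    unfolding add_0 by (rule has_vector_derivative_transform[OF t, rotated]) (rule eq)
  moreover have "((\<lambda>s. px w (x, s)) has_vector_derivative pt (px w) (x, t)) (at t within ?T)"
    using x t by (intro has_vector_derivative_pt diff[OF smooth(2)])
  ultimately show ?thesis
    using vector_derivative_unique_within_closed_interval[OF _ t[folded cbox_interval], of "\<lambda>s. px w (x, s)"] d
    unfolding p cbox_interval by (simp add: b_def)
qed


text \<open>One continuous partial derivative together with the existence of the other gives differentiability along
  the product. This makes a primitive jointly continuous when its derivatives are only computed separately.\<close>

lemma continuous_on_partialsI:
  fixes f :: "real \<times> real \<Rightarrow> complex"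
  assumes fx: "\<And>x y. x \<in> X \<Longrightarrow> y \<in> Y \<Longrightarrow> ((\<lambda>x. f (x, y)) has_vector_derivative fx (x, y)) (at x within X)"
    and fy: "\<And>x y. x \<in> X \<Longrightarrow> y \<in> Y \<Longrightarrow> ((\<lambda>y. f (x, y)) has_vector_derivative fy (x, y)) (at y within Y)"
    and cont: "continuous_on (X \<times> Y) fy" and "convex Y"
  shows "continuous_on (X \<times> Y) f"
  unfolding continuous_on_eq_continuous_within
proof
  fix p assume p: "p \<in> X \<times> Y"
  obtain x y where xy: "p = (x, y)" "x \<in> X" "y \<in> Y" using p by auto
  have "((\<lambda>(x, y). f (x, y)) has_derivative (\<lambda>(tx, ty). tx *\<^sub>R fx (x, y) + blinfun_scaleR_left (fy (x, y)) ty)) (at (x, y) within X \<times> Y)"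
  proof (rule has_derivative_partialsI[where f = "\<lambda>x y. f (x, y)" and fy = "\<lambda>x y. blinfun_scaleR_left (fy (x, y))"])
    show "((\<lambda>x. f (x, y)) has_derivative (\<lambda>tx. tx *\<^sub>R fx (x, y))) (at x within X)"
      using fx[OF xy(2,3)] by (simp add: has_vector_derivative_def)
    show "((\<lambda>y. f (x, y)) has_derivative blinfun_apply (blinfun_scaleR_left (fy (x, y)))) (at y within Y)"
      if "x \<in> X" "y \<in> Y" for x y
      using fy[OF that] by (simp add: has_vector_derivative_def)
    have "continuous (at (x, y) within X \<times> Y) fy"
      using cont xy p by (simp add: continuous_on_eq_continuous_within)
    then show "continuous (at (x, y) within X \<times> Y) (\<lambda>(x, y). blinfun_scaleR_left (fy (x, y)))"
      by (simp add: case_prod_beta') (intro bounded_linear.continuous[OF bounded_linear_blinfun_scaleR_left])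
  qed (use xy assms in auto)
  then show "continuous (at p within X \<times> Y) f"
    unfolding xy(1) by (simp add: has_derivative_continuous)
qed

lemma holomorphic_compose_partials:
  assumes "open W" "G holomorphic_on W" "w p \<in> W" "w differentiable (at p)"
  shows "(\<lambda>q. G (w q)) differentiable (at p)"
    and "px (\<lambda>q. G (w q)) p = deriv G (w p) * px w p"
    and "pt (\<lambda>q. G (w q)) p = deriv G (w p) * pt w p"
proof -
  have "(G has_field_derivative deriv G (w p)) (at (w p))"
    using holomorphic_derivI[OF assms(2,1,3)] .
  then have "(G has_derivative (*) (deriv G (w p))) (at (w p))"
    unfolding has_field_derivative_def .
  moreover have "(w has_derivative frechet_derivative w (at p)) (at p)"
    using assms(4) by (simp only: frechet_derivative_works[symmetric])
  ultimately have *: "((\<lambda>q. G (w q)) has_derivative (\<lambda>h. deriv G (w p) * frechet_derivative w (at p) h)) (at p)"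
    by (rule has_derivative_compose[rotated])
  then show "(\<lambda>q. G (w q)) differentiable (at p)" by (rule differentiableI)
  note eq = fun_cong[OF frechet_derivative_at[OF *]]
  show "px (\<lambda>q. G (w q)) p = deriv G (w p) * px w p"
    and "pt (\<lambda>q. G (w q)) p = deriv G (w p) * pt w p"
    using eq[of "(1, 0)"] eq[of "(0, 1)"] by simp_all
qed

section \<open>Solutions on a strip and Stokes' formula\<close>

text \<open>A rectangle with lower edge on the boundary, inside the domain \<open>V\<close> of a first integral \<open>Z\<close> of
  \<open>\<partial>\<^sub>t + a \<partial>\<^sub>x\<close>. The inequality \<open>Z\<^sub>x \<noteq> 0\<close> is what \<open>dZ \<noteq> 0\<close> means for a first integral of such a field.\<close>

locale strip =
  fixes V :: "(real \<times> real) set" and a Z :: "real \<times> real \<Rightarrow> complex" and l r T :: real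
  assumes open_V: "open V" and rect_V: "{l..r} \<times> {0..T} \<subseteq> V" and l_less_r: "l < r" and T_pos: "T > 0"
    and smooth_a: "smooth_on V a" and smooth_Z: "smooth_on V Z"
    and Z_t: "\<And>p. p \<in> V \<Longrightarrow> pt Z p = - (a p * px Z p)"
    and Z_x: "\<And>p. p \<in> V \<Longrightarrow> px Z p \<noteq> 0"
begin

lemma inV: "x \<in> {l..r} \<Longrightarrow> t \<in> {0..T} \<Longrightarrow> (x, t) \<in> V"
  using rect_V by auto

lemma inV': "x \<in> {l..r} \<Longrightarrow> t \<in> {0<..T} \<Longrightarrow> (x, t) \<in> V"
  using rect_V by auto

text \<open>A \<open>C\<^sup>1\<close> solution above the lower edge, with its \<open>x\<close>-derivative \<open>gx\<close> as a second argument: derivatives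
  are taken within the closed rectangle, and primitives of solutions come with their derivative.\<close>

definition solution :: "(real \<times> real \<Rightarrow> complex) \<Rightarrow> (real \<times> real \<Rightarrow> complex) \<Rightarrow> bool" where
  "solution g gx \<longleftrightarrow> continuous_on ({l..r} \<times> {0<..T}) g \<and> continuous_on ({l..r} \<times> {0<..T}) gx \<and>
    (\<forall>x\<in>{l..r}. \<forall>t\<in>{0<..T}.
      ((\<lambda>x. g (x, t)) has_vector_derivative gx (x, t)) (at x within {l..r}) \<and>
      ((\<lambda>t. g (x, t)) has_vector_derivative - (a (x, t) * gx (x, t))) (at t within {0<..T}))"

text \<open>The half-integral exponents avoid a logarithm: integrating \<open>growth (n + 1)\<close> over \<open>[t, T]\<close> gives
  \<open>growth n t\<close> up to constants, and the last step ends with a bounded function.\<close>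

definition growth :: "nat \<Rightarrow> real \<Rightarrow> real" where
  "growth n t = (if n = 0 then 1 else t powr (1 / 2 - real n))"

definition tame :: "nat \<Rightarrow> (real \<times> real \<Rightarrow> complex) \<Rightarrow> bool" where
  "tame n g \<longleftrightarrow> (\<exists>C. \<forall>x\<in>{l..r}. \<forall>t\<in>{0<..T}. cmod (g (x, t)) \<le> C * growth n t)"

text \<open>The first integral equation differentiated in \<open>x\<close>.\<close>

lemma pt_px_Z: "p \<in> V \<Longrightarrow> pt (px Z) p = - (a p * px (px Z) p + px a p * px Z p)"
proof -
  assume p: "p \<in> V"
  have d: "(\<lambda>q. a q * px Z q) differentiable (at p)"
    by (rule smooth_on_imp_differentiable[OF smooth_on_mult[OF open_V smooth_a smooth_on_px[OF smooth_Z]] p])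
  have "px (pt Z) p = px (\<lambda>q. (- 1) * (a q * px Z q)) p"
  proof -
    have "(\<lambda>q. (- 1) * (a q * px Z q)) differentiable (at p)"
      by (rule differentiable_mult[OF differentiable_const d])
    from frechet_derivative_cong_open(2)[OF open_V p _ this, of "pt Z"] Z_t show ?thesis by auto
  qed
  also have "\<dots> = (- 1) * px (\<lambda>q. a q * px Z q) p"
    using px_mult(1)[OF differentiable_const d, of "- 1"] by (simp add: frechet_derivative_const)
  also have "px (\<lambda>q. a q * px Z q) p = a p * px (px Z) p + px a p * px Z p"
    using p by (intro px_mult smooth_on_imp_differentiable[OF _ p] smooth_on_px smooth_a smooth_Z)
  finally show ?thesis using mixed_partials[OF open_V p smooth_Z] by simp
qed

text \<open>\<open>G(Z)\<close> is again a first integral, so \<open>G(Z) Z\<^sub>x\<close> is the density of a closed form: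
  it satisfies the equation \<open>k\<^sub>t + (a k)\<^sub>x = 0\<close> adjoint to \<open>Lf = 0\<close>.\<close>

lemma conservation_law:
  fixes G W
  defines "k \<equiv> \<lambda>p. G (Z p) * px Z p" and "V1 \<equiv> {p \<in> V. Z p \<in> W}"
  assumes W: "open W" "G holomorphic_on W"
  shows "open V1" "smooth_on V1 k" "\<And>p. p \<in> V1 \<Longrightarrow> pt k p = - px (\<lambda>q. a q * k q) p"
proof -
  have V1_eq: "V1 = V \<inter> Z -` W" by (auto simp: V1_def)
  show V1: "open V1"
    unfolding V1_eq using smooth_on_imp_continuous_on[OF smooth_Z] continuous_open_preimage open_V W(1) by blast
  have sub: "V1 \<subseteq> V" by (auto simp: V1_def)
  note sm = smooth_on_subset[OF smooth_Z sub] smooth_on_subset[OF smooth_on_px[OF smooth_Z] sub]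
    smooth_on_subset[OF smooth_a sub]
  show k: "smooth_on V1 k"
    unfolding k_def by (intro smooth_on_mult V1 sm smooth_on_holomorphic[OF V1 W]) (auto simp: V1_def)
  show "pt k p = - px (\<lambda>q. a q * k q) p" if p: "p \<in> V1" for p
  proof -
    have pV: "p \<in> V" "Z p \<in> W" using p by (auto simp: V1_def)
    note d = smooth_on_imp_differentiable[OF _ p]
    note GZ = holomorphic_compose_partials[OF W pV(2) d[OF sm(1)]]
    have "px k p = G (Z p) * px (px Z) p + deriv G (Z p) * px Z p * px Z p"
      unfolding k_def by (subst px_mult(1)[OF GZ(1) d[OF sm(2)]]) (simp add: GZ)
    moreover have "pt k p = G (Z p) * pt (px Z) p + deriv G (Z p) * pt Z p * px Z p"
      unfolding k_def by (subst px_mult(2)[OF GZ(1) d[OF sm(2)]]) (simp add: GZ)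
    moreover have "px (\<lambda>q. a q * k q) p = a p * px k p + px a p * k p"
      by (intro px_mult d sm k)
    ultimately show ?thesis
      by (simp add: pt_px_Z[OF pV(1)] Z_t[OF pV(1)] k_def algebra_simps)
  qed
qed

text \<open>The integrand on the right is the sum of \<open>Q = \<partial>\<^sub>t (g \<psi> k)\<close> and \<open>D = \<partial>\<^sub>x (g \<psi> a k)\<close>, because the terms
  without \<open>\<psi>'\<close> cancel by the equations for \<open>g\<close> and \<open>k\<close>. The first is integrated in \<open>t\<close>; the second, integrated in
  \<open>x\<close>, vanishes since \<open>\<psi>\<close> is \<open>0\<close> at both ends.\<close>

lemma Stokes:
  fixes k :: "real \<times> real \<Rightarrow> complex" and \<psi> \<psi>' :: "real \<Rightarrow> complex"
  assumes g: "solution g gx" and V1: "open V1" and k: "smooth_on V1 k" "V1 \<subseteq> V"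
    and kt: "\<And>p. p \<in> V1 \<Longrightarrow> pt k p = - px (\<lambda>q. a q * k q) p"
    and s: "0 < s0" "s0 \<le> s1" "s1 \<le> T" and rect: "{l..r} \<times> {s0..s1} \<subseteq> V1"
    and \<psi>: "\<And>x. x \<in> {l..r} \<Longrightarrow> (\<psi> has_vector_derivative \<psi>' x) (at x within {l..r})"
    and cont_\<psi>': "continuous_on {l..r} \<psi>'" and ends: "\<psi> l = 0" "\<psi> r = 0"
  shows "integral {l..r} (\<lambda>x. g (x, s1) * (\<psi> x * k (x, s1))) - integral {l..r} (\<lambda>x. g (x, s0) * (\<psi> x * k (x, s0)))
    = integral (cbox (l, s0) (r, s1)) (\<lambda>p. g p * (a p * \<psi>' (fst p) * k p))"
proof -
  let ?B = "cbox (l, s0) (r, s1)"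
  have B: "?B = {l..r} \<times> {s0..s1}" by (simp add: cbox_Pair_eq)
  let ?k' = "px (\<lambda>q. a q * k q)"
  define Q where "Q p = - (a p * gx p) * (\<psi> (fst p) * k p) - g p * (\<psi> (fst p) * ?k' p)" for p
  define D where "D p = g p * (\<psi>' (fst p) * (a p * k p) + \<psi> (fst p) * ?k' p) + gx p * (\<psi> (fst p) * (a p * k p))" for p
  have sub: "{l..r} \<times> {s0..s1} \<subseteq> {l..r} \<times> {0<..T}" using s by auto
  have ak: "smooth_on V1 (\<lambda>q. a q * k q)"
    by (intro smooth_on_mult V1 k smooth_on_subset[OF smooth_a])
  have cont_\<psi>: "continuous_on {l..r} \<psi>"
    using \<psi> by (meson continuous_on_eq_continuous_within has_vector_derivative_continuous)
  have cg: "continuous_on ?B g" "continuous_on ?B gx"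
    using g continuous_on_subset[OF _ sub] unfolding solution_def B by blast+
  have ck: "continuous_on ?B a" "continuous_on ?B k" "continuous_on ?B ?k'"
    using smooth_on_imp_continuous_on[OF k(1)] smooth_on_imp_continuous_on[OF smooth_on_px[OF ak]]
      smooth_on_imp_continuous_on[OF smooth_on_subset[OF smooth_a k(2)]]
      continuous_on_subset[OF _ rect] unfolding B by blast+
  have c\<psi>: "continuous_on ?B (\<lambda>p. \<psi> (fst p))" "continuous_on ?B (\<lambda>p. \<psi>' (fst p))"
    unfolding B by (intro continuous_on_compose2[OF cont_\<psi>] continuous_on_compose2[OF cont_\<psi>'] continuous_intros; force)+
  have cQ: "continuous_on ?B Q" and cD: "continuous_on ?B D"
    unfolding Q_def D_def by (intro continuous_intros cg ck c\<psi>)+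
  have diff: "v differentiable (at (x, t))" if "smooth_on V1 v" "x \<in> {l..r}" "t \<in> {s0..s1}" for v :: "real \<times> real \<Rightarrow> complex" and x t
    using smooth_on_imp_differentiable[OF that(1)] that rect by blast
  let ?q = "\<lambda>t x. g (x, t) * (\<psi> x * k (x, t))"
  have intQ: "integral {s0..s1} (\<lambda>t. Q (x, t)) = ?q s1 x - ?q s0 x" if x: "x \<in> {l..r}" for x
  proof (rule integral_unique, rule fundamental_theorem_of_calculus[OF s(2)])
    fix t assume t: "t \<in> {s0..s1}"
    have "((\<lambda>t. g (x, t)) has_vector_derivative - (a (x, t) * gx (x, t))) (at t within {0<..T})"
      using g x t s by (auto simp: solution_def)
    then have "((\<lambda>t. g (x, t)) has_vector_derivative - (a (x, t) * gx (x, t))) (at t within {s0..s1})"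
      by (rule has_vector_derivative_within_subset) (use s in auto)
    moreover have "((\<lambda>t. \<psi> x * k (x, t)) has_vector_derivative \<psi> x * - ?k' (x, t)) (at t within {s0..s1})"
    proof -
      have "(x, t) \<in> V1" using rect x t by auto
      from has_vector_derivative_mult_right[OF has_vector_derivative_pt[OF diff[OF k(1) x t]], of "\<psi> x"] kt[OF this]
      show ?thesis by simp
    qed
    ultimately show "((\<lambda>t. ?q t x) has_vector_derivative Q (x, t)) (at t within {s0..s1})"
      by (rule has_vector_derivative_eq_rhs[OF has_vector_derivative_mult]) (simp add: Q_def)
  qed
  have intD: "integral {l..r} (\<lambda>x. D (x, t)) = 0" if t: "t \<in> {s0..s1}" for t
  proof -
    have "((\<lambda>x. D (x, t)) has_integral g (r, t) * (\<psi> r * (a (r, t) * k (r, t))) - g (l, t) * (\<psi> l * (a (l, t) * k (l, t)))) {l..r}"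
    proof (rule fundamental_theorem_of_calculus)
      fix x assume x: "x \<in> {l..r}"
      have "((\<lambda>x. g (x, t)) has_vector_derivative gx (x, t)) (at x within {l..r})"
        using g x t s by (auto simp: solution_def)
      moreover have "((\<lambda>x. \<psi> x * (a (x, t) * k (x, t))) has_vector_derivative
          \<psi> x * ?k' (x, t) + \<psi>' x * (a (x, t) * k (x, t))) (at x within {l..r})"
        by (rule has_vector_derivative_mult[OF \<psi>[OF x] has_vector_derivative_px[OF diff[OF ak x t]]])
      ultimately show "((\<lambda>x. g (x, t) * (\<psi> x * (a (x, t) * k (x, t)))) has_vector_derivative D (x, t)) (at x within {l..r})"
        by (rule has_vector_derivative_eq_rhs[OF has_vector_derivative_mult]) (simp add: D_def algebra_simps)
    qed (use l_less_r in simp)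
    then show ?thesis using ends by (simp add: integral_unique)
  qed
  have "integral ?B Q = integral {l..r} (\<lambda>x. integral {s0..s1} (\<lambda>t. Q (x, t)))"
    using integral_prod_continuous[OF cQ] by simp
  also have "\<dots> = integral {l..r} (\<lambda>x. ?q s1 x - ?q s0 x)"
    by (intro integral_cong intQ)
  also have "\<dots> = integral {l..r} (?q s1) - integral {l..r} (?q s0)"
  proof (rule integral_diff)
    have "?q t integrable_on {l..r}" if "t \<in> {s0..s1}" for t
    proof (rule integrable_continuous_real, intro continuous_on_mult cont_\<psi>)
      show "continuous_on {l..r} (\<lambda>x. g (x, t))" "continuous_on {l..r} (\<lambda>x. k (x, t))"
        using that by (intro continuous_on_horizontal[OF cg(1)] continuous_on_horizontal[OF ck(2)]; simp add: B)+
    qed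
    then show "?q s1 integrable_on {l..r}" "?q s0 integrable_on {l..r}" using s by auto
  qed
  finally have Q: "integral ?B Q = integral {l..r} (?q s1) - integral {l..r} (?q s0)" .
  have "integral ?B D = integral {l..r} (\<lambda>x. integral {s0..s1} (\<lambda>t. D (x, t)))"
    using integral_prod_continuous[OF cD] by simp
  also have "\<dots> = integral {s0..s1} (\<lambda>t. integral {l..r} (\<lambda>x. D (x, t)))"
    using integral_swap_continuous[of l s0 r s1 "\<lambda>x t. D (x, t)"] cD by (simp add: case_prod_eta)
  also have "\<dots> = integral {s0..s1} (\<lambda>t. 0)"
    by (intro integral_cong intD)
  finally have D: "integral ?B D = 0" by simp
  have "integral ?B (\<lambda>p. g p * (a p * \<psi>' (fst p) * k p)) = integral ?B (\<lambda>p. Q p + D p)"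
    by (intro integral_cong) (simp add: Q_def D_def algebra_simps)
  also have "\<dots> = integral ?B Q + integral ?B D"
    by (intro integral_add integrable_continuous cQ cD)
  finally show ?thesis using Q D by simp
qed

end

section \<open>Primitives gain a power of time\<close>

context strip
begin

lemma continuous_on_rect: "smooth_on V w \<Longrightarrow> continuous_on ({l..r} \<times> {0..T}) w"
  using smooth_on_imp_continuous_on continuous_on_subset rect_V by blast

lemma bounded_rect:
  fixes w :: "real \<times> real \<Rightarrow> complex"
  assumes "smooth_on V w"
  obtains B where "B > 0" "\<And>x t. x \<in> {l..r} \<Longrightarrow> t \<in> {0..T} \<Longrightarrow> cmod (w (x, t)) \<le> B"
proof -
  have "compact (w ` ({l..r} \<times> {0..T}))"
    using continuous_on_rect[OF assms] by (intro compact_continuous_image compact_Times) auto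
  then obtain B where "B > 0" "\<forall>y\<in>w ` ({l..r} \<times> {0..T}). norm y \<le> B"
    using compact_imp_bounded bounded_pos by blast
  then show ?thesis using that by (metis SigmaI imageI)
qed

lemma growth_integral:
  "\<exists>K. \<forall>t\<in>{0<..T}. \<exists>I. ((growth (Suc n)) has_integral I) {t..T} \<and> I \<le> K * growth n t"
proof -
  define b where "b = 1 / 2 - real n"
  have b: "b \<noteq> 0"
  proof
    assume "b = 0"
    then have "real (2 * n) = real 1" by (simp add: b_def)
    then have "2 * n = 1" by (simp only: of_nat_eq_iff)
    then show False by presburger
  qed
  have *: "(growth (Suc n) has_integral T powr b / b - t powr b / b) {t..T}" if t: "t \<in> {0<..T}" for t
  proof (rule fundamental_theorem_of_calculus)
    fix x assume "x \<in> {t..T}"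
    then have x: "x > 0" using t by auto
    have "((\<lambda>x. x powr b / b) has_real_derivative b * x powr (b - 1) / b) (at x within {t..T})"
      using x by (intro DERIV_cdivide has_real_derivative_powr[THEN has_field_derivative_at_within])
    then show "((\<lambda>x. x powr b / b) has_vector_derivative growth (Suc n) x) (at x within {t..T})"
    proof -
      have "1 / 2 - real (Suc n) = b - 1" by (simp add: b_def)
      then have "growth (Suc n) x = b * x powr (b - 1) / b" using b by (simp add: growth_def del: of_nat_Suc)
      then show ?thesis
        using \<open>(_ has_real_derivative _) _\<close> by (simp add: has_real_derivative_iff_has_vector_derivative)
    qed
  qed (use t in auto)
  show ?thesis
  proof (cases "n = 0")
    case True
    then have "T powr b / b - t powr b / b \<le> T powr b / b * growth n t" for t
      by (simp add: growth_def b_def)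
    then show ?thesis using * by blast
  next
    case False
    then have "b < 0" by (simp add: b_def)
    then have "T powr b / b \<le> 0" by (simp add: divide_nonneg_neg)
    then have "T powr b / b - t powr b / b \<le> (- 1 / b) * growth n t" for t
      using False by (simp add: growth_def b_def)
    then show ?thesis using * by blast
  qed
qed

text \<open>The closed form \<open>g dZ\<close> has a primitive, whose \<open>t\<close>-derivative is of the size of \<open>g\<close>: integrating it in
  \<open>t\<close> gains one power of \<open>t\<close>.\<close>

lemma primitive:
  assumes g: "solution g gx"
  obtains F where "solution F (\<lambda>p. g p * px Z p)" "\<And>n. tame (Suc n) g \<Longrightarrow> tame n F"
proof -
  let ?R = "{l..r} \<times> {0<..T}"
  have subR: "?R \<subseteq> {l..r} \<times> {0..T}" by auto
  define h where "h p = a p * (g p * px Z p)" for p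
  define hx where "hx p = g p * px (\<lambda>q. a q * px Z q) p + gx p * (a p * px Z p)" for p
  have aZ: "smooth_on V (\<lambda>q. a q * px Z q)"
    by (rule smooth_on_mult[OF open_V smooth_a smooth_on_px[OF smooth_Z]])
  note cV = continuous_on_subset[OF continuous_on_rect subR]
  have cg: "continuous_on ?R g" "continuous_on ?R gx" using g by (auto simp: solution_def)
  have cont: "continuous_on ?R h" "continuous_on ?R hx" "continuous_on ?R (\<lambda>p. g p * px Z p)"
    unfolding h_def hx_def
    by (intro continuous_intros cg cV[OF smooth_a] cV[OF smooth_on_px[OF smooth_Z]] cV[OF smooth_on_px[OF aZ]])+
  \<comment> \<open>\<open>F\<close> integrates \<open>g dZ\<close> along the top edge and then down to height \<open>t\<close>\<close>
  define A where "A x = integral {l..x} (\<lambda>y. g (y, T) * px Z (y, T))" for x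
  define F where "F p = A (fst p) + integral {snd p..T} (\<lambda>\<sigma>. h (fst p, \<sigma>))" for p
  have gZ: "continuous_on {l..r} (\<lambda>y. g (y, T) * px Z (y, T))"
    using T_pos by (intro continuous_on_horizontal[OF cont(3)]) auto
  have hv: "continuous_on {s..T} (\<lambda>\<sigma>. h (x, \<sigma>))" if "x \<in> {l..r}" "s > 0" for x s
    using that by (intro continuous_on_vertical[OF cont(1)]) auto
  have A': "(A has_vector_derivative g (x, T) * px Z (x, T)) (at x within {l..r})" if "x \<in> {l..r}" for x
    unfolding A_def using integral_has_vector_derivative[OF gZ that] .
  have Ft: "((\<lambda>t. F (x, t)) has_vector_derivative - h (x, t)) (at t within {0<..T})"
    if x: "x \<in> {l..r}" and t: "t \<in> {0<..T}" for x t
  proof -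
    have "((\<lambda>u. integral {u..T} (\<lambda>\<sigma>. h (x, \<sigma>))) has_vector_derivative - h (x, t)) (at t within {t/2..T})"
      using t by (intro integral_has_vector_derivative' hv[OF x]) auto
    moreover have "at t within {t/2..T} = at t within {0<..T}"
      using t by (intro at_within_nhd[of _ "{t/2<..}"]) auto
    ultimately have "((\<lambda>u. A x + integral {u..T} (\<lambda>\<sigma>. h (x, \<sigma>))) has_vector_derivative 0 + - h (x, t)) (at t within {0<..T})"
      by (intro has_vector_derivative_add has_vector_derivative_const) simp
    then show ?thesis by (simp add: F_def)
  qed
  \<comment> \<open>closedness of \<open>g dZ\<close>: \<open>hx = - \<partial>\<^sub>t (g Z\<^sub>x)\<close>\<close>
  have gt: "integral {t..T} (\<lambda>\<sigma>. hx (x, \<sigma>)) = g (x, t) * px Z (x, t) - g (x, T) * px Z (x, T)"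
    if x: "x \<in> {l..r}" and t: "t \<in> {0<..T}" for x t
  proof -
    have "((\<lambda>\<sigma>. - hx (x, \<sigma>)) has_integral g (x, T) * px Z (x, T) - g (x, t) * px Z (x, t)) {t..T}"
    proof (rule fundamental_theorem_of_calculus)
      fix s assume s: "s \<in> {t..T}"
      have p: "(x, s) \<in> V" using x s t by (intro inV) auto
      have "((\<lambda>t. g (x, t)) has_vector_derivative - (a (x, s) * gx (x, s))) (at s within {0<..T})"
        using g x s t by (auto simp: solution_def)
      then have D1: "((\<lambda>t. g (x, t)) has_vector_derivative - (a (x, s) * gx (x, s))) (at s within {t..T})"
        by (rule has_vector_derivative_within_subset) (use t in auto)
      have D2: "((\<lambda>t. px Z (x, t)) has_vector_derivative pt (px Z) (x, s)) (at s within {t..T})"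
        by (rule has_vector_derivative_pt[OF smooth_on_imp_differentiable[OF smooth_on_px[OF smooth_Z] p]])
      have akx: "px (\<lambda>q. a q * px Z q) (x, s) = - pt (px Z) (x, s)"
        using px_mult(1)[OF smooth_on_imp_differentiable[OF smooth_a p] smooth_on_imp_differentiable[OF smooth_on_px[OF smooth_Z] p]]
          pt_px_Z[OF p] by simp
      show "((\<lambda>t. g (x, t) * px Z (x, t)) has_vector_derivative - hx (x, s)) (at s within {t..T})"
        using has_vector_derivative_mult[OF D1 D2] by (simp add: hx_def akx algebra_simps)
    qed (use t in auto)
    from integral_unique[OF has_integral_neg[OF this]] show ?thesis by simp
  qed
  have Fx: "((\<lambda>x. F (x, t)) has_vector_derivative g (x, t) * px Z (x, t)) (at x within {l..r})"
    if x: "x \<in> {l..r}" and t: "t \<in> {0<..T}" for x t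
  proof -
    have "((\<lambda>x. integral (cbox t T) (\<lambda>\<sigma>. h (x, \<sigma>))) has_vector_derivative integral (cbox t T) (\<lambda>\<sigma>. hx (x, \<sigma>))) (at x within {l..r})"
    proof (rule leibniz_rule_vector_derivative[where U = "{l..r}" and f = "\<lambda>x \<sigma>. h (x, \<sigma>)"])
      fix y s assume y: "y \<in> {l..r}" and s: "s \<in> cbox t T"
      have p: "(y, s) \<in> V" using y s t by (intro inV) auto
      have "((\<lambda>x. g (x, s)) has_vector_derivative gx (y, s)) (at y within {l..r})"
        using g y s t by (auto simp: solution_def)
      from has_vector_derivative_mult[OF this has_vector_derivative_px[OF smooth_on_imp_differentiable[OF aZ p]]]
      show "((\<lambda>x. h (x, s)) has_vector_derivative hx (y, s)) (at y within {l..r})"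
        by (simp add: h_def hx_def algebra_simps)
    next
      show "(\<lambda>\<sigma>. h (y, \<sigma>)) integrable_on cbox t T" if "y \<in> {l..r}" for y
        using hv[OF that] t by (intro integrable_continuous) simp
      show "continuous_on ({l..r} \<times> cbox t T) (\<lambda>(x, s). hx (x, s))"
        using continuous_on_subset[OF cont(2), of "{l..r} \<times> cbox t T"] t by (simp add: case_prod_eta subset_iff)
    qed (use x in auto)
    from has_vector_derivative_add[OF A'[OF x] this] show ?thesis
      using gt[OF x t] by (simp add: F_def)
  qed
  have "continuous_on ?R F"
  proof (rule continuous_on_partialsI[where fx = "\<lambda>p. g p * px Z p" and fy = "\<lambda>p. - h p"])
    show "continuous_on ?R (\<lambda>p. - h p)" using cont(1) by (rule continuous_on_minus)
  qed (simp_all only: Fx Ft convex_real_interval)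
  then have sol: "solution F (\<lambda>p. g p * px Z p)"
    unfolding solution_def using Fx Ft cont(3) by (simp add: h_def)
  have tame: "tame n F" if tg: "tame (Suc n) g" for n
  proof -
    obtain C where C: "\<And>x t. x \<in> {l..r} \<Longrightarrow> t \<in> {0<..T} \<Longrightarrow> cmod (g (x, t)) \<le> C * growth (Suc n) t"
      using tg unfolding tame_def by blast
    obtain B where B: "B > 0" "\<And>x t. x \<in> {l..r} \<Longrightarrow> t \<in> {0..T} \<Longrightarrow> cmod (a (x, t) * px Z (x, t)) \<le> B"
      using bounded_rect[OF aZ] by metis
    obtain K where K: "\<And>t. t \<in> {0<..T} \<Longrightarrow> \<exists>I. ((growth (Suc n)) has_integral I) {t..T} \<and> I \<le> K * growth n t"
      using growth_integral by blast
    have "compact (A ` {l..r})"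
      using has_vector_derivative_continuous[OF A']
      by (intro compact_continuous_image) (auto simp: continuous_on_eq_continuous_within)
    then obtain B0 where B0': "B0 > 0" "\<forall>y\<in>A ` {l..r}. norm y \<le> B0"
      using compact_imp_bounded bounded_pos by blast
    then have B0: "B0 > 0" "\<And>x. x \<in> {l..r} \<Longrightarrow> cmod (A x) \<le> B0" by auto
    have gpos: "growth m t > 0" if "t > 0" for m t using that by (simp add: growth_def)
    have C0: "0 \<le> C"
    proof -
      have "0 \<le> C * growth (Suc n) T" using order_trans[OF norm_ge_zero C[of l T]] l_less_r T_pos by simp
      then show ?thesis using gpos[OF T_pos, of "Suc n"] by (auto simp: zero_le_mult_iff)
    qed
    obtain c where c: "c > 0" "\<And>t. t \<in> {0<..T} \<Longrightarrow> c \<le> growth n t"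
    proof (cases "n = 0")
      case False
      show ?thesis
      proof (rule that[of "T powr (1/2 - n)"])
        show "T powr (1/2 - n) \<le> growth n t" if "t \<in> {0<..T}" for t
          using that False by (auto simp: growth_def intro!: powr_mono2')
      qed (use T_pos in auto)
    next
      case True
      show ?thesis by (rule that[of 1]) (simp_all add: True growth_def)
    qed
    have "cmod (F (x, t)) \<le> (B0 / c + C * B * K) * growth n t" if x: "x \<in> {l..r}" and t: "t \<in> {0<..T}" for x t
    proof -
      obtain I where I: "(growth (Suc n) has_integral I) {t..T}" "I \<le> K * growth n t" using K[OF t] by blast
      have "cmod (integral {t..T} (\<lambda>\<sigma>. h (x, \<sigma>))) \<le> integral {t..T} (\<lambda>\<sigma>. C * B * growth (Suc n) \<sigma>)"
      proof (rule integral_norm_bound_integral)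
        show "(\<lambda>\<sigma>. h (x, \<sigma>)) integrable_on {t..T}"
          using t by (intro integrable_continuous_real hv x) auto
        show "(\<lambda>\<sigma>. C * B * growth (Suc n) \<sigma>) integrable_on {t..T}"
          using has_integral_mult_right[OF I(1), of "C * B"] by (rule has_integral_integrable)
        fix s assume s: "s \<in> {t..T}"
        have "cmod (h (x, s)) = cmod (g (x, s)) * cmod (a (x, s) * px Z (x, s))"
          by (simp add: h_def norm_mult)
        also have "\<dots> \<le> (C * growth (Suc n) s) * B"
        proof (rule mult_mono)
          show "cmod (g (x, s)) \<le> C * growth (Suc n) s" using s t by (intro C x) auto
          show "cmod (a (x, s) * px Z (x, s)) \<le> B" using s t by (intro B(2) x) auto
          show "0 \<le> C * growth (Suc n) s" using C0 gpos[of s "Suc n"] s t by simp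
        qed simp
        finally show "cmod (h (x, s)) \<le> C * B * growth (Suc n) s" by (simp add: algebra_simps)
      qed
      also have "\<dots> = C * B * I" using I(1) by (simp add: integral_unique)
      also have "\<dots> \<le> C * B * (K * growth n t)" using I(2) C0 B(1) by (intro mult_left_mono) auto
      finally have 1: "cmod (integral {t..T} (\<lambda>\<sigma>. h (x, \<sigma>))) \<le> C * B * K * growth n t" by simp
      have "B0 \<le> B0 / c * growth n t" using c(1) c(2)[OF t] B0(1) by (simp add: field_simps)
      then have "cmod (A x) \<le> B0 / c * growth n t" using B0(2)[OF x] by linarith
      then show ?thesis
        using 1 norm_triangle_ineq[of "A x" "integral {t..T} (\<lambda>\<sigma>. h (x, \<sigma>))"]
        by (simp add: F_def distrib_right)
    qed
    then show ?thesis unfolding tame_def by blast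
  qed
  show ?thesis
  proof (rule that[of F])
    show "solution F (\<lambda>p. g p * px Z p)" by (fact sol)
    show "\<And>n. tame (Suc n) g \<Longrightarrow> tame n F" by (fact tame)
  qed
qed

end

section \<open>Pairings of a solution with holomorphic densities\<close>

lemma open_plane_horizontal:
  fixes V :: "(real \<times> real) set"
  assumes "open V" "(x, t) \<in> V"
  obtains e where "e > 0" "\<And>y. \<bar>y - x\<bar> \<le> e \<Longrightarrow> (y, t) \<in> V"
proof -
  obtain e where e: "e > 0" "cball (x, t) e \<subseteq> V" using assms open_contains_cball by blast
  have "(y, t) \<in> V" if "\<bar>y - x\<bar> \<le> e" for y
  proof -
    have "dist (x, t) (y, t) = \<bar>y - x\<bar>" by (simp add: dist_Pair_Pair dist_real_def abs_minus_commute)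
    then show ?thesis using e(2) that by auto
  qed
  then show ?thesis using e(1) that by blast
qed

lemma px_eq_0:
  assumes V: "open V" "(x, t) \<in> V" and w: "smooth_on V w"
    and zero: "(\<forall>y\<ge>x. (y, t) \<in> V \<longrightarrow> w (y, t) = 0) \<or> (\<forall>y\<le>x. (y, t) \<in> V \<longrightarrow> w (y, t) = 0)"
  shows "px w (x, t) = 0"
proof -
  obtain e where e: "e > 0" "\<And>y. \<bar>y - x\<bar> \<le> e \<Longrightarrow> (y, t) \<in> V"
    using open_plane_horizontal[OF V] by metis
  obtain c d where cd: "c < d" "x \<in> cbox c d" "\<And>y. y \<in> cbox c d \<Longrightarrow> w (y, t) = 0"
    using zero
  proof
    assume "\<forall>y\<ge>x. (y, t) \<in> V \<longrightarrow> w (y, t) = 0"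
    then show ?thesis using e by (intro that[of x "x + e"]) auto
  next
    assume "\<forall>y\<le>x. (y, t) \<in> V \<longrightarrow> w (y, t) = 0"
    then show ?thesis using e by (intro that[of "x - e" x]) auto
  qed
  have "((\<lambda>y. w (y, t)) has_vector_derivative px w (x, t)) (at x within cbox c d)"
    by (rule has_vector_derivative_px[OF smooth_on_imp_differentiable[OF w V(2)]])
  moreover have "((\<lambda>y. w (y, t)) has_vector_derivative 0) (at x within cbox c d)"
    by (rule has_vector_derivative_transform[OF cd(2) cd(3) has_vector_derivative_const])
  ultimately show ?thesis by (rule vector_derivative_unique_within_closed_interval[OF cd(1,2)])
qed

text \<open>For cutoffs: a function supported in \<open>{c<..<d}\<close> has an \<open>x\<close>-derivative supported there, including at the
  end points, where one side decides.\<close>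

lemma px_eq_0_outside:
  assumes V: "open V" and w: "smooth_on V w"
    and zero: "\<forall>p\<in>V. fst p \<notin> {c<..<d} \<longrightarrow> w p = 0"
  shows "\<forall>p\<in>V. fst p \<notin> {c<..<d} \<longrightarrow> px w p = 0"
proof (intro ballI impI)
  fix p assume p: "p \<in> V" "fst p \<notin> {c<..<d}"
  then obtain x t where xt: "p = (x, t)" "x \<le> c \<or> x \<ge> d" by (cases p) auto
  show "px w p = 0"
    unfolding xt(1) using p xt zero by (intro px_eq_0[OF V _ w]) auto
qed

context strip
begin

lemma tameE:
  assumes "tame n g"
  obtains C where "C \<ge> 0" "\<And>x t. x \<in> {l..r} \<Longrightarrow> t \<in> {0<..T} \<Longrightarrow> cmod (g (x, t)) \<le> C * growth n t"
proof -
  obtain C where C: "\<And>x t. x \<in> {l..r} \<Longrightarrow> t \<in> {0<..T} \<Longrightarrow> cmod (g (x, t)) \<le> C * growth n t"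
    using assms unfolding tame_def by blast
  have "cmod (g (x, t)) \<le> \<bar>C\<bar> * growth n t" if "x \<in> {l..r}" "t \<in> {0<..T}" for x t
  proof -
    have "growth n t \<ge> 0" by (simp add: growth_def)
    then have "C * growth n t \<le> \<bar>C\<bar> * growth n t" by (intro mult_right_mono) auto
    then show ?thesis using C[OF that] by linarith
  qed
  then show ?thesis using that[of "\<bar>C\<bar>"] by simp
qed

lemma smooth_inverse_Z_x: "smooth_on V (\<lambda>p. inverse (px Z p))"
  by (rule smooth_on_holomorphic[OF open_V _ _ _ smooth_on_px[OF smooth_Z], of "- {0}"])
    (auto intro!: holomorphic_intros simp: Z_x open_Compl)

lemma solution_slice:
  assumes "solution g gx" "t \<in> {0<..T}"
  shows "continuous_on {l..r} (\<lambda>x. g (x, t))"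
  using assms by (intro continuous_on_horizontal[of "{l..r} \<times> {0<..T}"]) (auto simp: solution_def)

lemma smooth_slice:
  assumes "smooth_on V w" "t \<in> {0..T}"
  shows "continuous_on {l..r} (\<lambda>x. w (x, t))"
  using assms by (intro continuous_on_horizontal[OF continuous_on_rect[OF assms(1)]]) auto

text \<open>\<open>C\<close> bounds the pairings of \<open>g v\<close> with all densities \<open>G(Z) Z\<^sub>x\<close>, at all times, in terms of the supremum \<open>B\<close>
  of the derivatives of \<open>G\<close> up to order \<open>n\<close> along the level curve. The bound is uniform in \<open>G\<close> and \<open>t\<close>.\<close>

definition pairing_le :: "nat \<Rightarrow> real \<Rightarrow> real \<Rightarrow> (real \<times> real \<Rightarrow> complex) \<Rightarrow> (real \<times> real \<Rightarrow> complex) \<Rightarrow> real \<Rightarrow> bool" where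
  "pairing_le n c d g v C \<longleftrightarrow>
    (\<forall>W G B t. open W \<longrightarrow> G holomorphic_on W \<longrightarrow> t \<in> {0<..T} \<longrightarrow> (\<forall>x\<in>{c..d}. Z (x, t) \<in> W) \<longrightarrow>
      (\<forall>i\<le>n. \<forall>x\<in>{c..d}. cmod ((deriv ^^ i) G (Z (x, t))) \<le> B) \<longrightarrow>
      cmod (integral {c..d} (\<lambda>x. g (x, t) * (v (x, t) * (G (Z (x, t)) * px Z (x, t))))) \<le> C * B)"

lemma pairing_leD:
  assumes "pairing_le n c d g v C" "open W" "G holomorphic_on W" "t \<in> {0<..T}" "\<forall>x\<in>{c..d}. Z (x, t) \<in> W"
    "\<forall>i\<le>n. \<forall>x\<in>{c..d}. cmod ((deriv ^^ i) G (Z (x, t))) \<le> B"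
  shows "cmod (integral {c..d} (\<lambda>x. g (x, t) * (v (x, t) * (G (Z (x, t)) * px Z (x, t))))) \<le> C * B"
  using assms unfolding pairing_le_def by blast

text \<open>Replacing \<open>g\<close> by a primitive costs one derivative of \<open>G\<close> and gains one power of \<open>t\<close>. After \<open>n\<close> steps the
  primitive is bounded, and its pairings are bounded down to \<open>t = 0\<close>.\<close>

lemma pairing_bound:
  assumes cd: "l \<le> c" "c < d" "d \<le> r"
  shows "solution g gx \<Longrightarrow> tame n g \<Longrightarrow> smooth_on V v \<Longrightarrow> (\<forall>p\<in>V. fst p \<notin> {c<..<d} \<longrightarrow> v p = 0) \<Longrightarrow>
    \<exists>C\<ge>0. pairing_le n c d g v C"
proof (induction n arbitrary: g gx v)
  case 0
  obtain C where C: "C \<ge> 0" "\<And>x t. x \<in> {l..r} \<Longrightarrow> t \<in> {0<..T} \<Longrightarrow> cmod (g (x, t)) \<le> C * growth 0 t"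
    using tameE[OF 0(2)] by metis
  have vZ: "smooth_on V (\<lambda>p. v p * px Z p)"
    by (rule smooth_on_mult[OF open_V 0(3) smooth_on_px[OF smooth_Z]])
  obtain D where D: "D > 0" "\<And>x t. x \<in> {l..r} \<Longrightarrow> t \<in> {0..T} \<Longrightarrow> cmod (v (x, t) * px Z (x, t)) \<le> D"
    using bounded_rect[OF vZ] by metis
  have "pairing_le 0 c d g v (C * D * (d - c))"
    unfolding pairing_le_def
  proof (intro allI impI)
    fix W G B t
    assume W: "open W" "G holomorphic_on W" and t: "t \<in> {0<..T}" and ZW: "\<forall>x\<in>{c..d}. Z (x, t) \<in> W"
      and B: "\<forall>i\<le>0. \<forall>x\<in>{c..d}. cmod ((deriv ^^ i) G (Z (x, t))) \<le> B"
    have sub: "{c..d} \<subseteq> {l..r}" using cd by auto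
    note cs = continuous_on_subset[OF smooth_slice sub]
    have t': "t \<in> {0..T}" using t by auto
    have "cmod (integral {c..d} (\<lambda>x. g (x, t) * (v (x, t) * (G (Z (x, t)) * px Z (x, t))))) \<le> C * D * B * (d - c)"
    proof (rule integral_bound)
      show "continuous_on {c..d} (\<lambda>x. g (x, t) * (v (x, t) * (G (Z (x, t)) * px Z (x, t))))"
      proof (intro continuous_on_mult)
        show "continuous_on {c..d} (\<lambda>x. G (Z (x, t)))"
          using continuous_on_compose2[OF holomorphic_on_imp_continuous_on[OF W(2)] cs[OF smooth_Z t']] ZW by auto
      qed (rule continuous_on_subset[OF solution_slice[OF 0(1) t] sub] cs[OF 0(3) t'] cs[OF smooth_on_px[OF smooth_Z] t'])+
      fix x assume x: "x \<in> {c..d}"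
      have "cmod (g (x, t) * (v (x, t) * (G (Z (x, t)) * px Z (x, t))))
          = cmod (g (x, t)) * cmod (v (x, t) * px Z (x, t)) * cmod (G (Z (x, t)))"
        by (simp add: norm_mult)
      also have "\<dots> \<le> C * D * B"
      proof (intro mult_mono)
        show "cmod (g (x, t)) \<le> C" using C(2)[of x t] x sub t by (auto simp: growth_def)
        show "cmod (v (x, t) * px Z (x, t)) \<le> D" using D(2)[of x t] x sub t by auto
        show "cmod (G (Z (x, t))) \<le> B" using B x by auto
      qed (use C D in auto)
      finally show "cmod (g (x, t) * (v (x, t) * (G (Z (x, t)) * px Z (x, t)))) \<le> C * D * B" .
    qed (use cd in auto)
    then show "cmod (integral {c..d} (\<lambda>x. g (x, t) * (v (x, t) * (G (Z (x, t)) * px Z (x, t))))) \<le> C * D * (d - c) * B"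
      by (simp add: algebra_simps)
  qed
  moreover have "C * D * (d - c) \<ge> 0" using C D cd by simp
  ultimately show ?case by blast
next
  case (Suc n)
  obtain F where F: "solution F (\<lambda>p. g p * px Z p)" and "\<And>n. tame (Suc n) g \<Longrightarrow> tame n F"
    using primitive[OF Suc.prems(1)] by metis
  then have tF: "tame n F" using Suc.prems(2) by blast
  define v' where "v' p = px v p * inverse (px Z p)" for p
  have v': "smooth_on V v'"
    unfolding v'_def by (rule smooth_on_mult[OF open_V smooth_on_px[OF Suc.prems(3)] smooth_inverse_Z_x])
  have v'0: "\<forall>p\<in>V. fst p \<notin> {c<..<d} \<longrightarrow> v' p = 0"
    using px_eq_0_outside[OF open_V Suc.prems(3,4)] by (simp add: v'_def)
  obtain C1 where C1: "C1 \<ge> 0" "pairing_le n c d F v' C1"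
    using Suc.IH[OF F tF v' v'0] by blast
  obtain C2 where C2: "C2 \<ge> 0" "pairing_le n c d F v C2"
    using Suc.IH[OF F tF Suc.prems(3,4)] by blast
  have "pairing_le (Suc n) c d g v (C1 + C2)"
    unfolding pairing_le_def
  proof (intro allI impI)
    fix W G B t
    assume W: "open W" "G holomorphic_on W" and t: "t \<in> {0<..T}" and ZW: "\<forall>x\<in>{c..d}. Z (x, t) \<in> W"
      and B: "\<forall>i\<le>Suc n. \<forall>x\<in>{c..d}. cmod ((deriv ^^ i) G (Z (x, t))) \<le> B"
    have sub: "{c..d} \<subseteq> {l..r}" using cd by auto
    have t': "t \<in> {0..T}" using t by auto
    note cs = continuous_on_subset[OF smooth_slice sub]
    note dG = holomorphic_deriv[OF W(2,1)]
    have cG: "continuous_on {c..d} (\<lambda>x. H (Z (x, t)))" if "H holomorphic_on W" for H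
      using continuous_on_compose2[OF holomorphic_on_imp_continuous_on[OF that] cs[OF smooth_Z t']] ZW by auto
    have cF: "continuous_on {c..d} (\<lambda>x. F (x, t))" "continuous_on {c..d} (\<lambda>x. g (x, t))"
      using continuous_on_subset[OF solution_slice[OF _ t] sub] F Suc.prems(1) by blast+
    define I0 where "I0 x = g (x, t) * (v (x, t) * (G (Z (x, t)) * px Z (x, t)))" for x
    define I1 where "I1 x = F (x, t) * (v' (x, t) * (G (Z (x, t)) * px Z (x, t)))" for x
    define I2 where "I2 x = F (x, t) * (v (x, t) * (deriv G (Z (x, t)) * px Z (x, t)))" for x
    have int: "I0 integrable_on {c..d}" "I1 integrable_on {c..d}" "I2 integrable_on {c..d}"
      unfolding I0_def I1_def I2_def
      by (intro integrable_continuous_real continuous_on_mult cF cG W(2) dG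
          cs[OF Suc.prems(3) t'] cs[OF v' t'] cs[OF smooth_on_px[OF smooth_Z] t'])+
    \<comment> \<open>integration by parts, with \<open>F\<^sub>x = g Z\<^sub>x\<close>\<close>
    have "((\<lambda>x. I0 x + (I1 x + I2 x)) has_integral
        F (d, t) * (v (d, t) * G (Z (d, t))) - F (c, t) * (v (c, t) * G (Z (c, t)))) {c..d}"
    proof (rule fundamental_theorem_of_calculus)
      fix x assume x: "x \<in> {c..d}"
      then have p: "(x, t) \<in> V" using sub t' inV by blast
      have "((\<lambda>x. F (x, t)) has_vector_derivative g (x, t) * px Z (x, t)) (at x within {l..r})"
        using F x sub t by (auto simp: solution_def)
      then have D1: "((\<lambda>x. F (x, t)) has_vector_derivative g (x, t) * px Z (x, t)) (at x within {c..d})"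
        using sub by (rule has_vector_derivative_within_subset)
      have ZW': "Z (x, t) \<in> W" using ZW x by blast
      note hc = holomorphic_compose_partials[OF W ZW' smooth_on_imp_differentiable[OF smooth_Z p]]
      have D2: "((\<lambda>x. G (Z (x, t))) has_vector_derivative deriv G (Z (x, t)) * px Z (x, t)) (at x within {c..d})"
        using has_vector_derivative_px[OF hc(1)] hc(2) by simp
      note D3 = has_vector_derivative_px[OF smooth_on_imp_differentiable[OF Suc.prems(3) p], of "{c..d}"]
      show "((\<lambda>x. F (x, t) * (v (x, t) * G (Z (x, t)))) has_vector_derivative I0 x + (I1 x + I2 x)) (at x within {c..d})"
        using has_vector_derivative_mult[OF D1 has_vector_derivative_mult[OF D3 D2]] Z_x[OF p]
        by (simp add: I0_def I1_def I2_def v'_def field_simps)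
    qed (use cd in auto)
    moreover have "v (c, t) = 0" "v (d, t) = 0"
      using Suc.prems(4) cd t' inV[of c t] inV[of d t] by auto
    ultimately have "integral {c..d} (\<lambda>x. I0 x + (I1 x + I2 x)) = 0"
      by (simp add: integral_unique)
    moreover have "integral {c..d} (\<lambda>x. I0 x + (I1 x + I2 x)) = integral {c..d} I0 + (integral {c..d} I1 + integral {c..d} I2)"
      by (simp only: integral_add int integrable_add)
    ultimately have "integral {c..d} I0 = - (integral {c..d} I1 + integral {c..d} I2)"
      by (simp only: eq_neg_iff_add_eq_0)
    then have "cmod (integral {c..d} I0) \<le> cmod (integral {c..d} I1) + cmod (integral {c..d} I2)"
      by (metis norm_minus_cancel norm_triangle_ineq)
    also have "cmod (integral {c..d} I1) \<le> C1 * B"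
      unfolding I1_def using B by (intro pairing_leD[OF C1(2) W t ZW]) auto
    also have "cmod (integral {c..d} I2) \<le> C2 * B"
      unfolding I2_def
    proof (intro pairing_leD[OF C2(2) W(1) dG t ZW] allI impI ballI)
      fix i x assume "i \<le> n" "x \<in> {c..d}"
      then show "cmod ((deriv ^^ i) (deriv G) (Z (x, t))) \<le> B"
        using B[rule_format, of "Suc i" x] by (simp add: funpow_swap1)
    qed
    finally show "cmod (integral {c..d} (\<lambda>x. g (x, t) * (v (x, t) * (G (Z (x, t)) * px Z (x, t))))) \<le> (C1 + C2) * B"
      by (simp add: I0_def[abs_def] distrib_right)
  qed
  moreover have "C1 + C2 \<ge> 0" using C1(1) C2(1) by simp
  ultimately show ?case by blast
qed

text \<open>The trace is a limit for fixed test functions, whereas the densities \<open>G(Z) Z\<^sub>x\<close> move with \<open>t\<close>. The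
  difference is a smooth \<open>w\<close> that vanishes on the lower edge; integrating by parts onto a bounded primitive keeps
  this vanishing and makes the pairing tend to \<open>0\<close>.\<close>

lemma pairing_tendsto_0:
  assumes V': "open V'" "V' \<subseteq> V" "{l..r} \<times> {0..\<tau>} \<subseteq> V'" and \<tau>: "0 < \<tau>" "\<tau> \<le> T"
  shows "solution g gx \<Longrightarrow> tame n g \<Longrightarrow> smooth_on V' w \<Longrightarrow> (\<forall>p\<in>V'. fst p \<notin> {l<..<r} \<longrightarrow> w p = 0) \<Longrightarrow>
    (\<forall>x. (x, 0) \<in> V' \<longrightarrow> w (x, 0) = 0) \<Longrightarrow>
    ((\<lambda>t. integral {l..r} (\<lambda>x. g (x, t) * w (x, t))) \<longlongrightarrow> 0) (at_right 0)"
proof (induction n arbitrary: g gx w)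
  case 0
  obtain C where C: "C \<ge> 0" "\<And>x t. x \<in> {l..r} \<Longrightarrow> t \<in> {0<..T} \<Longrightarrow> cmod (g (x, t)) \<le> C * growth 0 t"
    using tameE[OF 0(2)] by metis
  have cw: "continuous_on ({l..r} \<times> {0..\<tau>}) w"
    using continuous_on_subset[OF smooth_on_imp_continuous_on[OF 0(3)] V'(3)] .
  then have uc: "uniformly_continuous_on ({l..r} \<times> {0..\<tau>}) w"
    by (intro compact_uniformly_continuous compact_Times) auto
  show ?case
  proof (rule tendstoI)
    fix e :: real assume e: "e > 0"
    define e' where "e' = e / (2 * (C + 1) * (r - l))"
    have e': "e' > 0" using e C l_less_r by (simp add: e'_def)
    obtain \<delta> where \<delta>: "\<delta> > 0" "\<And>p q. p \<in> {l..r} \<times> {0..\<tau>} \<Longrightarrow> q \<in> {l..r} \<times> {0..\<tau>} \<Longrightarrow> dist q p < \<delta> \<Longrightarrow> dist (w q) (w p) < e'"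
      using uc e' unfolding uniformly_continuous_on_def by metis
    have "cmod (integral {l..r} (\<lambda>x. g (x, t) * w (x, t))) < e" if t: "0 < t" "t < min \<delta> \<tau>" for t
    proof -
      have "cmod (integral {l..r} (\<lambda>x. g (x, t) * w (x, t))) \<le> C * e' * (r - l)"
      proof (rule integral_bound)
        show "continuous_on {l..r} (\<lambda>x. g (x, t) * w (x, t))"
          using t \<tau> by (intro continuous_on_mult solution_slice[OF 0(1)] continuous_on_horizontal[OF cw]) auto
        fix x assume x: "x \<in> {l..r}"
        have "dist (x, t) (x, 0) < \<delta>" using t by (simp add: dist_Pair_Pair)
        then have "dist (w (x, t)) (w (x, 0)) < e'" using \<delta>(2)[of "(x, 0)" "(x, t)"] x t \<tau> by auto
        moreover have "w (x, 0) = 0" using 0(5) subsetD[OF V'(3), of "(x, 0)"] x \<tau> by auto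
        ultimately have "cmod (w (x, t)) \<le> e'" by simp
        moreover have "cmod (g (x, t)) \<le> C" using C(2)[of x t] x t \<tau> by (auto simp: growth_def)
        ultimately show "cmod (g (x, t) * w (x, t)) \<le> C * e'"
          using C(1) by (simp add: norm_mult mult_mono)
      qed (use l_less_r in simp)
      also have "C * e' * (r - l) = C * (e / (2 * (C + 1)))" using l_less_r by (simp add: e'_def)
      also have "\<dots> < e"
      proof -
        have "0 \<le> C * e" using C(1) e by simp
        then have "C * e < e * (2 * (C + 1))" using e by (simp add: algebra_simps)
        then show ?thesis using C(1) by (simp add: field_simps)
      qed
      finally show ?thesis .
    qed
    then show "\<forall>\<^sub>F t in at_right 0. dist (integral {l..r} (\<lambda>x. g (x, t) * w (x, t))) 0 < e"
      unfolding eventually_at_right_field using \<delta>(1) \<tau>(1) by (intro exI[of _ "min \<delta> \<tau>"]) auto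
  qed
next
  case (Suc n)
  obtain F where F: "solution F (\<lambda>p. g p * px Z p)" and "\<And>n. tame (Suc n) g \<Longrightarrow> tame n F"
    using primitive[OF Suc.prems(1)] by metis
  then have tF: "tame n F" using Suc.prems(2) by blast
  define u where "u p = w p * inverse (px Z p)" for p
  have u: "smooth_on V' u"
    unfolding u_def by (rule smooth_on_mult[OF V'(1) Suc.prems(3) smooth_on_subset[OF smooth_inverse_Z_x V'(2)]])
  have u0: "\<forall>p\<in>V'. fst p \<notin> {l<..<r} \<longrightarrow> u p = 0" "\<forall>x. (x, 0) \<in> V' \<longrightarrow> u (x, 0) = 0"
    using Suc.prems(4,5) by (simp_all add: u_def)
  have "\<forall>x. (x, 0) \<in> V' \<longrightarrow> px u (x, 0) = 0"
    using u0(2) by (auto intro!: px_eq_0[OF V'(1) _ u])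
  from Suc.IH[OF F tF smooth_on_px[OF u] px_eq_0_outside[OF V'(1) u u0(1)] this]
  have lim: "((\<lambda>t. - integral {l..r} (\<lambda>x. F (x, t) * px u (x, t))) \<longlongrightarrow> - 0) (at_right 0)"
    by (rule tendsto_minus)
  have "- integral {l..r} (\<lambda>x. F (x, t) * px u (x, t)) = integral {l..r} (\<lambda>x. g (x, t) * w (x, t))"
    if t: "0 < t" "t < \<tau>" for t
  proof -
    have t': "t \<in> {0<..T}" "t \<in> {0..T}" using t \<tau> by auto
    have inV': "(x, t) \<in> V'" if "x \<in> {l..r}" for x using that t V'(3) by auto
    have cV': "continuous_on {l..r} (\<lambda>x. h (x, t))" if "smooth_on V' h" for h :: "real \<times> real \<Rightarrow> complex"
      using inV' by (intro continuous_on_horizontal[OF smooth_on_imp_continuous_on[OF that]])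
    have "((\<lambda>x. F (x, t) * px u (x, t) + g (x, t) * w (x, t)) has_integral
        F (r, t) * u (r, t) - F (l, t) * u (l, t)) {l..r}"
    proof (rule fundamental_theorem_of_calculus)
      fix x assume x: "x \<in> {l..r}"
      have D1: "((\<lambda>x. F (x, t)) has_vector_derivative g (x, t) * px Z (x, t)) (at x within {l..r})"
        using F x t' by (auto simp: solution_def)
      note D2 = has_vector_derivative_px[OF smooth_on_imp_differentiable[OF u inV'[OF x]], of "{l..r}"]
      have "px Z (x, t) \<noteq> 0" using Z_x V'(2) inV'[OF x] by blast
      then show "((\<lambda>x. F (x, t) * u (x, t)) has_vector_derivative F (x, t) * px u (x, t) + g (x, t) * w (x, t)) (at x within {l..r})"
        using has_vector_derivative_mult[OF D1 D2] by (simp add: u_def field_simps)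
    qed (use l_less_r in simp)
    moreover have "u (r, t) = 0" "u (l, t) = 0" using u0(1) inV' l_less_r by auto
    ultimately have "integral {l..r} (\<lambda>x. F (x, t) * px u (x, t) + g (x, t) * w (x, t)) = 0"
      by (simp add: integral_unique)
    moreover have "integral {l..r} (\<lambda>x. F (x, t) * px u (x, t) + g (x, t) * w (x, t))
       = integral {l..r} (\<lambda>x. F (x, t) * px u (x, t)) + integral {l..r} (\<lambda>x. g (x, t) * w (x, t))"
      by (intro integral_add integrable_continuous_real continuous_on_mult solution_slice[OF F t'(1)]
          solution_slice[OF Suc.prems(1) t'(1)] cV' Suc.prems(3) smooth_on_px[OF u])
    ultimately have "integral {l..r} (\<lambda>x. F (x, t) * px u (x, t)) + integral {l..r} (\<lambda>x. g (x, t) * w (x, t)) = 0"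
      by simp
    from minus_unique[OF this] show ?thesis .
  qed
  then have "\<forall>\<^sub>F t in at_right 0. - integral {l..r} (\<lambda>x. F (x, t) * px u (x, t)) = integral {l..r} (\<lambda>x. g (x, t) * w (x, t))"
    unfolding eventually_at_right_field using \<tau>(1) by blast
  from Lim_transform_eventually[OF lim this] show ?case by simp
qed

end

section \<open>Cutoffs and the identity between two levels\<close>

text \<open>For continuation in the shift \<open>\<eta>\<close> along the unit vector \<open>e\<close>.\<close>

lemma holomorphic_on_shift_integral:
  fixes q Y :: "'b::euclidean_space \<Rightarrow> complex"
  assumes q: "continuous_on (cbox a b) q" and Y: "continuous_on (cbox a b) Y"
    and W: "open W" "G holomorphic_on W" and U: "convex U"
    and inW: "\<And>\<eta> p. \<eta> \<in> U \<Longrightarrow> p \<in> cbox a b \<Longrightarrow> Y p + e * \<eta> \<in> W"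
  shows "(\<lambda>\<eta>. integral (cbox a b) (\<lambda>p. q p * G (Y p + e * \<eta>))) holomorphic_on U"
proof (rule leibniz_rule_holomorphic[where fx = "\<lambda>\<eta> p. q p * (deriv G (Y p + e * \<eta>) * e)"])
  fix \<eta> p assume \<eta>: "\<eta> \<in> U" and p: "p \<in> cbox a b"
  have 1: "((\<lambda>\<eta>. Y p + e * \<eta>) has_field_derivative e) (at \<eta> within U)"
    by (auto intro!: derivative_eq_intros)
  have "((\<lambda>\<eta>. G (Y p + e * \<eta>)) has_field_derivative deriv G (Y p + e * \<eta>) * e) (at \<eta> within U)"
    using DERIV_chain2[OF holomorphic_derivI[OF W(2,1) inW[OF \<eta> p]] 1] .
  then show "((\<lambda>\<eta>. q p * G (Y p + e * \<eta>)) has_field_derivative q p * (deriv G (Y p + e * \<eta>) * e)) (at \<eta> within U)"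
    by (rule DERIV_cmult)
next
  fix \<eta> assume \<eta>: "\<eta> \<in> U"
  have "continuous_on (cbox a b) (\<lambda>p. G (Y p + e * \<eta>))"
    using \<eta> inW by (intro continuous_on_compose2[OF holomorphic_on_imp_continuous_on[OF W(2)]] continuous_intros Y) auto
  then show "(\<lambda>p. q p * G (Y p + e * \<eta>)) integrable_on cbox a b"
    by (intro integrable_continuous continuous_on_mult q)
next
  have Y2: "continuous_on (U \<times> cbox a b) (\<lambda>z. Y (snd z))" and q2: "continuous_on (U \<times> cbox a b) (\<lambda>z. q (snd z))"
    by (rule continuous_on_compose2[OF Y continuous_on_snd[OF continuous_on_id]], force,
        rule continuous_on_compose2[OF q continuous_on_snd[OF continuous_on_id]], force)
  have "continuous_on (U \<times> cbox a b) (\<lambda>z. deriv G (Y (snd z) + e * fst z))"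
    by (rule continuous_on_compose2[OF holomorphic_on_imp_continuous_on[OF holomorphic_deriv[OF W(2,1)]]])
      (auto intro!: continuous_intros Y2 inW)
  then show "continuous_on (U \<times> cbox a b) (\<lambda>(\<eta>, p). q p * (deriv G (Y p + e * \<eta>) * e))"
    unfolding case_prod_beta by (intro continuous_on_mult q2 continuous_on_const)
qed (fact U)

lemma integral_box_le:
  fixes f :: "real \<times> real \<Rightarrow> complex"
  assumes f: "continuous_on (cbox (c, s0) (d, s1)) f" and s: "s0 \<le> s1"
    and M: "\<And>t. t \<in> {s0..s1} \<Longrightarrow> cmod (integral {c..d} (\<lambda>x. f (x, t))) \<le> M"
  shows "cmod (integral (cbox (c, s0) (d, s1)) f) \<le> M * (s1 - s0)"
proof -
  have "integral (cbox (c, s0) (d, s1)) f = integral {c..d} (\<lambda>x. integral {s0..s1} (\<lambda>t. f (x, t)))"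
    using integral_prod_continuous[OF f] by simp
  also have "\<dots> = integral {s0..s1} (\<lambda>t. integral {c..d} (\<lambda>x. f (x, t)))"
    using integral_swap_continuous[of c s0 d s1 "\<lambda>x t. f (x, t)"] f by (simp add: case_prod_eta)
  finally have *: "integral (cbox (c, s0) (d, s1)) f = integral {s0..s1} (\<lambda>t. integral {c..d} (\<lambda>x. f (x, t)))" .
  have "continuous_on ({s0..s1} \<times> cbox c d) (\<lambda>(t, x). f (x, t))"
  proof -
    have "continuous_on ({s0..s1} \<times> cbox c d) (\<lambda>z. f (snd z, fst z))"
      by (rule continuous_on_compose2[OF f]) (auto intro!: continuous_intros simp: cbox_Pair_eq)
    then show ?thesis by (simp add: case_prod_beta')
  qed
  from integral_continuous_on_param[OF this]
  have "continuous_on {s0..s1} (\<lambda>t. integral {c..d} (\<lambda>x. f (x, t)))" by simp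
  from integral_bound[OF s this M] show ?thesis unfolding * .
qed

lemma lborel_integral_eq_integral:
  fixes h :: "real \<Rightarrow> complex"
  assumes h: "continuous_on {l..r} h" and 0: "\<And>x. x \<notin> {l..r} \<Longrightarrow> h x = 0"
  shows "(LINT x|lborel. h x) = integral {l..r} h"
proof -
  have "set_integrable lborel {l..r} h" by (rule borel_integrable_atLeastAtMost'[OF h])
  from set_borel_integral_eq_integral(2)[OF this]
  have "(LINT x|lborel. indicator {l..r} x *\<^sub>R h x) = integral {l..r} h" by (simp add: set_lebesgue_integral_def)
  moreover have "(\<lambda>x. indicator {l..r} x *\<^sub>R h x) = h" using 0 by (auto simp: indicator_def)
  ultimately show ?thesis by simp
qed

text \<open>The derivative of the plateau \<open>\<psi>\<close> splits into a part \<open>b1\<close> at its left and a part \<open>b2\<close> at its right; both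
  are smooth on the whole line, which lets each side be treated as a pairing of its own.\<close>

locale cutoff_strip = strip +
  fixes m1 m2 :: real and \<psi> b1 b2 :: "real \<Rightarrow> complex"
  assumes m: "l < m1" "m1 < m2" "m2 < r"
    and smooth_cutoff: "smooth_on UNIV \<psi>" "smooth_on UNIV b1" "smooth_on UNIV b2"
    and cutoff_deriv: "\<And>x. (\<psi> has_vector_derivative (b1 x - b2 x)) (at x)"
    and b1_0: "\<And>x. x \<notin> {l<..<m1} \<Longrightarrow> b1 x = 0" and b2_0: "\<And>x. x \<notin> {m2<..<r} \<Longrightarrow> b2 x = 0"
    and cutoff_0: "\<And>x. x \<notin> {l<..<r} \<Longrightarrow> \<psi> x = 0"
    and cutoff_1: "\<And>x. x \<in> {m1..m2} \<Longrightarrow> \<psi> x = 1"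
    and cutoff_le: "\<And>x. cmod (\<psi> x) \<le> 1"
begin

definition level :: "(real \<times> real \<Rightarrow> complex) \<Rightarrow> (complex \<Rightarrow> complex) \<Rightarrow> real \<Rightarrow> complex" where
  "level g G t = integral {l..r} (\<lambda>x. g (x, t) * (\<psi> x * (G (Z (x, t)) * px Z (x, t))))"

definition side1 :: "(real \<times> real \<Rightarrow> complex) \<Rightarrow> (complex \<Rightarrow> complex) \<Rightarrow> real \<Rightarrow> real \<Rightarrow> complex" where
  "side1 g G s0 s1 = integral (cbox (l, s0) (m1, s1)) (\<lambda>p. g p * (a p * b1 (fst p) * (G (Z p) * px Z p)))"

definition side2 :: "(real \<times> real \<Rightarrow> complex) \<Rightarrow> (complex \<Rightarrow> complex) \<Rightarrow> real \<Rightarrow> real \<Rightarrow> complex" where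
  "side2 g G s0 s1 = integral (cbox (m2, s0) (r, s1)) (\<lambda>p. g p * (a p * b2 (fst p) * (G (Z p) * px Z p)))"

text \<open>Stokes' formula with the cutoff \<open>\<psi>\<close>; the double integral lives on the supports of \<open>b1\<close> and \<open>b2\<close>.\<close>

lemma level_identity:
  assumes g: "solution g gx" and W: "open W" "G holomorphic_on W" and s: "0 < s0" "s0 \<le> s1" "s1 \<le> T"
    and inW: "\<And>x t. x \<in> {l..r} \<Longrightarrow> t \<in> {s0..s1} \<Longrightarrow> Z (x, t) \<in> W"
  shows "level g G s1 - level g G s0 = side1 g G s0 s1 - side2 g G s0 s1"
proof -
  let ?k = "\<lambda>p. G (Z p) * px Z p" and ?V = "{p \<in> V. Z p \<in> W}" and ?B = "cbox (l, s0) (r, s1)"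
  note d = conservation_law[OF W]
  have rect: "{l..r} \<times> {s0..s1} \<subseteq> ?V" using s inW inV by auto
  have B: "?B = {l..r} \<times> {s0..s1}" by (simp add: cbox_Pair_eq)
  have cb: "continuous_on UNIV b1" "continuous_on UNIV b2"
    using smooth_cutoff smooth_on_imp_continuous_on by blast+
  have sub: "?B \<subseteq> {l..r} \<times> {0<..T}" "?B \<subseteq> {l..r} \<times> {0..T}" using s B by auto
  note cV = continuous_on_subset[OF continuous_on_rect sub(2)]
  have fst: "continuous_on ?B fst" by (intro continuous_intros)
  have cont: "continuous_on ?B g" "continuous_on ?B a" "continuous_on ?B (px Z)"
    "continuous_on ?B (\<lambda>p. b1 (fst p))" "continuous_on ?B (\<lambda>p. b2 (fst p))" "continuous_on ?B (\<lambda>p. G (Z p))"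
  proof -
    show "continuous_on ?B g" using g sub(1) unfolding solution_def by (blast intro: continuous_on_subset)
    show "continuous_on ?B a" "continuous_on ?B (px Z)"
      by (rule cV[OF smooth_a] cV[OF smooth_on_px[OF smooth_Z]])+
    show "continuous_on ?B (\<lambda>p. b1 (fst p))" by (rule continuous_on_compose2[OF cb(1) fst]) simp
    show "continuous_on ?B (\<lambda>p. b2 (fst p))" by (rule continuous_on_compose2[OF cb(2) fst]) simp
    show "continuous_on ?B (\<lambda>p. G (Z p))"
      by (rule continuous_on_compose2[OF holomorphic_on_imp_continuous_on[OF W(2)] cV[OF smooth_Z]]) (use inW B in auto)
  qed
  have "level g G s1 - level g G s0 = integral ?B (\<lambda>p. g p * (a p * (b1 (fst p) - b2 (fst p)) * ?k p))"
    unfolding level_def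
  proof (rule Stokes[OF g d(1,2) _ d(3) s rect])
    show "(\<psi> has_vector_derivative b1 x - b2 x) (at x within {l..r})" for x
      by (rule has_vector_derivative_at_within[OF cutoff_deriv])
    show "continuous_on {l..r} (\<lambda>x. b1 x - b2 x)"
      by (intro continuous_on_diff continuous_on_subset[OF cb(1)] continuous_on_subset[OF cb(2)]) simp_all
  qed (use cutoff_0 in auto)
  also have "\<dots> = integral ?B (\<lambda>p. g p * (a p * b1 (fst p) * ?k p) - g p * (a p * b2 (fst p) * ?k p))"
    by (intro integral_cong) (simp add: algebra_simps)
  also have "\<dots> = integral ?B (\<lambda>p. g p * (a p * b1 (fst p) * ?k p)) - integral ?B (\<lambda>p. g p * (a p * b2 (fst p) * ?k p))"
    by (intro integral_diff integrable_continuous continuous_on_mult cont)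
  also have "integral ?B (\<lambda>p. g p * (a p * b1 (fst p) * ?k p)) = side1 g G s0 s1"
    unfolding side1_def
  proof (rule integral_spike_set[OF empty_imp_negligible empty_imp_negligible])
    show "{p \<in> ?B - cbox (l, s0) (m1, s1). g p * (a p * b1 (fst p) * ?k p) \<noteq> 0} = {}"
      using b1_0 by (auto simp: cbox_Pair_eq)
    show "{p \<in> cbox (l, s0) (m1, s1) - ?B. g p * (a p * b1 (fst p) * ?k p) \<noteq> 0} = {}"
      using m by (auto simp: cbox_Pair_eq)
  qed
  also have "integral ?B (\<lambda>p. g p * (a p * b2 (fst p) * ?k p)) = side2 g G s0 s1"
    unfolding side2_def
  proof (rule integral_spike_set[OF empty_imp_negligible empty_imp_negligible])
    show "{p \<in> ?B - cbox (m2, s0) (r, s1). g p * (a p * b2 (fst p) * ?k p) \<noteq> 0} = {}"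
      using b2_0 by (auto simp: cbox_Pair_eq)
    show "{p \<in> cbox (m2, s0) (r, s1) - ?B. g p * (a p * b2 (fst p) * ?k p) \<noteq> 0} = {}"
      using m by (auto simp: cbox_Pair_eq)
  qed
  finally show ?thesis .
qed

end

section \<open>Analytic continuation in a shift\<close>

text \<open>The \<open>\<epsilon>\<close>-neighbourhood of the segment from \<open>0\<close> to \<open>\<Theta>\<close>, on which the identity is continued from
  the far end \<open>\<Theta>\<close> back to \<open>0\<close>.\<close>

lemma segment_neighbourhood:
  fixes \<Theta> \<epsilon> :: real
  assumes "\<epsilon> > 0"
  defines "U \<equiv> (\<Union>x\<in>closed_segment 0 (complex_of_real \<Theta>). \<Union>y\<in>ball 0 \<epsilon>. {x + y})"
  shows "open U" "convex U" "closed_segment 0 (complex_of_real \<Theta>) \<subseteq> U"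
    and "\<And>\<eta>. \<Theta> \<ge> 0 \<Longrightarrow> \<eta> \<in> U \<Longrightarrow> \<exists>\<theta>\<in>{0..\<Theta>}. cmod (\<eta> - of_real \<theta>) < \<epsilon>"
proof -
  show "open U" unfolding U_def by (rule open_sums) simp
  show "convex U" unfolding U_def by (rule convex_sums) auto
  show "closed_segment 0 (complex_of_real \<Theta>) \<subseteq> U" using assms(1) by (force simp: U_def)
  show "\<exists>\<theta>\<in>{0..\<Theta>}. cmod (\<eta> - of_real \<theta>) < \<epsilon>" if th: "\<Theta> \<ge> 0" "\<eta> \<in> U" for \<eta>
  proof -
    obtain x y where xy: "x \<in> closed_segment 0 (complex_of_real \<Theta>)" "cmod y < \<epsilon>" "\<eta> = x + y"
      using th(2) by (auto simp: U_def)
    obtain u where u: "0 \<le> u" "u \<le> 1" "x = u *\<^sub>R complex_of_real \<Theta>"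
      using xy(1) by (auto simp: in_segment)
    have "cmod (\<eta> - of_real (u * \<Theta>)) < \<epsilon>" using xy u by (simp add: scaleR_conv_of_real)
    moreover have "u * \<Theta> \<in> {0..\<Theta>}" using u th(1) by (simp add: mult_left_le_one_le)
    ultimately show ?thesis by blast
  qed
qed

lemma eq_0_by_continuation:
  assumes "\<Theta> \<ge> 0" "\<epsilon> > 0" "\<epsilon>' > 0"
    and A: "A holomorphic_on (\<Union>x\<in>closed_segment 0 (complex_of_real \<Theta>). \<Union>y\<in>ball 0 \<epsilon>. {x + y})" (is "_ holomorphic_on ?U")
    and 0: "\<And>\<eta>. cmod (\<eta> - of_real \<Theta>) < \<epsilon>' \<Longrightarrow> A \<eta> = 0"
  shows "A 0 = 0"
proof (rule analytic_continuation[OF A, of "ball (of_real \<Theta>) (min \<epsilon> \<epsilon>')" "of_real \<Theta>"])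
  note U = segment_neighbourhood[OF assms(2), of \<Theta>]
  show "open ?U" using U(1) .
  show "connected ?U" using U(2) by (rule convex_connected)
  show "ball (of_real \<Theta>) (min \<epsilon> \<epsilon>') \<subseteq> ?U"
  proof
    fix z assume "z \<in> ball (complex_of_real \<Theta>) (min \<epsilon> \<epsilon>')"
    then have "of_real \<Theta> + (z - of_real \<Theta>) \<in> ?U"
      by (intro UN_I[of "of_real \<Theta>"] UN_I[of "z - of_real \<Theta>"]) (auto simp: dist_norm norm_minus_commute)
    then show "z \<in> ?U" by simp
  qed
  show "of_real \<Theta> \<in> ?U" "0 \<in> ?U" by (rule subsetD[OF U(3)]; simp)+
  show "complex_of_real \<Theta> islimpt ball (of_real \<Theta>) (min \<epsilon> \<epsilon>')"
    using assms by (intro interior_limit_point) (simp add: interior_open)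
  show "A z = 0" if "z \<in> ball (complex_of_real \<Theta>) (min \<epsilon> \<epsilon>')" for z
    using that by (intro 0) (simp add: dist_norm norm_minus_commute)
qed

lemma compact_shift_margin:
  fixes K :: "complex set"
  assumes "compact K" "open W" "\<And>z \<theta>. z \<in> K \<Longrightarrow> \<theta> \<in> {\<alpha>..\<beta>} \<Longrightarrow> z + e * of_real \<theta> \<in> W" "cmod e = 1"
  shows "\<exists>\<epsilon>>0. \<forall>z\<in>K. \<forall>\<theta>\<in>{\<alpha>..\<beta>}. \<forall>z' \<eta>. cmod (z' - z) < \<epsilon> \<longrightarrow> cmod (\<eta> - of_real \<theta>) < \<epsilon> \<longrightarrow> z' + e * \<eta> \<in> W"
proof -
  let ?f = "\<lambda>p. fst p + e * of_real (snd p)"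
  have c: "compact (?f ` (K \<times> {\<alpha>..\<beta>}))"
    by (intro compact_continuous_image compact_Times assms(1) compact_Icc continuous_intros)
  have sub: "?f ` (K \<times> {\<alpha>..\<beta>}) \<subseteq> W" using assms(3) by auto
  obtain \<epsilon> where \<epsilon>: "\<epsilon> > 0" "(\<Union>x\<in>?f ` (K \<times> {\<alpha>..\<beta>}). ball x \<epsilon>) \<subseteq> W"
    by (rule compact_subset_open_imp_ball_epsilon_subset[OF c assms(2) sub])
  show ?thesis
  proof (intro exI[of _ "\<epsilon> / 2"] conjI ballI allI impI)
    fix z z' \<theta> \<eta>
    assume z: "z \<in> K" "\<theta> \<in> {\<alpha>..\<beta>}" "cmod (z' - z) < \<epsilon> / 2" "cmod (\<eta> - of_real \<theta>) < \<epsilon> / 2"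
    have "cmod ((z' + e * \<eta>) - (z + e * of_real \<theta>)) = cmod ((z' - z) + e * (\<eta> - of_real \<theta>))"
      by (simp add: algebra_simps)
    also have "\<dots> \<le> cmod (z' - z) + cmod (e * (\<eta> - of_real \<theta>))" by (rule norm_triangle_ineq)
    also have "\<dots> < \<epsilon>" using z assms(4) by (simp add: norm_mult)
    finally have "z' + e * \<eta> \<in> ball (?f (z, \<theta>)) \<epsilon>" by (simp add: dist_norm norm_minus_commute)
    moreover have "ball (?f (z, \<theta>)) \<epsilon> \<subseteq> W"
      using \<epsilon>(2)[unfolded UN_subset_iff] imageI[of "(z, \<theta>)" "K \<times> {\<alpha>..\<beta>}" ?f] z by blast
    ultimately show "z' + e * \<eta> \<in> W" by (rule subsetD[rotated])
  qed (use \<epsilon> in simp)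
qed

context cutoff_strip
begin

lemma smooth_box:
  assumes "smooth_on V w" "l \<le> c" "d \<le> r" "0 < s0" "s1 \<le> T"
  shows "continuous_on (cbox (c, s0) (d, s1)) w"
  using assms(2-) by (intro continuous_on_subset[OF continuous_on_rect[OF assms(1)]]) (auto simp: cbox_Pair_eq)

lemma solution_box:
  assumes "solution g gx" "l \<le> c" "d \<le> r" "0 < s0" "s1 \<le> T"
  shows "continuous_on (cbox (c, s0) (d, s1)) g"
proof (rule continuous_on_subset)
  show "continuous_on ({l..r} \<times> {0<..T}) g" using assms(1) unfolding solution_def by blast
  show "cbox (c, s0) (d, s1) \<subseteq> {l..r} \<times> {0<..T}" using assms(2-) by (auto simp: cbox_Pair_eq)
qed

lemma cutoff_continuous: "continuous_on R \<psi>" "continuous_on S (\<lambda>p. b1 (fst p))" "continuous_on S (\<lambda>p. b2 (fst p))"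
  for S :: "(real \<times> real) set"
proof -
  have c: "continuous_on UNIV \<psi>" "continuous_on UNIV b1" "continuous_on UNIV b2"
    using smooth_cutoff smooth_on_imp_continuous_on by blast+
  show "continuous_on R \<psi>" using continuous_on_subset[OF c(1)] by simp
  show "continuous_on S (\<lambda>p. b1 (fst p))" "continuous_on S (\<lambda>p. b2 (fst p))"
    using continuous_on_compose2[OF c(2), of S fst] continuous_on_compose2[OF c(3), of S fst]
    by (simp_all add: continuous_on_fst)
qed

text \<open>Between the two levels \<open>G\<close> may be singular. The identity is true for \<open>G(\<cdot> + e \<Theta>)\<close>, which is holomorphic on
  the image of the whole rectangle (\<open>far\<close>). All terms involve only the two levels and the sides, where the argument
  may be shifted by every \<open>e \<theta>\<close> with \<open>0 \<le> \<theta> \<le> \<Theta>\<close>; they are therefore holomorphic in the shift, and the identity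
  continues to \<open>\<theta> = 0\<close>.\<close>

lemma level_identity_shift:
  assumes g: "solution g gx" and W: "open W" "G holomorphic_on W" and s: "0 < s0" "s0 \<le> s1" "s1 \<le> T"
    and e: "cmod e = 1" and \<Theta>: "\<Theta> \<ge> 0"
    and bot: "\<And>x \<theta>. x \<in> {l..r} \<Longrightarrow> \<theta> \<in> {0..\<Theta>} \<Longrightarrow> Z (x, s0) + e * of_real \<theta> \<in> W"
    and top: "\<And>x \<theta>. x \<in> {l..r} \<Longrightarrow> \<theta> \<in> {0..\<Theta>} \<Longrightarrow> Z (x, s1) + e * of_real \<theta> \<in> W"
    and sides: "\<And>x t \<theta>. x \<in> {l..m1} \<union> {m2..r} \<Longrightarrow> t \<in> {s0..s1} \<Longrightarrow> \<theta> \<in> {0..\<Theta>} \<Longrightarrow> Z (x, t) + e * of_real \<theta> \<in> W"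
    and far: "\<And>x t. x \<in> {l..r} \<Longrightarrow> t \<in> {s0..s1} \<Longrightarrow> Z (x, t) + e * of_real \<Theta> \<in> W"
  shows "level g G s1 - level g G s0 = side1 g G s0 s1 - side2 g G s0 s1"
proof -
  let ?S1 = "cbox (l, s0) (m1, s1)" and ?S2 = "cbox (m2, s0) (r, s1)" and ?B = "cbox (l, s0) (r, s1)"
  have sT: "s0 \<in> {0<..T}" "s1 \<in> {0<..T}" "s0 \<in> {0..T}" "s1 \<in> {0..T}" using s by auto
  have mm: "m1 \<le> r" "l \<le> m2" using m by auto
  note cZ1 = smooth_box[OF smooth_Z order_refl mm(1) s(1,3)] and cZ2 = smooth_box[OF smooth_Z mm(2) order_refl s(1,3)]
  define K where "K = (\<lambda>x. Z (x, s0)) ` {l..r} \<union> (\<lambda>x. Z (x, s1)) ` {l..r} \<union> Z ` ?S1 \<union> Z ` ?S2"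
  have cK: "compact K"
    unfolding K_def by (intro compact_Un compact_continuous_image smooth_slice[OF smooth_Z sT(3)]
        smooth_slice[OF smooth_Z sT(4)] cZ1 cZ2 compact_cbox compact_Icc)
  have inK: "z + e * of_real \<theta> \<in> W" if "z \<in> K" "\<theta> \<in> {0..\<Theta>}" for z \<theta>
    using that bot top sides unfolding K_def by (auto simp: cbox_Pair_eq)
  obtain \<epsilon> where \<epsilon>: "\<epsilon> > 0"
    "\<forall>z\<in>K. \<forall>\<theta>\<in>{0..\<Theta>}. \<forall>z' \<eta>. cmod (z' - z) < \<epsilon> \<longrightarrow> cmod (\<eta> - of_real \<theta>) < \<epsilon> \<longrightarrow> z' + e * \<eta> \<in> W"
    using compact_shift_margin[OF cK W(1) inK e] by blast
  have cB: "compact (Z ` ?B)"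
    by (intro compact_continuous_image smooth_box[OF smooth_Z order_refl order_refl s(1,3)] compact_cbox)
  have inB: "z + e * of_real \<theta> \<in> W" if "z \<in> Z ` ?B" "\<theta> \<in> {\<Theta>..\<Theta>}" for z \<theta>
    using that far by (auto simp: cbox_Pair_eq)
  obtain \<epsilon>' where \<epsilon>': "\<epsilon>' > 0"
    "\<forall>z\<in>Z ` ?B. \<forall>\<theta>\<in>{\<Theta>..\<Theta>}. \<forall>z' \<eta>. cmod (z' - z) < \<epsilon>' \<longrightarrow> cmod (\<eta> - of_real \<theta>) < \<epsilon>' \<longrightarrow> z' + e * \<eta> \<in> W"
    using compact_shift_margin[OF cB W(1) inB e] by blast
  let ?U = "(\<Union>x\<in>closed_segment 0 (complex_of_real \<Theta>). \<Union>y\<in>ball 0 \<epsilon>. {x + y})"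
  note U = segment_neighbourhood[OF \<epsilon>(1), of \<Theta>]
  have KU: "z + e * \<eta> \<in> W" if z: "z \<in> K" "\<eta> \<in> ?U" for z \<eta>
  proof -
    obtain \<theta> where "\<theta> \<in> {0..\<Theta>}" "cmod (\<eta> - of_real \<theta>) < \<epsilon>" using U(4)[OF \<Theta> z(2)] by blast
    then show ?thesis using \<epsilon>(2)[rule_format, OF z(1), of \<theta> z \<eta>] \<epsilon>(1) by simp
  qed
  define G' where "G' \<eta> z = G (z + e * \<eta>)" for \<eta> z
  define A where "A \<eta> = (level g (G' \<eta>) s1 - level g (G' \<eta>) s0) - (side1 g (G' \<eta>) s0 s1 - side2 g (G' \<eta>) s0 s1)" for \<eta>
  have level_hol: "(\<lambda>\<eta>. level g (G' \<eta>) s) holomorphic_on ?U" if s': "s = s0 \<or> s = s1" for s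
  proof -
    have sT': "s \<in> {0<..T}" "s \<in> {0..T}" using s' sT by auto
    have "(\<lambda>\<eta>. integral (cbox l r) (\<lambda>x. (g (x, s) * \<psi> x * px Z (x, s)) * G (Z (x, s) + e * \<eta>))) holomorphic_on ?U"
    proof (rule holomorphic_on_shift_integral[OF _ _ W U(2)])
      show "continuous_on (cbox l r) (\<lambda>x. g (x, s) * \<psi> x * px Z (x, s))"
        using solution_slice[OF g sT'(1)] smooth_slice[OF smooth_on_px[OF smooth_Z] sT'(2)] cutoff_continuous(1)
        unfolding cbox_interval by (intro continuous_on_mult)
      show "continuous_on (cbox l r) (\<lambda>x. Z (x, s))" using smooth_slice[OF smooth_Z sT'(2)] by simp
      show "Z (x, s) + e * \<eta> \<in> W" if "\<eta> \<in> ?U" "x \<in> cbox l r" for \<eta> x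
        using that s' by (intro KU) (auto simp: K_def)
    qed
    then show ?thesis unfolding level_def G'_def by (simp add: mult_ac)
  qed
  have side_hol: "(\<lambda>\<eta>. side1 g (G' \<eta>) s0 s1) holomorphic_on ?U" "(\<lambda>\<eta>. side2 g (G' \<eta>) s0 s1) holomorphic_on ?U"
  proof -
    have "(\<lambda>\<eta>. integral ?S1 (\<lambda>p. (g p * (a p * b1 (fst p) * px Z p)) * G (Z p + e * \<eta>))) holomorphic_on ?U"
      using KU by (intro holomorphic_on_shift_integral[OF _ cZ1 W U(2)] continuous_on_mult cutoff_continuous
          smooth_box[OF smooth_a order_refl mm(1) s(1,3)] smooth_box[OF smooth_on_px[OF smooth_Z] order_refl mm(1) s(1,3)]
          solution_box[OF g order_refl mm(1) s(1,3)]) (simp add: K_def)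
    then show "(\<lambda>\<eta>. side1 g (G' \<eta>) s0 s1) holomorphic_on ?U" unfolding side1_def G'_def by (simp add: mult_ac)
    have "(\<lambda>\<eta>. integral ?S2 (\<lambda>p. (g p * (a p * b2 (fst p) * px Z p)) * G (Z p + e * \<eta>))) holomorphic_on ?U"
      using KU by (intro holomorphic_on_shift_integral[OF _ cZ2 W U(2)] continuous_on_mult cutoff_continuous
          smooth_box[OF smooth_a mm(2) order_refl s(1,3)] smooth_box[OF smooth_on_px[OF smooth_Z] mm(2) order_refl s(1,3)]
          solution_box[OF g mm(2) order_refl s(1,3)]) (simp add: K_def)
    then show "(\<lambda>\<eta>. side2 g (G' \<eta>) s0 s1) holomorphic_on ?U" unfolding side2_def G'_def by (simp add: mult_ac)
  qed
  have A_hol: "A holomorphic_on ?U"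
    unfolding A_def using level_hol by (intro holomorphic_on_diff side_hol) auto
  have A0: "A \<eta> = 0" if \<eta>: "cmod (\<eta> - of_real \<Theta>) < \<epsilon>'" for \<eta>
  proof -
    let ?W = "(\<lambda>z. z + e * \<eta>) -` W"
    have "open ?W" using W(1) by (intro open_vimage continuous_intros)
    moreover have "G' \<eta> holomorphic_on ?W"
      unfolding G'_def by (rule holomorphic_on_compose_gen[OF _ W(2), unfolded o_def]) (auto intro!: holomorphic_intros)
    moreover have "Z (x, t) \<in> ?W" if "x \<in> {l..r}" "t \<in> {s0..s1}" for x t
      using \<epsilon>'(2)[rule_format, of "Z (x, t)" \<Theta> "Z (x, t)" \<eta>] \<epsilon>'(1) \<eta> that by (simp add: cbox_Pair_eq)
    ultimately show ?thesis using level_identity[OF g _ _ s, of ?W "G' \<eta>"] by (simp add: A_def)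
  qed
  have "A 0 = 0" by (rule eq_0_by_continuation[OF \<Theta> \<epsilon>(1) \<epsilon>'(1) A_hol]) (rule A0)
  then show ?thesis by (simp add: A_def G'_def[abs_def])
qed

end

section \<open>Bounding the trace by a later level\<close>

context cutoff_strip
begin

text \<open>The hypotheses of the shifted identity for the levels \<open>0\<close> and \<open>s\<close>. A solution has no values at level
  \<open>0\<close>; the identity will be applied at levels slightly above it, to which the hypotheses pass by compactness.\<close>

definition admissible :: "(complex \<Rightarrow> complex) \<Rightarrow> complex set \<Rightarrow> real \<Rightarrow> complex \<Rightarrow> real \<Rightarrow> bool" where
  "admissible G W s e \<Theta> \<longleftrightarrow> open W \<and> G holomorphic_on W \<and> 0 < s \<and> s \<le> T \<and> cmod e = 1 \<and> 0 \<le> \<Theta> \<and>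
    (\<forall>\<theta>\<in>{0..\<Theta>}. \<forall>x\<in>{l..r}. Z (x, 0) + e * of_real \<theta> \<in> W \<and> Z (x, s) + e * of_real \<theta> \<in> W) \<and>
    (\<forall>\<theta>\<in>{0..\<Theta>}. \<forall>x\<in>{l..m1} \<union> {m2..r}. \<forall>t\<in>{0..s}. Z (x, t) + e * of_real \<theta> \<in> W) \<and>
    (\<forall>x\<in>{l..r}. \<forall>t\<in>{0..s}. Z (x, t) + e * of_real \<Theta> \<in> W)"

definition trace_test :: "(complex \<Rightarrow> complex) \<Rightarrow> real \<Rightarrow> complex" where
  "trace_test G x = \<psi> x * (G (Z (x, 0)) * px Z (x, 0))"

lemma smooth_b: "smooth_on V (\<lambda>p. a p * b1 (fst p))" "smooth_on V (\<lambda>p. a p * b2 (fst p))"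
  using smooth_on_mult[OF open_V smooth_a smooth_on_fst[OF open_V smooth_cutoff(2)]]
    smooth_on_mult[OF open_V smooth_a smooth_on_fst[OF open_V smooth_cutoff(3)]] by simp_all

text \<open>Each horizontal slice of a side integral is a pairing, bounded independently of \<open>t\<close>; so the sides stay bounded
  as the lower level goes down to the boundary.\<close>

lemma sides_le:
  assumes g: "solution g gx" "tame n g"
  obtains C where "C \<ge> 0"
    "\<And>G W t s B. open W \<Longrightarrow> G holomorphic_on W \<Longrightarrow> 0 < t \<Longrightarrow> t \<le> s \<Longrightarrow> s \<le> T \<Longrightarrow>
      (\<forall>x\<in>{l..m1} \<union> {m2..r}. \<forall>t\<in>{0..s}. Z (x, t) \<in> W) \<Longrightarrow>
      (\<forall>i\<le>n. \<forall>x\<in>{l..m1} \<union> {m2..r}. \<forall>t\<in>{0..s}. cmod ((deriv ^^ i) G (Z (x, t))) \<le> B) \<Longrightarrow>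
      cmod (side1 g G t s) + cmod (side2 g G t s) \<le> C * B"
proof -
  have mm: "m1 \<le> r" "l \<le> m2" using m by auto
  obtain C1 where C1: "C1 \<ge> 0" "pairing_le n l m1 g (\<lambda>p. a p * b1 (fst p)) C1"
    using pairing_bound[OF order_refl m(1) mm(1) g smooth_b(1)] b1_0 by auto
  obtain C2 where C2: "C2 \<ge> 0" "pairing_le n m2 r g (\<lambda>p. a p * b2 (fst p)) C2"
    using pairing_bound[OF mm(2) m(3) order_refl g smooth_b(2)] b2_0 by auto
  have le: "cmod (side1 g G t s) + cmod (side2 g G t s) \<le> (C1 + C2) * T * B"
    if W: "open W" "G holomorphic_on W" and t: "0 < t" "t \<le> s" "s \<le> T"
      and inW: "\<forall>x\<in>{l..m1} \<union> {m2..r}. \<forall>t\<in>{0..s}. Z (x, t) \<in> W"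
      and B: "\<forall>i\<le>n. \<forall>x\<in>{l..m1} \<union> {m2..r}. \<forall>t\<in>{0..s}. cmod ((deriv ^^ i) G (Z (x, t))) \<le> B"
    for G W t s B
  proof -
    have "cmod ((deriv ^^ 0) G (Z (l, t))) \<le> B" by (rule B[rule_format]) (use t m in auto)
    then have B0: "B \<ge> 0" using order_trans[OF norm_ge_zero] by blast
    note cG = continuous_on_compose2[OF holomorphic_on_imp_continuous_on[OF W(2)]]
    have "cmod (side1 g G t s) \<le> C1 * B * (s - t)"
      unfolding side1_def
    proof (rule integral_box_le[OF _ t(2)])
      have "continuous_on (cbox (l, t) (m1, s)) (\<lambda>p. G (Z p))"
        using inW t by (intro cG[OF smooth_box[OF smooth_Z order_refl mm(1) t(1,3)]]) (auto simp: cbox_Pair_eq)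
      then show "continuous_on (cbox (l, t) (m1, s)) (\<lambda>p. g p * (a p * b1 (fst p) * (G (Z p) * px Z p)))"
        by (intro continuous_on_mult solution_box[OF g(1) order_refl mm(1) t(1,3)]
          smooth_box[OF smooth_a order_refl mm(1) t(1,3)] cutoff_continuous
          smooth_box[OF smooth_on_px[OF smooth_Z] order_refl mm(1) t(1,3)])
      fix t' assume t': "t' \<in> {t..s}"
      show "cmod (integral {l..m1} (\<lambda>x. g (x, t') * (a (x, t') * b1 (fst (x, t')) * (G (Z (x, t')) * px Z (x, t'))))) \<le> C1 * B"
        using t' t inW B by (intro pairing_leD[OF C1(2) W]) auto
    qed
    moreover have "cmod (side2 g G t s) \<le> C2 * B * (s - t)"
      unfolding side2_def
    proof (rule integral_box_le[OF _ t(2)])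
      have "continuous_on (cbox (m2, t) (r, s)) (\<lambda>p. G (Z p))"
        using inW t by (intro cG[OF smooth_box[OF smooth_Z mm(2) order_refl t(1,3)]]) (auto simp: cbox_Pair_eq)
      then show "continuous_on (cbox (m2, t) (r, s)) (\<lambda>p. g p * (a p * b2 (fst p) * (G (Z p) * px Z p)))"
        by (intro continuous_on_mult solution_box[OF g(1) mm(2) order_refl t(1,3)]
          smooth_box[OF smooth_a mm(2) order_refl t(1,3)] cutoff_continuous
          smooth_box[OF smooth_on_px[OF smooth_Z] mm(2) order_refl t(1,3)])
      fix t' assume t': "t' \<in> {t..s}"
      show "cmod (integral {m2..r} (\<lambda>x. g (x, t') * (a (x, t') * b2 (fst (x, t')) * (G (Z (x, t')) * px Z (x, t'))))) \<le> C2 * B"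
        using t' t inW B by (intro pairing_leD[OF C2(2) W]) auto
    qed
    moreover have "C1 * B * (s - t) \<le> C1 * B * T" "C2 * B * (s - t) \<le> C2 * B * T"
      using C1(1) C2(1) B0 t by (intro mult_left_mono; simp)+
    ultimately have "cmod (side1 g G t s) + cmod (side2 g G t s) \<le> C1 * B * T + C2 * B * T" by linarith
    then show ?thesis by (simp add: algebra_simps)
  qed
  have "(C1 + C2) * T \<ge> 0" using C1(1) C2(1) T_pos by simp
  from that[OF this le] show ?thesis .
qed

lemma trace_test_function:
  assumes W: "open W" "G holomorphic_on W" and inW: "\<And>x. x \<in> {l..r} \<Longrightarrow> Z (x, 0) \<in> W" and X: "{l..r} \<subseteq> X"
  shows "test_function X (trace_test G)"
proof -
  note d = conservation_law[OF W]
  let ?V = "{p \<in> V. Z p \<in> W}"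
  let ?S = "(\<lambda>x. (x, 0)) -` ?V"
  have S: "open ?S" by (intro open_vimage d(1) continuous_intros)
  have sub: "{l..r} \<subseteq> ?S" using inV inW T_pos by auto
  have "smooth_on ?S (\<lambda>x. G (Z (x, 0)) * px Z (x, 0))"
    by (rule smooth_on_slice[OF S d(1) _ d(2)]) simp
  then have 1: "smooth_on ?S (trace_test G)"
    unfolding trace_test_def[abs_def]
    by (rule smooth_on_mult[OF S smooth_on_subset[OF smooth_cutoff(1) subset_UNIV]])
  have 2: "smooth_on (- {l..r}) (trace_test G)"
    by (rule smooth_on_cong[OF _ _ smooth_on_const[of _ 0]]) (use cutoff_0 in \<open>auto simp: trace_test_def\<close>)
  have "?S \<union> - {l..r} = UNIV" using sub by blast
  then have "smooth_on UNIV (trace_test G)"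
    using smooth_on_Un[OF S _ 1 2] by (simp add: open_Compl)
  moreover have "trace_test G x = 0" if "x \<notin> {l..r}" for x
  proof -
    have "\<psi> x = 0" using that by (intro cutoff_0) auto
    then show ?thesis by (simp add: trace_test_def)
  qed
  then have "{x. trace_test G x \<noteq> 0} \<subseteq> {l..r}" by blast
  then have cl: "closure {x. trace_test G x \<noteq> 0} \<subseteq> {l..r}" by (rule closure_minimal) simp
  then have "compact (closure {x. trace_test G x \<noteq> 0})"
    using bounded_subset[OF bounded_closed_interval[of l r]] by (simp add: compact_eq_bounded_closed)
  ultimately show ?thesis
    unfolding test_function_def using cl X by blast
qed

text \<open>At time \<open>t\<close> the level integral is the trace test function paired with \<open>f(\<cdot>, t)\<close>, plus a pairing with
  \<open>\<psi> (G(Z) Z\<^sub>x - G(\<zeta>) \<zeta>')\<close>, which is \<open>0\<close> on the lower edge.\<close>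

lemma level_tendsto_trace:
  assumes g: "solution g gx" "tame n g"
    and L: "has_trace X g L"
    and X: "{l..r} \<subseteq> X" and W: "open W" "G holomorphic_on W"
    and \<tau>: "0 < \<tau>" "\<tau> \<le> T" and inW: "\<And>x t. x \<in> {l..r} \<Longrightarrow> t \<in> {0..\<tau>} \<Longrightarrow> Z (x, t) \<in> W"
  shows "((\<lambda>t. level g G t) \<longlongrightarrow> L (trace_test G)) (at_right 0)"
proof -
  note d = conservation_law[OF W]
  let ?V = "{p \<in> V. Z p \<in> W}" and ?k = "\<lambda>p. G (Z p) * px Z p"
  let ?V' = "?V \<inter> (\<lambda>p. (fst p, 0)) -` ?V"
  have V': "open ?V'" by (intro open_Int open_vimage d(1) continuous_intros)
  have sub: "{l..r} \<times> {0..\<tau>} \<subseteq> ?V'" using inV inW \<tau> by auto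
  define w where "w p = \<psi> (fst p) * (?k p - ?k (fst p, 0))" for p
  have sw: "smooth_on ?V' w"
  proof -
    have 1: "smooth_on ?V' (\<lambda>p. \<psi> (fst p))" by (rule smooth_on_fst[OF V' smooth_cutoff(1)])
    have 2: "smooth_on ?V' ?k" by (rule smooth_on_subset[OF d(2)]) blast
    have 3: "smooth_on ?V' (\<lambda>p. ?k (fst p, 0))" by (rule smooth_on_slice_fst[OF V' d(1) _ d(2)]) blast
    show ?thesis unfolding w_def by (rule smooth_on_mult[OF V' 1 smooth_on_diff[OF V' 2 3]])
  qed
  have "((\<lambda>t. integral {l..r} (\<lambda>x. g (x, t) * w (x, t))) \<longlongrightarrow> 0) (at_right 0)"
    by (rule pairing_tendsto_0[OF V' _ sub \<tau> g sw]) (use cutoff_0 in \<open>auto simp: w_def\<close>)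
  moreover have tf: "test_function X (trace_test G)"
    by (rule trace_test_function[OF W _ X]) (use inW \<tau> in auto)
  ultimately have lim: "((\<lambda>t. integral {l..r} (\<lambda>x. g (x, t) * w (x, t)) + (LINT x|lborel. g (x, t) * trace_test G x))
      \<longlongrightarrow> 0 + L (trace_test G)) (at_right 0)"
    using L[unfolded has_trace_def, rule_format, of "trace_test G"] by (intro tendsto_add) simp_all
  have "integral {l..r} (\<lambda>x. g (x, t) * w (x, t)) + (LINT x|lborel. g (x, t) * trace_test G x) = level g G t"
    if t: "0 < t" "t < \<tau>" for t
  proof -
    have t': "t \<in> {0<..T}" using t \<tau> by auto
    have ct: "continuous_on {l..r} (\<lambda>x. g (x, t) * trace_test G x)"
      using tf solution_slice[OF g(1) t'] unfolding test_function_def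
      by (intro continuous_on_mult) (auto intro: continuous_on_subset[OF smooth_on_imp_continuous_on])
    have cw: "continuous_on {l..r} (\<lambda>x. g (x, t) * w (x, t))"
    proof -
      have "(x, t) \<in> ?V'" if "x \<in> {l..r}" for x by (rule subsetD[OF sub]) (use that t in auto)
      then show ?thesis
        by (intro continuous_on_mult solution_slice[OF g(1) t'] continuous_on_horizontal[OF smooth_on_imp_continuous_on[OF sw]])
    qed
    have "(LINT x|lborel. g (x, t) * trace_test G x) = integral {l..r} (\<lambda>x. g (x, t) * trace_test G x)"
      using cutoff_0 by (intro lborel_integral_eq_integral ct) (auto simp: trace_test_def)
    then have "integral {l..r} (\<lambda>x. g (x, t) * w (x, t)) + (LINT x|lborel. g (x, t) * trace_test G x)
        = integral {l..r} (\<lambda>x. g (x, t) * w (x, t) + g (x, t) * trace_test G x)"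
      using cw ct by (simp add: integral_add integrable_continuous_real)
    also have "\<dots> = level g G t"
      unfolding level_def by (intro integral_cong) (simp add: w_def trace_test_def algebra_simps)
    finally show ?thesis .
  qed
  then have "\<forall>\<^sub>F t in at_right 0. integral {l..r} (\<lambda>x. g (x, t) * w (x, t)) + (LINT x|lborel. g (x, t) * trace_test G x) = level g G t"
    unfolding eventually_at_right_field using \<tau>(1) by blast
  from Lim_transform_eventually[OF lim this] show ?thesis by simp
qed

text \<open>The identity between a low level \<open>t\<close> and \<open>s\<close>, in the limit \<open>t \<rightarrow> 0\<close>. For \<open>t\<close> below some \<open>\<tau>\<close> the level curve
  is so close to the lowest one that the hypotheses on the latter, being open conditions on compact sets, pass to it.\<close>

lemma trace_bound:
  assumes g: "solution g gx" "tame n g"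
    and L: "has_trace X g L"
    and X: "{l..r} \<subseteq> X"
  obtains C where "C \<ge> 0"
    "\<And>G W s e \<Theta> B. admissible G W s e \<Theta> \<Longrightarrow>
      (\<forall>i\<le>n. \<forall>x\<in>{l..m1} \<union> {m2..r}. \<forall>t\<in>{0..s}. cmod ((deriv ^^ i) G (Z (x, t))) \<le> B) \<Longrightarrow>
      cmod (L (trace_test G)) \<le> cmod (level g G s) + C * B"
proof -
  obtain C where C: "C \<ge> 0" "\<And>G W t s B. open W \<Longrightarrow> G holomorphic_on W \<Longrightarrow> 0 < t \<Longrightarrow> t \<le> s \<Longrightarrow> s \<le> T \<Longrightarrow>
      (\<forall>x\<in>{l..m1} \<union> {m2..r}. \<forall>t\<in>{0..s}. Z (x, t) \<in> W) \<Longrightarrow>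
      (\<forall>i\<le>n. \<forall>x\<in>{l..m1} \<union> {m2..r}. \<forall>t\<in>{0..s}. cmod ((deriv ^^ i) G (Z (x, t))) \<le> B) \<Longrightarrow>
      cmod (side1 g G t s) + cmod (side2 g G t s) \<le> C * B"
    by (rule sides_le[OF g]) blast
  have le: "cmod (L (trace_test G)) \<le> cmod (level g G s) + C * B"
    if adm: "admissible G W s e \<Theta>"
      and B: "\<forall>i\<le>n. \<forall>x\<in>{l..m1} \<union> {m2..r}. \<forall>t\<in>{0..s}. cmod ((deriv ^^ i) G (Z (x, t))) \<le> B"
    for G W s e \<Theta> B
  proof -
    have W: "open W" "G holomorphic_on W" and s: "0 < s" "s \<le> T" and e: "cmod e = 1" and \<Theta>: "0 \<le> \<Theta>"
      and bot: "\<And>x \<theta>. x \<in> {l..r} \<Longrightarrow> \<theta> \<in> {0..\<Theta>} \<Longrightarrow> Z (x, 0) + e * of_real \<theta> \<in> W"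
      and top: "\<And>x \<theta>. x \<in> {l..r} \<Longrightarrow> \<theta> \<in> {0..\<Theta>} \<Longrightarrow> Z (x, s) + e * of_real \<theta> \<in> W"
      and sides: "\<And>x t \<theta>. x \<in> {l..m1} \<union> {m2..r} \<Longrightarrow> t \<in> {0..s} \<Longrightarrow> \<theta> \<in> {0..\<Theta>} \<Longrightarrow> Z (x, t) + e * of_real \<theta> \<in> W"
      and far: "\<And>x t. x \<in> {l..r} \<Longrightarrow> t \<in> {0..s} \<Longrightarrow> Z (x, t) + e * of_real \<Theta> \<in> W"
      using adm unfolding admissible_def by blast+
    have cZ: "continuous_on ({l..r} \<times> {0..T}) Z" by (rule continuous_on_rect[OF smooth_Z])
    have cZ0: "continuous_on {l..r} (\<lambda>x. Z (x, 0))" using T_pos by (intro smooth_slice[OF smooth_Z]) auto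
    have "compact ((\<lambda>x. Z (x, 0)) ` {l..r})"
      by (intro compact_continuous_image cZ0 compact_Icc)
    from compact_shift_margin[OF this W(1) _ e, of 0 \<Theta>] obtain \<epsilon> where \<epsilon>: "\<epsilon> > 0"
      "\<forall>z\<in>(\<lambda>x. Z (x, 0)) ` {l..r}. \<forall>\<theta>\<in>{0..\<Theta>}. \<forall>z' \<eta>. cmod (z' - z) < \<epsilon> \<longrightarrow> cmod (\<eta> - of_real \<theta>) < \<epsilon> \<longrightarrow> z' + e * \<eta> \<in> W"
      using bot by blast
    have "uniformly_continuous_on ({l..r} \<times> {0..T}) Z"
      by (intro compact_uniformly_continuous cZ compact_Times compact_Icc)
    then obtain \<delta> where \<delta>: "\<delta> > 0" "\<forall>p\<in>{l..r} \<times> {0..T}. \<forall>q\<in>{l..r} \<times> {0..T}. dist q p < \<delta> \<longrightarrow> dist (Z q) (Z p) < \<epsilon>"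
      using \<epsilon>(1) unfolding uniformly_continuous_on_def by blast
    define \<tau> where "\<tau> = min (\<delta> / 2) s"
    have \<tau>: "0 < \<tau>" "\<tau> \<le> s" "\<tau> \<le> T" using \<delta>(1) s by (auto simp: \<tau>_def)
    have low: "Z (x, t) + e * of_real \<theta> \<in> W" if "x \<in> {l..r}" "t \<in> {0..\<tau>}" "\<theta> \<in> {0..\<Theta>}" for x t \<theta>
    proof -
      have "dist (x, t) (x, 0) < \<delta>" using that \<delta>(1) by (auto simp: dist_Pair_Pair \<tau>_def)
      then have "dist (Z (x, t)) (Z (x, 0)) < \<epsilon>"
        using \<delta>(2)[rule_format, of "(x, 0)" "(x, t)"] that \<tau> T_pos by auto
      then show ?thesis
        using \<epsilon>(2)[rule_format, of "Z (x, 0)" \<theta> "Z (x, t)" "of_real \<theta>"] that \<epsilon>(1) by (auto simp: dist_norm)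
    qed
    have lim: "((\<lambda>t. level g G t) \<longlongrightarrow> L (trace_test G)) (at_right 0)"
      using low[of _ _ 0] \<Theta> by (intro level_tendsto_trace[OF g L X W \<tau>(1,3)]) auto
    have "cmod (level g G t) \<le> cmod (level g G s) + C * B" if t: "0 < t" "t < \<tau>" for t
    proof -
      have "level g G s - level g G t = side1 g G t s - side2 g G t s"
        using t \<tau> s low top sides far by (intro level_identity_shift[OF g(1) W _ _ _ e \<Theta>]) auto
      then have "level g G t = level g G s - (side1 g G t s - side2 g G t s)" by (simp add: algebra_simps)
      then have "cmod (level g G t) \<le> cmod (level g G s) + (cmod (side1 g G t s) + cmod (side2 g G t s))"
        by (metis norm_triangle_ineq4 order_trans add_left_mono)
      also have "cmod (side1 g G t s) + cmod (side2 g G t s) \<le> C * B"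
        using t \<tau> s sides[of _ _ 0] \<Theta> by (intro C(2)[OF W _ _ _ _ B]) auto
      finally show ?thesis by simp
    qed
    then have "\<forall>\<^sub>F t in at_right 0. cmod (level g G t) \<le> cmod (level g G s) + C * B"
      unfolding eventually_at_right_field using \<tau>(1) by blast
    from tendsto_upperbound[OF tendsto_norm[OF lim] this] show ?thesis by simp
  qed
  show ?thesis by (rule that[OF C(1)]) (rule le)
qed

end

section \<open>Smooth steps\<close>

lemma frechet_derivative_real:
  fixes f :: "real \<Rightarrow> 'b::real_normed_vector"
  assumes "(f has_vector_derivative f') (at x)"
  shows "frechet_derivative f (at x) 1 = f'"
  using fun_cong[OF frechet_derivative_at[OF assms[unfolded has_vector_derivative_def]], of 1] by simp

lemma Ck_on_real_family:
  fixes F :: "(real \<Rightarrow> complex) set"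
  assumes "\<And>f. f \<in> F \<Longrightarrow> \<exists>f'\<in>F. \<forall>x. (f has_vector_derivative f' x) (at x)"
  shows "f \<in> F \<Longrightarrow> Ck_on k UNIV f"
proof (induction k arbitrary: f)
  case 0
  then obtain f' where "\<And>x. (f has_vector_derivative f' x) (at x)" using assms by blast
  then show ?case by (auto intro!: continuous_at_imp_continuous_on has_vector_derivative_continuous)
next
  case (Suc k)
  then obtain f' where f': "f' \<in> F" "\<And>x. (f has_vector_derivative f' x) (at x)" using assms by blast
  note d = f'(2)[unfolded has_vector_derivative_def]
  have "(\<lambda>p. frechet_derivative f (at p) 1) = f'"
    by (intro ext frechet_derivative_real f'(2))
  then show ?case using differentiableI[OF d] Suc.IH[OF f'(1)] by simp
qed

text \<open>The classical flat functions \<open>p(1/x) e\<^sup>-\<^sup>1\<^sup>/\<^sup>x\<close>. With arbitrary polynomials the family is closed under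
  differentiation.\<close>

definition flat_exp :: "real poly \<Rightarrow> real \<Rightarrow> real" where
  "flat_exp P x = (if x > 0 then poly P (1 / x) * exp (- (1 / x)) else 0)"

lemma poly_exp_tendsto_0: "((\<lambda>y. poly P y * exp (- y)) \<longlongrightarrow> (0 :: real)) at_top"
proof -
  have "((\<lambda>y. \<Sum>i\<le>degree P. coeff P i * (y ^ i / exp y)) \<longlongrightarrow> (\<Sum>i\<le>degree P. coeff P i * 0)) at_top"
    by (intro tendsto_sum tendsto_mult tendsto_const tendsto_power_div_exp_0)
  moreover have "(\<Sum>i\<le>degree P. coeff P i * (y ^ i / exp y)) = poly P y * exp (- y)" for y
    by (simp add: poly_altdef sum_distrib_right exp_minus divide_inverse mult.assoc)
  ultimately show ?thesis by simp
qed

lemma flat_exp_tendsto_0: "(flat_exp P \<longlongrightarrow> 0) (at_right 0)"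
proof (rule Lim_transform_eventually)
  have "filterlim (\<lambda>x :: real. 1 / x) at_top (at_right 0)"
    using filterlim_inverse_at_top_right by (simp add: inverse_eq_divide)
  from filterlim_compose[OF poly_exp_tendsto_0 this]
  show "((\<lambda>x. poly P (1 / x) * exp (- (1 / x))) \<longlongrightarrow> 0) (at_right 0)" .
  show "\<forall>\<^sub>F x in at_right 0. poly P (1 / x) * exp (- (1 / x)) = flat_exp P x"
    unfolding eventually_at_right_field by (auto simp: flat_exp_def intro!: exI[of _ 1])
qed

lemma flat_exp_deriv:
  "(flat_exp P has_real_derivative flat_exp ([:0, 0, 1:] * (P - pderiv P)) x) (at x)"
proof -
  consider "x > 0" | "x < 0" | "x = 0" by linarith
  then show ?thesis
  proof cases
    case 1
    have "((\<lambda>x. poly P (1 / x) * exp (- (1 / x))) has_real_derivative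
        poly ([:0, 0, 1:] * (P - pderiv P)) (1 / x) * exp (- (1 / x))) (at x)"
      using 1 by (auto intro!: derivative_eq_intros simp: field_simps power2_eq_square)
    then have "((\<lambda>x. poly P (1 / x) * exp (- (1 / x))) has_real_derivative flat_exp ([:0, 0, 1:] * (P - pderiv P)) x) (at x)"
      using 1 by (simp add: flat_exp_def)
    then show ?thesis
      by (rule has_field_derivative_transform_within[where d = x]) (use 1 in \<open>auto simp: flat_exp_def dist_real_def\<close>)
  next
    case 2
    have "((\<lambda>x. 0) has_real_derivative flat_exp ([:0, 0, 1:] * (P - pderiv P)) x) (at x)"
      using 2 by (simp add: flat_exp_def)
    then show ?thesis
      by (rule has_field_derivative_transform_within[where d = "- x"]) (use 2 in \<open>auto simp: flat_exp_def dist_real_def\<close>)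
  next
    case 3
    have "((\<lambda>h. (flat_exp P (0 + h) - flat_exp P 0) / h) \<longlongrightarrow> 0) (at 0)"
    proof (rule filterlim_split_at)
      have "\<forall>\<^sub>F h in at_left 0. 0 = (flat_exp P (0 + h) - flat_exp P 0) / h"
        unfolding eventually_at_left_field by (auto simp: flat_exp_def intro!: exI[of _ "-1"])
      then show "((\<lambda>h. (flat_exp P (0 + h) - flat_exp P 0) / h) \<longlongrightarrow> 0) (at_left 0)"
        by (rule Lim_transform_eventually[OF tendsto_const])
      have "\<forall>\<^sub>F h in at_right 0. flat_exp ([:0, 1:] * P) h = (flat_exp P (0 + h) - flat_exp P 0) / h"
        unfolding eventually_at_right_field by (auto simp: flat_exp_def intro!: exI[of _ 1])
      then show "((\<lambda>h. (flat_exp P (0 + h) - flat_exp P 0) / h) \<longlongrightarrow> 0) (at_right 0)"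
        by (rule Lim_transform_eventually[OF flat_exp_tendsto_0])
    qed
    then show ?thesis using 3 by (simp add: DERIV_def flat_exp_def)
  qed
qed

lemma smooth_flat_exp: "smooth_on UNIV (\<lambda>x. complex_of_real (flat_exp P x))"
  unfolding smooth_on_def
proof
  fix k
  show "Ck_on k UNIV (\<lambda>x. complex_of_real (flat_exp P x))"
  proof (rule Ck_on_real_family[where F = "range (\<lambda>P x. complex_of_real (flat_exp P x))"])
    fix f assume "f \<in> range (\<lambda>P x. complex_of_real (flat_exp P x))"
    then obtain P where f: "f = (\<lambda>x. complex_of_real (flat_exp P x))" by blast
    have "(f has_vector_derivative complex_of_real (flat_exp ([:0, 0, 1:] * (P - pderiv P)) x)) (at x)" for x
      unfolding f using flat_exp_deriv[of P x]
      by (intro bounded_linear.has_vector_derivative[OF bounded_linear_of_real])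
        (simp add: has_real_derivative_iff_has_vector_derivative)
    then show "\<exists>f'\<in>range (\<lambda>P x. complex_of_real (flat_exp P x)). \<forall>x. (f has_vector_derivative f' x) (at x)"
      by (intro bexI[OF _ rangeI] allI)
  qed blast
qed

text \<open>\<open>\<sigma>\<close> is the normalized integral of a nonnegative bump on \<open>{c<..<d}\<close>.\<close>

lemma smooth_step:
  fixes c d :: real
  assumes "c < d"
  obtains \<sigma> b :: "real \<Rightarrow> complex"
  where "smooth_on UNIV \<sigma>" "smooth_on UNIV b" "\<And>x. (\<sigma> has_vector_derivative b x) (at x)"
    "\<And>x. x \<notin> {c<..<d} \<Longrightarrow> b x = 0" "\<And>x. x \<le> c \<Longrightarrow> \<sigma> x = 0" "\<And>x. x \<ge> d \<Longrightarrow> \<sigma> x = 1"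
    "\<And>x. cmod (\<sigma> x) \<le> 1" "\<And>x. cmod (1 - \<sigma> x) \<le> 1"
proof -
  define f where "f x = flat_exp 1 (x - c) * flat_exp 1 (d - x)" for x
  have f_pos: "f x > 0" if "x \<in> {c<..<d}" for x using that by (simp add: f_def flat_exp_def)
  have f_0: "f x = 0" if "x \<notin> {c<..<d}" for x using that by (auto simp: f_def flat_exp_def)
  have f_supp: "c < x \<and> x < d" if "f x \<noteq> 0" for x using that f_0[of x] by auto
  have f_nonneg: "f x \<ge> 0" for x using f_pos[of x] f_0[of x] by fastforce
  have sm: "smooth_on UNIV (\<lambda>x. complex_of_real (f x))"
  proof -
    have "smooth_on UNIV (\<lambda>x. complex_of_real (flat_exp 1 (x + - c)))"
      by (rule smooth_on_affine[OF bounded_linear_ident open_UNIV open_UNIV _ smooth_flat_exp]) simp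
    moreover have "smooth_on UNIV (\<lambda>x. complex_of_real (flat_exp 1 (- x + d)))"
      by (rule smooth_on_affine[OF bounded_linear_minus[OF bounded_linear_ident] open_UNIV open_UNIV _ smooth_flat_exp]) simp
    ultimately have "smooth_on UNIV (\<lambda>x. complex_of_real (flat_exp 1 (x + - c)) * complex_of_real (flat_exp 1 (- x + d)))"
      by (rule smooth_on_mult[OF open_UNIV])
    then show ?thesis by (simp add: f_def)
  qed
  have cont: "continuous_on S f" for S
  proof -
    have "continuous_on UNIV (\<lambda>x. Re (complex_of_real (f x)))"
      by (intro continuous_on_Re smooth_on_imp_continuous_on[OF sm])
    then show ?thesis using continuous_on_subset by auto
  qed
  define K where "K = integral {c..d} f"
  have K: "K > 0"
  proof -
    have "K \<ge> 0" unfolding K_def by (intro integral_nonneg integrable_continuous_real cont f_nonneg)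
    moreover have "K \<noteq> 0"
    proof
      assume "K = 0"
      then have "(f has_integral 0) (cbox c d)"
        unfolding K_def using integrable_integral[OF integrable_continuous_real[OF cont]] by (metis cbox_interval)
      then have "f ((c + d) / 2) = 0"
        using assms by (intro has_integral_0_cbox_imp_0[OF cont f_nonneg]) auto
      then show False using f_pos[of "(c + d) / 2"] assms by auto
    qed
    ultimately show ?thesis by simp
  qed
  define s where "s x = integral {c..x} f / K" for x
  have s': "(s has_real_derivative f x / K) (at x)" for x
  proof -
    define A where "A = min c x - 1"
    have A: "A < c" "A < x" by (auto simp: A_def)
    have s_eq: "s y = integral {A..y} f / K" for y
    proof -
      have "integral {A..y} f = integral {c..y} f"
        by (rule integral_spike_set[OF empty_imp_negligible empty_imp_negligible]) (use A in \<open>auto dest!: f_supp\<close>)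
      then show ?thesis by (simp add: s_def)
    qed
    have "((\<lambda>y. integral {A..y} f) has_vector_derivative f x) (at x within {A..x+1})"
      using A by (intro integral_has_vector_derivative cont) auto
    moreover have "at x within {A..x+1} = at x" using A by (intro at_within_Icc_at) auto
    ultimately have "((\<lambda>y. integral {A..y} f) has_real_derivative f x) (at x)"
      by (simp add: has_real_derivative_iff_has_vector_derivative)
    from DERIV_cdivide[OF this, of K] show ?thesis by (simp add: s_eq[abs_def])
  qed
  define \<sigma> where "\<sigma> x = complex_of_real (s x)" for x
  define b where "b x = complex_of_real (1 / K) * complex_of_real (f x)" for x
  have b: "smooth_on UNIV b" unfolding b_def by (rule smooth_on_mult[OF open_UNIV smooth_on_const sm])
  have \<sigma>': "(\<sigma> has_vector_derivative b x) (at x)" for x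
  proof -
    have "(\<sigma> has_vector_derivative complex_of_real (f x / K)) (at x)"
      unfolding \<sigma>_def[abs_def] using s'[of x]
      by (intro bounded_linear.has_vector_derivative[OF bounded_linear_of_real])
        (simp add: has_real_derivative_iff_has_vector_derivative)
    then show ?thesis by (simp add: b_def)
  qed
  have \<sigma>: "smooth_on UNIV \<sigma>"
    unfolding smooth_on_def
  proof
    fix k
    note dd = \<sigma>'[unfolded has_vector_derivative_def]
    have "(\<lambda>p. frechet_derivative \<sigma> (at p) 1) = b"
      by (intro ext frechet_derivative_real \<sigma>')
    then have "Ck_on (Suc k) UNIV \<sigma>" using differentiableI[OF dd] b by (simp add: smooth_on_def)
    then show "Ck_on k UNIV \<sigma>" by (rule Ck_on_Suc_D[OF open_UNIV])
  qed
  have s_le: "0 \<le> s x" "s x \<le> 1" for x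
  proof -
    show "0 \<le> s x" unfolding s_def using K
      by (intro divide_nonneg_pos integral_nonneg integrable_continuous_real cont f_nonneg)
    have "integral {c..x} f = integral ({c..x} \<inter> {c..d}) f"
      by (rule integral_spike_set[OF empty_imp_negligible empty_imp_negligible]) (auto dest!: f_supp)
    also have "\<dots> \<le> K"
      unfolding K_def Int_atLeastAtMost using f_nonneg
      by (intro integral_subset_le integrable_continuous_real cont) auto
    finally show "s x \<le> 1" unfolding s_def using K by simp
  qed
  have s0: "s x = 0" if "x \<le> c" for x
  proof (cases "x = c")
    case False
    then show ?thesis using that by (simp add: s_def)
  qed (simp add: s_def)
  have s1: "s x = 1" if "x \<ge> d" for x
  proof -
    have "integral {c..x} f = integral {c..d} f"
      by (rule integral_spike_set[OF empty_imp_negligible empty_imp_negligible]) (use that in \<open>auto dest!: f_supp\<close>)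
    then show ?thesis using K by (simp add: s_def K_def)
  qed
  have norm_s: "cmod (\<sigma> x) \<le> 1" "cmod (1 - \<sigma> x) \<le> 1" for x
  proof -
    have "1 - \<sigma> x = complex_of_real (1 - s x)" by (simp add: \<sigma>_def)
    then show "cmod (1 - \<sigma> x) \<le> 1" using s_le[of x] by (simp only: norm_of_real)
    show "cmod (\<sigma> x) \<le> 1" using s_le[of x] by (simp add: \<sigma>_def)
  qed
  show ?thesis
    by (rule that[of \<sigma> b]) (use \<sigma> b \<sigma>' f_0 s0 s1 norm_s in \<open>simp_all add: b_def \<sigma>_def\<close>)
qed

section \<open>Nearly horizontal level curves\<close>

text \<open>Leibniz' rule on the set \<open>W\<close>, which is open because the projection of a closed set along a compact interval is
  closed.\<close>

lemma kernel_integral_holomorphic: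
  fixes D :: "complex \<Rightarrow> real \<Rightarrow> complex" and q :: "real \<Rightarrow> complex"
  assumes q: "continuous_on {c..d} q"
    and D: "continuous_on (UNIV \<times> {c..d}) (\<lambda>p. D (fst p) (snd p))"
    and D': "\<And>z s. s \<in> {c..d} \<Longrightarrow> ((\<lambda>z. D z s) has_field_derivative D' z s) (at z)"
    and cD': "continuous_on (UNIV \<times> {c..d}) (\<lambda>p. D' (fst p) (snd p))"
  defines "W \<equiv> {z. \<forall>s\<in>{c..d}. D z s \<noteq> 0}"
  shows "open W" "(\<lambda>z. integral {c..d} (\<lambda>s. q s / D z s)) holomorphic_on W"
proof -
  let ?C = "{p \<in> {c..d} \<times> UNIV. D (snd p) (fst p) = 0}"
  have "continuous_on ({c..d} \<times> UNIV) (\<lambda>p. (snd p, fst p))"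
    by (intro continuous_on_Pair continuous_on_snd continuous_on_fst continuous_on_id)
  from continuous_on_compose2[OF D this] have "continuous_on ({c..d} \<times> UNIV) (\<lambda>p. D (snd p) (fst p))"
    by force
  then have "closed ?C"
    by (rule continuous_closed_preimage_constant[OF _ closed_Times[OF closed_atLeastAtMost closed_UNIV]])
  then have "closed {z. \<exists>s. s \<in> {c..d} \<and> (s, z) \<in> ?C}" by (rule closed_compact_projection[OF compact_Icc])
  moreover have "W = - {z. \<exists>s. s \<in> {c..d} \<and> (s, z) \<in> ?C}"
    by (auto simp: W_def)
  ultimately show W: "open W" by (simp add: open_Compl)
  show "(\<lambda>z. integral {c..d} (\<lambda>s. q s / D z s)) holomorphic_on W"
    unfolding holomorphic_on_open[OF W]
  proof
    fix z assume "z \<in> W"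
    then obtain e where e: "e > 0" "ball z e \<subseteq> W" using W open_contains_ball by blast
    have nz: "D w s \<noteq> 0" if "w \<in> ball z e" "s \<in> {c..d}" for w s using e that by (auto simp: W_def)
    have "(\<lambda>z. integral (cbox c d) (\<lambda>s. q s / D z s)) holomorphic_on ball z e"
    proof (rule leibniz_rule_holomorphic[where fx = "\<lambda>z s. - (q s * D' z s) / (D z s * D z s)"])
      show "((\<lambda>z. q s / D z s) has_field_derivative - (q s * D' w s) / (D w s * D w s)) (at w within ball z e)"
        if "w \<in> ball z e" "s \<in> cbox c d" for w s
      proof -
        have "D w s \<noteq> 0" using nz that by simp
        have "((\<lambda>z. q s / D z s) has_field_derivative (0 * D w s - q s * D' w s) / (D w s * D w s)) (at w)"
          by (rule DERIV_divide[OF DERIV_const D']) (use that \<open>D w s \<noteq> 0\<close> in auto)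
        then show ?thesis by (simp add: has_field_derivative_at_within)
      qed
      show "(\<lambda>s. q s / D w s) integrable_on cbox c d" if "w \<in> ball z e" for w
      proof -
        have "continuous_on {c..d} (\<lambda>s. D w s)"
          using continuous_on_compose2[OF D, of "{c..d}" "\<lambda>s. (w, s)"]
          by (simp add: continuous_on_Pair image_subset_iff)
        then have "continuous_on {c..d} (\<lambda>s. q s / D w s)"
          using nz[OF that] by (intro continuous_on_divide q) auto
        then show ?thesis by (simp add: integrable_continuous_real)
      qed
      have sub: "ball z e \<times> cbox c d \<subseteq> UNIV \<times> {c..d}" by auto
      have "continuous_on (ball z e \<times> cbox c d) (\<lambda>p. q (snd p))"
        by (rule continuous_on_compose2[OF q continuous_on_snd[OF continuous_on_id]]) auto
      then have "continuous_on (ball z e \<times> cbox c d) (\<lambda>p. - (q (snd p) * D' (fst p) (snd p)) / (D (fst p) (snd p) * D (fst p) (snd p)))"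
        using nz by (intro continuous_on_divide continuous_on_minus continuous_on_mult
            continuous_on_subset[OF D sub] continuous_on_subset[OF cD' sub]) auto
      then show "continuous_on (ball z e \<times> cbox c d) (\<lambda>(z, s). - (q s * D' z s) / (D z s * D z s))"
        by (simp add: case_prod_beta')
    qed simp
    then show "\<exists>f'. ((\<lambda>z. integral {c..d} (\<lambda>s. q s / D z s)) has_field_derivative f') (at z)"
      using e(1) by (simp add: holomorphic_on_open)
  qed
qed

lemma norm_one_minus_exp_le: "cmod (1 - exp (- z)) \<le> cmod z * exp (cmod z)"
proof -
  have "cmod (exp (- z) - exp 0) \<le> exp (cmod z) * cmod (- z - 0)"
  proof (rule field_differentiable_bound[OF convex_cball[of 0 "cmod z"]])
    show "(exp has_field_derivative exp w) (at w within cball 0 (cmod z))" for w :: complex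
      using DERIV_exp has_field_derivative_at_within by blast
    show "cmod (exp w) \<le> exp (cmod z)" if "w \<in> cball 0 (cmod z)" for w
      using order_trans[OF norm_exp[of w], of "exp (cmod z)"] that by simp
  qed auto
  then show ?thesis by (simp add: norm_minus_commute mult.commute)
qed

lemma abs_near:
  fixes a d :: real
  assumes "\<bar>a - d\<bar> \<le> \<bar>d\<bar> / 4"
  shows "3 / 4 * \<bar>d\<bar> \<le> \<bar>a\<bar>"
  using assms by (simp add: abs_if split: if_splits)

text \<open>\<open>Z\<close> is within \<open>\<epsilon>\<close> of the identity in \<open>x\<close>, hence the level curves are graphs of slope at most \<open>1/3\<close>. Over the
  sides they keep the horizontal distance \<open>\<rho>\<close> from the part of the lowest curve above \<open>{i1..i2}\<close>, on which the peaks
  will be placed.\<close>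

locale flat_strip = cutoff_strip +
  fixes \<epsilon> \<rho> i1 i2 :: real
  assumes eps: "0 < \<epsilon>" "\<epsilon> \<le> 1 / 4"
    and Z_near: "\<And>x y t. x \<in> {l..r} \<Longrightarrow> y \<in> {l..r} \<Longrightarrow> t \<in> {0..T} \<Longrightarrow>
      cmod (Z (x, t) - Z (y, t) - of_real (x - y)) \<le> \<epsilon> * \<bar>x - y\<bar>"
    and Zx_near: "\<And>x t. x \<in> {l..r} \<Longrightarrow> t \<in> {0..T} \<Longrightarrow> cmod (px Z (x, t) - 1) \<le> \<epsilon>"
    and I: "m1 < i1" "i1 < i2" "i2 < m2"
    and rho: "0 < \<rho>"
    and side_sep: "\<And>x t s. x \<in> {l..m1} \<union> {m2..r} \<Longrightarrow> t \<in> {0..T} \<Longrightarrow> s \<in> {i1..i2} \<Longrightarrow>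
      \<rho> \<le> \<bar>Re (Z (x, t) - Z (s, 0))\<bar>"
begin

abbreviation \<zeta> :: "real \<Rightarrow> complex" where "\<zeta> s \<equiv> Z (s, 0)"
abbreviation \<zeta>' :: "real \<Rightarrow> complex" where "\<zeta>' s \<equiv> px Z (s, 0)"

lemma I_sub: "s \<in> {i1..i2} \<Longrightarrow> s \<in> {l..r}"
  using I m by auto

lemma zero_in: "0 \<in> {0..T}" using T_pos by simp

lemma continuous_zeta: "continuous_on {l..r} \<zeta>" "continuous_on {l..r} \<zeta>'"
  using smooth_slice[OF smooth_Z zero_in] smooth_slice[OF smooth_on_px[OF smooth_Z] zero_in] .

lemma Re_Im_near:
  assumes "x \<in> {l..r}" "y \<in> {l..r}" "t \<in> {0..T}"
  shows "\<bar>Re (Z (x, t) - Z (y, t)) - (x - y)\<bar> \<le> \<bar>x - y\<bar> / 4"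
    and "\<bar>Im (Z (x, t) - Z (y, t))\<bar> \<le> \<bar>x - y\<bar> / 4"
    and "\<bar>Re (Z (x, t) - Z (y, t))\<bar> \<ge> 3 / 4 * \<bar>x - y\<bar>"
    and "cmod (Z (x, t) - Z (y, t)) \<le> 5 / 4 * \<bar>x - y\<bar>"
    and "\<bar>Im (Z (x, t) - Z (y, t))\<bar> \<le> \<bar>Re (Z (x, t) - Z (y, t))\<bar> / 3"
proof -
  let ?D = "Z (x, t) - Z (y, t) - of_real (x - y)"
  have "cmod ?D \<le> \<epsilon> * \<bar>x - y\<bar>" by (rule Z_near[OF assms])
  also have "\<dots> \<le> 1 / 4 * \<bar>x - y\<bar>" using eps by (intro mult_right_mono) auto
  finally have D: "cmod ?D \<le> \<bar>x - y\<bar> / 4" by simp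
  have "\<bar>Re ?D\<bar> \<le> \<bar>x - y\<bar> / 4" "\<bar>Im ?D\<bar> \<le> \<bar>x - y\<bar> / 4"
    using abs_Re_le_cmod[of ?D] abs_Im_le_cmod[of ?D] D by linarith+
  then show 1: "\<bar>Re (Z (x, t) - Z (y, t)) - (x - y)\<bar> \<le> \<bar>x - y\<bar> / 4"
    and 2: "\<bar>Im (Z (x, t) - Z (y, t))\<bar> \<le> \<bar>x - y\<bar> / 4" by simp_all
  show 3: "\<bar>Re (Z (x, t) - Z (y, t))\<bar> \<ge> 3 / 4 * \<bar>x - y\<bar>" using abs_near[OF 1] .
  show "\<bar>Im (Z (x, t) - Z (y, t))\<bar> \<le> \<bar>Re (Z (x, t) - Z (y, t))\<bar> / 3" using 2 3 by linarith
  have "cmod (Z (x, t) - Z (y, t)) \<le> cmod ?D + cmod (of_real (x - y))"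
    using norm_triangle_ineq[of ?D "of_real (x - y)"] by simp
  then show "cmod (Z (x, t) - Z (y, t)) \<le> 5 / 4 * \<bar>x - y\<bar>" using D unfolding norm_of_real by simp
qed

text \<open>The bound for the trace involves derivatives of \<open>G\<close> over the sides. Cauchy's estimates on discs of radius \<open>\<rho>/2\<close>
  reduce them to values of \<open>G\<close> at points of horizontal distance at least \<open>\<rho>/2\<close> from the curve above \<open>{i1..i2}\<close>.\<close>

lemma trace_tendsto_0:
  assumes g: "solution g gx" "tame n g"
    and L: "has_trace X g L"
    and X: "{l..r} \<subseteq> X"
    and adm: "\<And>k. admissible (G k) (W k) s e (\<Theta> k)"
    and lev: "(\<lambda>k. level g (G k) s) \<longlonglongrightarrow> 0"
    and side: "\<And>k w. (\<And>v. v \<in> {i1..i2} \<Longrightarrow> \<rho> / 2 \<le> \<bar>Re (w - \<zeta> v)\<bar>) \<Longrightarrow> w \<in> W k \<and> cmod (G k w) \<le> B k"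
    and B: "B \<longlonglongrightarrow> 0"
  shows "(\<lambda>k. L (trace_test (G k))) \<longlonglongrightarrow> 0"
proof -
  obtain C where C: "C \<ge> 0" "\<And>G W s e \<Theta> B. admissible G W s e \<Theta> \<Longrightarrow>
      (\<forall>i\<le>n. \<forall>x\<in>{l..m1} \<union> {m2..r}. \<forall>t\<in>{0..s}. cmod ((deriv ^^ i) G (Z (x, t))) \<le> B) \<Longrightarrow>
      cmod (L (trace_test G)) \<le> cmod (level g G s) + C * B"
    by (rule trace_bound[OF g L X]) blast
  define M where "M = (\<Sum>i\<le>n. fact i / (\<rho> / 2) ^ i)"
  have s: "0 < s" "s \<le> T" using adm[of 0] by (auto simp: admissible_def)
  have le: "cmod (L (trace_test (G k))) \<le> cmod (level g (G k) s) + C * (M * B k)" for k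
  proof (rule C(2)[OF adm], intro allI impI ballI)
    fix i x t assume i: "i \<le> n" and x: "x \<in> {l..m1} \<union> {m2..r}" and t: "t \<in> {0..s}"
    let ?z = "Z (x, t)"
    have t': "t \<in> {0..T}" using t s by auto
    have near: "w \<in> W k \<and> cmod (G k w) \<le> B k" if w: "w \<in> cball ?z (\<rho> / 2)" for w
    proof (rule side)
      fix v assume v: "v \<in> {i1..i2}"
      have "\<bar>Re (w - ?z)\<bar> \<le> \<rho> / 2"
        using abs_Re_le_cmod[of "w - ?z"] w by (simp add: dist_norm norm_minus_commute)
      moreover have "Re (Z (x, t) - \<zeta> v) = Re (w - \<zeta> v) - Re (w - ?z)" by simp
      then have "\<bar>Re (Z (x, t) - \<zeta> v)\<bar> \<le> \<bar>Re (w - \<zeta> v)\<bar> + \<bar>Re (w - ?z)\<bar>"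
        by (simp only: abs_triangle_ineq4)
      ultimately show "\<rho> / 2 \<le> \<bar>Re (w - \<zeta> v)\<bar>" using side_sep[OF x t' v] by linarith
    qed
    have B0: "0 \<le> B k" 
    proof -
      have "cmod (G k ?z) \<le> B k" using near[of ?z] rho by simp
      then show ?thesis by (rule order_trans[OF norm_ge_zero])
    qed
    have hol: "G k holomorphic_on W k" using adm[of k] by (simp add: admissible_def)
    have "norm ((deriv ^^ i) (G k) ?z) \<le> fact i * B k / (\<rho> / 2) ^ i"
    proof (rule Cauchy_inequality)
      have sub: "cball ?z (\<rho> / 2) \<subseteq> W k" using near by blast
      then show "G k holomorphic_on ball ?z (\<rho> / 2)"
        using holomorphic_on_subset[OF hol] ball_subset_cball by blast
      show "continuous_on (cball ?z (\<rho> / 2)) (G k)"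
        by (rule holomorphic_on_imp_continuous_on[OF holomorphic_on_subset[OF hol sub]])
      show "cmod (G k w) \<le> B k" if "cmod (?z - w) = \<rho> / 2" for w
        using near[of w] that by (simp add: dist_norm)
    qed (use rho in simp)
    also have "\<dots> = (fact i / (\<rho> / 2) ^ i) * B k" by simp
    also have "\<dots> \<le> M * B k"
      unfolding M_def using i B0 rho by (intro mult_right_mono member_le_sum) auto
    finally show "cmod ((deriv ^^ i) (G k) ?z) \<le> M * B k" .
  qed
  have "(\<lambda>k. cmod (level g (G k) s) + C * (M * B k)) \<longlonglongrightarrow> 0 + C * (M * 0)"
    by (intro tendsto_add tendsto_mult tendsto_const B tendsto_norm_zero lev)
  then have lim: "(\<lambda>k. cmod (level g (G k) s) + C * (M * B k)) \<longlonglongrightarrow> 0" by simp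
  show ?thesis by (rule Lim_null_comparison[OF always_eventually lim]) (simp add: le)
qed

end

section \<open>Peak functions\<close>

text \<open>At least one of the intervals of length \<open>\<kappa>\<close> to the left and right of \<open>x\<close> lies in \<open>{c0..d0}\<close>, and the
  integrand is at least \<open>y\<close> on it.\<close>

lemma half_interval_le_integral:
  fixes x \<kappa> y c0 d0 :: real and h :: "real \<Rightarrow> real"
  assumes h: "continuous_on {c0..d0} h" and nonneg: "\<And>v. v \<in> {c0..d0} \<Longrightarrow> 0 \<le> h v"
    and x: "x \<in> {c0..d0}" and \<kappa>: "0 < \<kappa>" "\<kappa> \<le> (d0 - c0) / 2"
    and low: "\<And>v. v \<in> {c0..d0} \<Longrightarrow> \<bar>x - v\<bar> \<le> \<kappa> \<Longrightarrow> y \<le> h v"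
  shows "y * \<kappa> \<le> integral {c0..d0} h"
proof -
  obtain c where c: "{c..c + \<kappa>} \<subseteq> {c0..d0}" "\<And>v. v \<in> {c..c + \<kappa>} \<Longrightarrow> \<bar>x - v\<bar> \<le> \<kappa>"
  proof (cases "x + \<kappa> \<le> d0")
    case True
    then show ?thesis using x \<kappa> by (intro that[of x]) auto
  next
    case False
    then show ?thesis using x \<kappa> by (intro that[of "x - \<kappa>"]) auto
  qed
  have "y * \<kappa> = integral {c..c + \<kappa>} (\<lambda>v. y)" using \<kappa> by simp
  also have "\<dots> \<le> integral {c..c + \<kappa>} h"
    using c low by (intro integral_le integrable_continuous_real continuous_on_subset[OF h] continuous_on_const) auto
  also have "\<dots> \<le> integral {c0..d0} h"
    using c(1) nonneg by (intro integral_subset_le integrable_continuous_real continuous_on_subset[OF h]) auto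
  finally show ?thesis .
qed

context flat_strip
begin

text \<open>What the measure argument needs to know about \<open>E\<close>: functions \<open>G k\<close>, bounded on the lowest curve, that are
  eventually \<open>\<eta>\<close>-close to \<open>1\<close> above \<open>E\<close> and tend to \<open>0\<close> elsewhere, while the trace does not see them in the limit.\<close>

definition peaks :: "real set \<Rightarrow> ((real \<Rightarrow> complex) \<Rightarrow> complex) \<Rightarrow> real set \<Rightarrow> real \<Rightarrow> bool" where
  "peaks X L E \<eta> \<longleftrightarrow> (\<exists>G M. (\<forall>k. test_function X (trace_test (G k))) \<and>
    (\<lambda>k. L (trace_test (G k))) \<longlonglongrightarrow> 0 \<and>
    (\<forall>k. \<forall>x\<in>{l..r}. cmod (G k (\<zeta> x)) \<le> M) \<and>
    (\<forall>x\<in>{l..r} - E. (\<lambda>k. G k (\<zeta> x)) \<longlonglongrightarrow> 0) \<and>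
    (\<forall>\<^sub>F k in sequentially. \<forall>x\<in>E. cmod (G k (\<zeta> x) - 1) \<le> \<eta>))"

text \<open>\<open>H k\<close> takes values in a half-plane on both levels, so \<open>G = 1 - exp (- q H)\<close> is bounded there. It tends to \<open>0\<close> where
  \<open>H\<close> does, and \<open>Re H \<ge> c\<close> gives \<open>\<bar>G - 1\<bar> \<le> exp (- q c) \<le> \<eta>\<close> for large \<open>q\<close>. The level integral at \<open>s\<close> vanishes
  in the limit by dominated convergence.\<close>

lemma peaks_of_half_plane:
  assumes g: "solution g gx" "tame n g" and L: "has_trace X g L" and X: "{l..r} \<subseteq> X"
    and adm: "\<And>k. admissible (H k) (W k) s e (\<Theta> k)"
    and bot: "\<And>k x. x \<in> {l..r} \<Longrightarrow> - C \<le> Re (H k (\<zeta> x))" "\<And>x. x \<in> {l..r} - E \<Longrightarrow> (\<lambda>k. H k (\<zeta> x)) \<longlonglongrightarrow> 0"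
    and E: "c > 0" "\<forall>\<^sub>F k in sequentially. \<forall>x\<in>E. c \<le> Re (H k (\<zeta> x))"
    and side: "\<And>k w. (\<And>v. v \<in> {i1..i2} \<Longrightarrow> \<rho> / 2 \<le> \<bar>Re (w - \<zeta> v)\<bar>) \<Longrightarrow> w \<in> W k \<and> cmod (H k w) \<le> b k"
    and b: "b \<longlonglongrightarrow> 0"
    and top: "\<And>k x. x \<in> {l..r} \<Longrightarrow> - C \<le> Re (H k (Z (x, s)))" "negligible N"
      "\<And>x. x \<in> {l..r} - N \<Longrightarrow> (\<lambda>k. H k (Z (x, s))) \<longlonglongrightarrow> 0"
    and \<eta>: "\<eta> > 0"
  shows "peaks X L E \<eta>"
proof -
  define q where "q = max 1 (- ln \<eta> / c)"
  have q: "q > 0" by (simp add: q_def)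
  have exp_q: "exp (- (q * c)) \<le> \<eta>"
  proof -
    have "- ln \<eta> \<le> q * c" using E(1) by (simp add: q_def pos_divide_le_eq[symmetric])
    then have "exp (- (q * c)) \<le> exp (ln \<eta>)" by simp
    then show ?thesis using \<eta> by simp
  qed
  define G where "G k z = 1 - exp (- (of_real q * H k z))" for k z
  define M where "M = 1 + exp (q * C)"
  have M: "cmod (G k z) \<le> M" if "- C \<le> Re (H k z)" for k z
  proof -
    have "cmod (G k z) \<le> cmod 1 + cmod (exp (- (of_real q * H k z)))"
      unfolding G_def by (rule norm_triangle_ineq4)
    also have "cmod (exp (- (of_real q * H k z))) = exp (- (q * Re (H k z)))" by simp
    also have "\<dots> \<le> exp (q * C)"
      using mult_left_mono[OF that, of q] q by simp
    finally show ?thesis by (simp add: M_def)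
  qed
  have G0: "(\<lambda>k. G k (z k)) \<longlonglongrightarrow> 0" if "(\<lambda>k. H k (z k)) \<longlonglongrightarrow> 0" for z
  proof -
    have "(\<lambda>k. G k (z k)) \<longlonglongrightarrow> 1 - exp (- (of_real q * 0))"
      unfolding G_def by (intro tendsto_intros that)
    then show ?thesis by simp
  qed
  have admG: "admissible (G k) (W k) s e (\<Theta> k)" for k
  proof -
    have "H k holomorphic_on W k" using adm[of k] by (simp add: admissible_def)
    then have "G k holomorphic_on W k" unfolding G_def by (intro holomorphic_intros)
    then show ?thesis using adm[of k] unfolding admissible_def by blast
  qed
  have W: "open (W k)" "G k holomorphic_on W k" and s: "0 < s" "s \<le> T"
    and bW: "\<And>x. x \<in> {l..r} \<Longrightarrow> \<zeta> x \<in> W k" and tW: "\<And>x. x \<in> {l..r} \<Longrightarrow> Z (x, s) \<in> W k" for k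
  proof -
    show "open (W k)" "G k holomorphic_on W k" "0 < s" "s \<le> T" using admG[of k] by (simp_all add: admissible_def)
    have "0 \<in> {0..\<Theta> k}" using admG[of k] by (simp add: admissible_def)
    moreover have "\<forall>\<theta>\<in>{0..\<Theta> k}. \<forall>x\<in>{l..r}. Z (x, 0) + e * of_real \<theta> \<in> W k \<and> Z (x, s) + e * of_real \<theta> \<in> W k"
      using admG[of k] by (simp add: admissible_def)
    ultimately show "\<And>x. x \<in> {l..r} \<Longrightarrow> \<zeta> x \<in> W k" "\<And>x. x \<in> {l..r} \<Longrightarrow> Z (x, s) \<in> W k" by fastforce+
  qed
  have sT: "s \<in> {0<..T}" "s \<in> {0..T}" using s by auto
  have lev: "(\<lambda>k. level g (G k) s) \<longlonglongrightarrow> 0"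
  proof -
    let ?f = "\<lambda>k x. g (x, s) * (\<psi> x * (G k (Z (x, s)) * px Z (x, s)))"
    have cg: "continuous_on {l..r} (\<lambda>x. g (x, s) * (\<psi> x * px Z (x, s)))"
      by (intro continuous_on_mult solution_slice[OF g(1) sT(1)] cutoff_continuous smooth_slice[OF smooth_on_px[OF smooth_Z] sT(2)])
    have cf: "continuous_on {l..r} (?f k)" for k
    proof -
      have "continuous_on {l..r} (\<lambda>x. G k (Z (x, s)))"
        using tW by (intro continuous_on_compose2[OF holomorphic_on_imp_continuous_on[OF W(2)] smooth_slice[OF smooth_Z sT(2)]]) auto
      then show ?thesis
        by (intro continuous_on_mult solution_slice[OF g(1) sT(1)] cutoff_continuous smooth_slice[OF smooth_on_px[OF smooth_Z] sT(2)])
    qed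
    have spike: "integral {l..r} (?f k) = integral ({l..r} - N) (?f k)" for k
      by (rule integral_spike_set) (auto intro: negligible_subset[OF top(2)])
    have "(\<lambda>k. integral ({l..r} - N) (?f k)) \<longlonglongrightarrow> integral ({l..r} - N) (\<lambda>x. 0)"
    proof (rule dominated_convergence(2)[where h = "\<lambda>x. cmod (g (x, s) * (\<psi> x * px Z (x, s))) * M"])
      have int: "f integrable_on {l..r} - N" if "continuous_on {l..r} f" for f :: "real \<Rightarrow> 'b::euclidean_space"
        using integrable_continuous_real[OF that]
        by (rule integrable_spike_set) (auto intro: negligible_subset[OF top(2)])
      show "?f k integrable_on {l..r} - N" for k by (rule int[OF cf])
      show "(\<lambda>x. cmod (g (x, s) * (\<psi> x * px Z (x, s))) * M) integrable_on {l..r} - N"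
        by (intro int continuous_on_mult continuous_on_norm cg continuous_on_const)
      show "cmod (?f k x) \<le> cmod (g (x, s) * (\<psi> x * px Z (x, s))) * M" if "x \<in> {l..r} - N" for k x
      proof -
        have "cmod (?f k x) = cmod (g (x, s) * (\<psi> x * px Z (x, s))) * cmod (G k (Z (x, s)))" by (simp add: norm_mult)
        also have "\<dots> \<le> cmod (g (x, s) * (\<psi> x * px Z (x, s))) * M"
          using that by (intro mult_left_mono M top(1)) auto
        finally show ?thesis .
      qed
      show "(\<lambda>k. ?f k x) \<longlonglongrightarrow> 0" if "x \<in> {l..r} - N" for x
      proof -
        have "(\<lambda>k. ?f k x) \<longlonglongrightarrow> g (x, s) * (\<psi> x * (0 * px Z (x, s)))"
          by (intro tendsto_mult tendsto_const G0 top(3) that)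
        then show ?thesis by simp
      qed
    qed
    then show ?thesis unfolding level_def spike by simp
  qed
  have "(\<lambda>k. L (trace_test (G k))) \<longlonglongrightarrow> 0"
  proof (rule trace_tendsto_0[OF g L X admG lev, where B = "\<lambda>k. (q * b k) * exp (q * b k)"])
    fix k w assume "\<And>v. v \<in> {i1..i2} \<Longrightarrow> \<rho> / 2 \<le> \<bar>Re (w - \<zeta> v)\<bar>"
    from side[OF this] have w: "w \<in> W k" "cmod (H k w) \<le> b k" by blast+
    have h: "cmod (of_real q * H k w) \<le> q * b k" using w(2) q by (simp add: norm_mult)
    have "cmod (G k w) \<le> cmod (of_real q * H k w) * exp (cmod (of_real q * H k w))"
      unfolding G_def by (rule norm_one_minus_exp_le)
    also have "\<dots> \<le> (q * b k) * exp (q * b k)"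
      using h by (intro mult_mono) (auto intro: order_trans[OF norm_ge_zero h])
    finally show "w \<in> W k \<and> cmod (G k w) \<le> (q * b k) * exp (q * b k)" using w(1) by blast
  next
    have "(\<lambda>k. (q * b k) * exp (q * b k)) \<longlonglongrightarrow> (q * 0) * exp (q * 0)"
      by (intro tendsto_intros b)
    then show "(\<lambda>k. (q * b k) * exp (q * b k)) \<longlonglongrightarrow> 0" by simp
  qed
  moreover have "test_function X (trace_test (G k))" for k
    by (rule trace_test_function[OF W bW X])
  moreover have "cmod (G k (\<zeta> x)) \<le> M" if "x \<in> {l..r}" for k x
    by (rule M[OF bot(1)[OF that]])
  moreover have "(\<lambda>k. G k (\<zeta> x)) \<longlonglongrightarrow> 0" if "x \<in> {l..r} - E" for x
    by (rule G0[OF bot(2)[OF that]])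
  moreover have "\<forall>\<^sub>F k in sequentially. \<forall>x\<in>E. cmod (G k (\<zeta> x) - 1) \<le> \<eta>"
    using E(2)
  proof eventually_elim
    case (elim k)
    show ?case
    proof
      fix x assume "x \<in> E"
      then have "q * c \<le> q * Re (H k (\<zeta> x))" using elim q by (intro mult_left_mono) auto
      moreover have "cmod (G k (\<zeta> x) - 1) = exp (- (q * Re (H k (\<zeta> x))))" by (simp add: G_def)
      moreover have "exp (- (q * Re (H k (\<zeta> x)))) \<le> exp (- (q * c))" using calculation(1) by simp
      ultimately show "cmod (G k (\<zeta> x) - 1) \<le> \<eta>" using exp_q by linarith
    qed
  qed
  ultimately show ?thesis unfolding peaks_def by blast
qed

end

section \<open>Peaks at points that lie on all level curves\<close>

lemma has_integral_arctan_kernel: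
  fixes q u :: real
  assumes q: "q > 0" and cd: "c \<le> d"
  shows "((\<lambda>v. q / (q\<^sup>2 + ((v - u) / 8)\<^sup>2)) has_integral 8 * arctan ((d - u) / (8 * q)) - 8 * arctan ((c - u) / (8 * q))) {c..d}"
proof (rule fundamental_theorem_of_calculus[OF cd])
  fix v
  have 1: "((\<lambda>v. (v - u) / (8 * q)) has_real_derivative 1 / (8 * q)) (at v within {c..d})"
    by (rule DERIV_cdivide) (rule DERIV_diff[OF DERIV_ident DERIV_const, simplified])
  have "((\<lambda>v. 8 * arctan ((v - u) / (8 * q))) has_real_derivative 8 * (inverse (1 + ((v - u) / (8 * q))\<^sup>2) * (1 / (8 * q)))) (at v within {c..d})"
    by (rule DERIV_cmult[OF DERIV_chain2[OF DERIV_arctan 1]])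
  moreover have "8 * (inverse (1 + ((v - u) / (8 * q))\<^sup>2) * (1 / (8 * q))) = q / (q\<^sup>2 + ((v - u) / 8)\<^sup>2)"
  proof -
    have "q\<^sup>2 + ((v - u) / 8)\<^sup>2 = q\<^sup>2 * (1 + ((v - u) / (8 * q))\<^sup>2)"
    proof -
      have "q * ((v - u) / (8 * q)) = (v - u) / 8" using q by (simp add: field_simps)
      then have "((v - u) / 8)\<^sup>2 = q\<^sup>2 * ((v - u) / (8 * q))\<^sup>2" by (metis power_mult_distrib)
      then show ?thesis unfolding distrib_left by (simp only: mult_1_right)
    qed
    moreover have "8 * (inverse S * (1 / (8 * q))) = q / (q\<^sup>2 * S)" for S
      using q by (cases "S = 0") (simp_all add: field_simps power2_eq_square)
    ultimately show ?thesis by (simp only:)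
  qed
  ultimately show "((\<lambda>v. 8 * arctan ((v - u) / (8 * q))) has_vector_derivative q / (q\<^sup>2 + ((v - u) / 8)\<^sup>2)) (at v within {c..d})"
    by (simp only: has_real_derivative_iff_has_vector_derivative)
qed

context flat_strip
begin

text \<open>The denominators \<open>D = 25 K\<^sup>2 + (z - \<zeta>(v))\<^sup>2\<close> with \<open>K = \<kappa> + d(v, E)\<close> vanish only at
  \<open>\<zeta>(v) \<plusminus> 5 \<i> K\<close>. A level curve through all points of \<open>\<zeta>(E)\<close> deviates vertically from \<open>\<zeta>(v)\<close> by at most a third of the
  horizontal distance plus \<open>d(v, E)\<close>; so \<open>D\<close> is nowhere small on it, at any level up to \<open>s\<close>, and the shift \<open>\<Theta> = 0\<close> will do. The factor
  \<open>\<kappa>\<close> is normalized as in a Poisson kernel: the integral is bounded, and at a point of \<open>\<zeta>(E)\<close>, near which \<open>K\<close> is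
  comparable to \<open>\<kappa>\<close>, its real part is bounded below. Away from \<open>\<zeta>(E)\<close> it tends to \<open>0\<close>, and the part of the curve at level \<open>s\<close> that lies in
  \<open>\<zeta>(E)\<close> is the image of the null set \<open>E\<close> under a Lipschitz map.\<close>

lemma peaks_two_sided:
  assumes g: "solution g gx" "tame n g" and L: "has_trace X g L" and X: "{l..r} \<subseteq> X"
    and E: "compact E" "E \<noteq> {}" "E \<subseteq> {i1..i2}" "negligible E" and s: "0 < s" "s \<le> T"
    and ch: "\<And>e t. e \<in> E \<Longrightarrow> t \<in> {0..s} \<Longrightarrow> \<exists>y\<in>{l..r}. Z (y, t) = \<zeta> e"
    and \<eta>: "\<eta> > 0"
  shows "peaks X L E \<eta>"
proof -
  define len where "len = i2 - i1"
  have len: "len > 0" using I by (simp add: len_def)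
  define \<kappa> where "\<kappa> k = 1 / real (Suc k)" for k
  have \<kappa>: "\<kappa> k > 0" for k by (simp add: \<kappa>_def)
  have \<kappa>_lim: "\<kappa> \<longlonglongrightarrow> 0" unfolding \<kappa>_def using LIMSEQ_inverse_real_of_nat by (simp add: inverse_eq_divide)
  have \<kappa>_mult: "(\<lambda>k. \<kappa> k * y) \<longlonglongrightarrow> 0" for y
    using tendsto_mult_right[OF \<kappa>_lim, of y] by (simp only: mult_zero_left)
  define K where "K k v = \<kappa> k + infdist v E" for k v
  have K: "K k v > 0" "infdist v E \<le> K k v" "\<kappa> k \<le> K k v" for k v
    using \<kappa>[of k] infdist_nonneg[of v E] by (simp_all add: K_def)
  define D where "D k z v = of_real (25 * (K k v)\<^sup>2) + (z - \<zeta> v)\<^sup>2" for k z v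
  define H where "H k z = integral {i1..i2} (\<lambda>v. of_real (\<kappa> k) / D k z v)" for k z
  define W where "W k = {z. \<forall>v\<in>{i1..i2}. D k z v \<noteq> 0}" for k
  have factor: "cmod (D k z v) = cmod (5 * of_real (K k v) + \<i> * (z - \<zeta> v)) * cmod (5 * of_real (K k v) - \<i> * (z - \<zeta> v))" for k z v
  proof -
    have "D k z v = (5 * of_real (K k v) + \<i> * (z - \<zeta> v)) * (5 * of_real (K k v) - \<i> * (z - \<zeta> v))"
      by (simp add: D_def power2_eq_square algebra_simps)
    then show ?thesis by (simp only: norm_mult)
  qed
  have cI: "continuous_on {i1..i2} \<zeta>" using continuous_on_subset[OF continuous_zeta(1)] I_sub by blast
  have cK: "continuous_on {i1..i2} (K k)" for k unfolding K_def by (intro continuous_intros)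
  have cD: "continuous_on (UNIV \<times> {i1..i2}) (\<lambda>p. D k (fst p) (snd p))" for k
  proof -
    have "continuous_on (UNIV \<times> {i1..i2}) (\<lambda>p :: complex \<times> real. \<zeta> (snd p))"
      by (rule continuous_on_compose2[OF cI continuous_on_snd[OF continuous_on_id]]) auto
    moreover have "continuous_on (UNIV \<times> {i1..i2}) (\<lambda>p :: complex \<times> real. K k (snd p))"
      by (rule continuous_on_compose2[OF cK continuous_on_snd[OF continuous_on_id]]) auto
    ultimately show ?thesis unfolding D_def by (intro continuous_intros)
  qed
  have D': "((\<lambda>z. D k z v) has_field_derivative 2 * (z - \<zeta> v)) (at z)" for k z v
    unfolding D_def by (auto intro!: derivative_eq_intros)
  have cD': "continuous_on (UNIV \<times> {i1..i2}) (\<lambda>p :: complex \<times> real. 2 * (fst p - \<zeta> (snd p)))"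
  proof -
    have "continuous_on (UNIV \<times> {i1..i2}) (\<lambda>p :: complex \<times> real. \<zeta> (snd p))"
      by (rule continuous_on_compose2[OF cI continuous_on_snd[OF continuous_on_id]]) auto
    then show ?thesis by (intro continuous_intros)
  qed
  have hol: "open (W k)" "H k holomorphic_on W k" for k
    using kernel_integral_holomorphic[where q = "\<lambda>_. of_real (\<kappa> k)" and D = "D k", OF continuous_on_const cD D' cD']
    by (simp_all add: W_def H_def[abs_def])
  have cDz: "continuous_on {i1..i2} (\<lambda>v. D k z v)" for k z
    unfolding D_def by (intro continuous_intros cK cI)
  have cH: "continuous_on {i1..i2} (\<lambda>v. of_real (\<kappa> k) / D k z v)" if "z \<in> W k" for k z
    using that cDz by (intro continuous_on_divide continuous_on_const) (auto simp: W_def)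
  \<comment> \<open>the cone condition at the point \<open>e\<close> of \<open>E\<close> nearest to \<open>v\<close>, applied to both linear factors of \<open>D\<close>\<close>
  have lower: "K k v + \<bar>Re (Z (x, t) - \<zeta> v)\<bar> / 3 \<le> cmod (5 * of_real (K k v) + q * \<i> * (Z (x, t) - \<zeta> v))"
    if x: "x \<in> {l..r}" and t: "t \<in> {0..s}" and v: "v \<in> {i1..i2}" and q: "q = 1 \<or> q = - 1" for k v x t and q :: complex
  proof -
    obtain e where e: "e \<in> E" "infdist v E = dist v e"
      by (rule infdist_attains_inf[OF compact_imp_closed[OF E(1)] E(2), of v])
    obtain y where y: "y \<in> {l..r}" "Z (y, t) = \<zeta> e" using ch[OF e(1) t] by blast
    have tT: "t \<in> {0..T}" using t s by auto
    define d where "d = \<bar>e - v\<bar>"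
    have dK: "d \<le> K k v" using K(2)[of v k] e(2) by (simp add: d_def dist_real_def abs_minus_commute)
    define A where "A = \<bar>Re (Z (x, t) - \<zeta> v)\<bar>"
    have "e \<in> {l..r}" "v \<in> {l..r}" using e(1) E(3) v I_sub by auto
    note n1 = Re_Im_near[OF this zero_in] and n2 = Re_Im_near[OF x y(1) tT]
    have 1: "\<bar>Im (Z (x, t) - \<zeta> e)\<bar> \<le> \<bar>Re (Z (x, t) - \<zeta> e)\<bar> / 3" using n2(5) y(2) by simp
    have 2: "\<bar>Re (\<zeta> e - \<zeta> v)\<bar> \<le> 5 / 4 * d" "\<bar>Im (\<zeta> e - \<zeta> v)\<bar> \<le> 1 / 4 * d"
      using n1(2) abs_Re_le_cmod[of "\<zeta> e - \<zeta> v"] n1(4) unfolding d_def by linarith+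
    have "\<bar>Re (Z (x, t) - \<zeta> e)\<bar> \<le> A + \<bar>Re (\<zeta> e - \<zeta> v)\<bar>"
    proof -
      have "Re (Z (x, t) - \<zeta> e) = Re (Z (x, t) - \<zeta> v) - Re (\<zeta> e - \<zeta> v)" by simp
      then show ?thesis unfolding A_def by (simp only: abs_triangle_ineq4)
    qed
    moreover have "\<bar>Im (Z (x, t) - \<zeta> v)\<bar> \<le> \<bar>Im (Z (x, t) - \<zeta> e)\<bar> + \<bar>Im (\<zeta> e - \<zeta> v)\<bar>"
    proof -
      have "Im (Z (x, t) - \<zeta> v) = Im (Z (x, t) - \<zeta> e) + Im (\<zeta> e - \<zeta> v)" by simp
      then show ?thesis by (simp only: abs_triangle_ineq)
    qed
    ultimately have Im_le: "\<bar>Im (Z (x, t) - \<zeta> v)\<bar> \<le> A / 3 + d" using 1 2 by linarith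
    let ?w = "5 * of_real (K k v) + q * \<i> * (Z (x, t) - \<zeta> v)"
    have "\<bar>Im ?w\<bar> = A" using q by (auto simp: A_def abs_minus_commute)
    then have cA: "A \<le> cmod ?w" using abs_Im_le_cmod[of ?w] by simp
    have "5 * K k v - \<bar>Im (Z (x, t) - \<zeta> v)\<bar> \<le> Re ?w" using q by auto
    then have cR: "4 * K k v - A / 3 \<le> cmod ?w" using abs_Re_le_cmod[of ?w] Im_le dK by linarith
    have "K k v + A / 3 \<le> cmod ?w" using cA cR K(1)[of k v] by linarith
    then show ?thesis by (simp add: A_def)
  qed
  have D_lower: "(K k v + \<bar>Re (Z (x, t) - \<zeta> v)\<bar> / 3)\<^sup>2 \<le> cmod (D k (Z (x, t)) v)"
    if "x \<in> {l..r}" "t \<in> {0..s}" "v \<in> {i1..i2}" for k v x t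
    unfolding factor power2_eq_square using lower[OF that, of 1 k] lower[OF that, of "-1" k] K(1)[of k v]
    by (intro mult_mono) simp_all
  have D_pos: "0 < K k v + \<bar>Re w\<bar> / 3" for k v w using K(1)[of k v] by (simp add: add_pos_nonneg)
  have inW: "Z (x, t) \<in> W k" if "x \<in> {l..r}" "t \<in> {0..s}" for k x t
  proof -
    have "D k (Z (x, t)) v \<noteq> 0" if v: "v \<in> {i1..i2}" for v
    proof -
      have "0 < (K k v + \<bar>Re (Z (x, t) - \<zeta> v)\<bar> / 3)\<^sup>2" using D_pos by (intro zero_less_power)
      then show ?thesis using D_lower[OF \<open>x \<in> _\<close> \<open>t \<in> _\<close> v, of k] by auto
    qed
    then show ?thesis by (simp add: W_def)
  qed
  have sideW: "w \<in> W k \<and> cmod (H k w) \<le> \<kappa> k * (len / (\<rho> / 2)\<^sup>2)"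
    if w: "\<And>v. v \<in> {i1..i2} \<Longrightarrow> \<rho> / 2 \<le> \<bar>Re (w - \<zeta> v)\<bar>" for k w
  proof -
    have "(\<rho> / 2)\<^sup>2 \<le> cmod (D k w v)" if v: "v \<in> {i1..i2}" for v
    proof -
      have "\<bar>Re (w - \<zeta> v)\<bar> \<le> cmod (5 * of_real (K k v) + \<i> * (w - \<zeta> v))"
        using abs_Im_le_cmod[of "5 * of_real (K k v) + \<i> * (w - \<zeta> v)"] by simp
      moreover have "\<bar>Re (w - \<zeta> v)\<bar> \<le> cmod (5 * of_real (K k v) - \<i> * (w - \<zeta> v))"
        using abs_Im_le_cmod[of "5 * of_real (K k v) - \<i> * (w - \<zeta> v)"] by simp
      ultimately show ?thesis
        unfolding factor power2_eq_square using w[OF v] rho by (intro mult_mono) auto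
    qed
    note D_le = this
    have pos: "0 < (\<rho> / 2)\<^sup>2" using rho by simp
    have wW: "w \<in> W k" using D_le pos by (force simp: W_def)
    have "cmod (H k w) \<le> (\<kappa> k / (\<rho> / 2)\<^sup>2) * (i2 - i1)"
      unfolding H_def
    proof (rule integral_bound[OF _ cH[OF wW]])
      show "cmod (of_real (\<kappa> k) / D k w v) \<le> \<kappa> k / (\<rho> / 2)\<^sup>2" if "v \<in> {i1..i2}" for v
        using D_le[OF that] pos \<kappa>[of k] by (simp add: norm_divide frac_le)
    qed (use I in simp)
    then show ?thesis using wW by (simp add: len_def)
  qed
  \<comment> \<open>comparison with the kernel whose primitive is an arctangent, centred at the \<open>u\<close> for which \<open>\<zeta>(u)\<close> is horizontally nearest\<close>
  have H_bound: "cmod (H k (Z (x, t))) \<le> 8 * pi" if x: "x \<in> {l..r}" and t: "t \<in> {0..s}" for k x t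
  proof -
    let ?z = "Z (x, t)"
    have "continuous_on {i1..i2} (\<lambda>v. \<bar>Re (?z - \<zeta> v)\<bar>)" by (intro continuous_intros cI)
    then have "\<exists>u\<in>{i1..i2}. \<forall>v\<in>{i1..i2}. \<bar>Re (?z - \<zeta> u)\<bar> \<le> \<bar>Re (?z - \<zeta> v)\<bar>"
      using I by (intro continuous_attains_inf) simp_all
    then obtain u where u: "u \<in> {i1..i2}" "\<And>v. v \<in> {i1..i2} \<Longrightarrow> \<bar>Re (?z - \<zeta> u)\<bar> \<le> \<bar>Re (?z - \<zeta> v)\<bar>"
      by blast
    let ?h = "\<lambda>v. \<kappa> k / ((\<kappa> k)\<^sup>2 + ((v - u) / 8)\<^sup>2)"
    have "(?h has_integral 8 * arctan ((i2 - u) / (8 * \<kappa> k)) - 8 * arctan ((i1 - u) / (8 * \<kappa> k))) {i1..i2}"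
      using I by (intro has_integral_arctan_kernel \<kappa>) simp
    note h_int = this
    have "8 * arctan ((i2 - u) / (8 * \<kappa> k)) - 8 * arctan ((i1 - u) / (8 * \<kappa> k)) \<le> 8 * pi"
      using arctan_bounded[of "(i2 - u) / (8 * \<kappa> k)"] arctan_bounded[of "(i1 - u) / (8 * \<kappa> k)"] by linarith
    then have int_h: "?h integrable_on {i1..i2}" "integral {i1..i2} ?h \<le> 8 * pi"
      using has_integral_integrable[OF h_int] integral_unique[OF h_int] by simp_all
    have "cmod (H k ?z) \<le> integral {i1..i2} ?h"
      unfolding H_def
    proof (rule integral_norm_bound_integral[OF integrable_continuous_real[OF cH[OF inW[OF x t]]] int_h(1)])
      fix v assume v: "v \<in> {i1..i2}"
      have "3 / 4 * \<bar>v - u\<bar> \<le> \<bar>Re (\<zeta> v - \<zeta> u)\<bar>" using v u(1) by (intro Re_Im_near(3) I_sub zero_in)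
      also have "\<dots> \<le> \<bar>Re (?z - \<zeta> u)\<bar> + \<bar>Re (?z - \<zeta> v)\<bar>"
      proof -
        have "Re (\<zeta> v - \<zeta> u) = Re (?z - \<zeta> u) - Re (?z - \<zeta> v)" by simp
        then show ?thesis by (simp only: abs_triangle_ineq4)
      qed
      finally have "\<bar>v - u\<bar> / 8 \<le> \<bar>Re (?z - \<zeta> v)\<bar> / 3" using u(2)[OF v] by linarith
      then have "\<kappa> k + \<bar>v - u\<bar> / 8 \<le> K k v + \<bar>Re (?z - \<zeta> v)\<bar> / 3" using K(3)[of k v] by linarith
      then have "(\<kappa> k + \<bar>v - u\<bar> / 8)\<^sup>2 \<le> (K k v + \<bar>Re (?z - \<zeta> v)\<bar> / 3)\<^sup>2"
        using \<kappa>[of k] by (intro power_mono) auto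
      also have "\<dots> \<le> cmod (D k ?z v)" by (rule D_lower[OF x t v])
      finally have "(\<kappa> k + \<bar>v - u\<bar> / 8)\<^sup>2 \<le> cmod (D k ?z v)" .
      moreover have "(\<kappa> k)\<^sup>2 + ((v - u) / 8)\<^sup>2 \<le> (\<kappa> k + \<bar>v - u\<bar> / 8)\<^sup>2"
        using \<kappa>[of k] by (simp add: power2_sum power_divide)
      ultimately have "(\<kappa> k)\<^sup>2 + ((v - u) / 8)\<^sup>2 \<le> cmod (D k ?z v)" by linarith
      moreover have "0 < (\<kappa> k)\<^sup>2 + ((v - u) / 8)\<^sup>2" using \<kappa>[of k] by (intro add_pos_nonneg) auto
      ultimately show "cmod (of_real (\<kappa> k) / D k ?z v) \<le> ?h v"
        using \<kappa>[of k] by (simp add: norm_divide frac_le)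
    qed
    then show ?thesis using int_h(2) by linarith
  qed
  have H0: "(\<lambda>k. H k (Z (x, t))) \<longlonglongrightarrow> 0"
    if x: "x \<in> {l..r}" and t: "t \<in> {0..s}" and notin: "Z (x, t) \<notin> \<zeta> ` E" for x t
  proof -
    let ?z = "Z (x, t)" and ?m = "\<lambda>v. infdist v E + \<bar>Re (Z (x, t) - \<zeta> v)\<bar> / 3"
    have "continuous_on {i1..i2} ?m" by (intro continuous_intros cI) simp
    then have "\<exists>u\<in>{i1..i2}. \<forall>v\<in>{i1..i2}. ?m u \<le> ?m v"
      using I by (intro continuous_attains_inf) simp_all
    then obtain u where u: "u \<in> {i1..i2}" "\<And>v. v \<in> {i1..i2} \<Longrightarrow> ?m u \<le> ?m v"
      by blast
    have mpos: "0 < ?m u"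
    proof (rule ccontr)
      assume "\<not> 0 < ?m u"
      then have 0: "infdist u E = 0" "Re (?z - \<zeta> u) = 0" using infdist_nonneg[of u E] by linarith+
      then have uE: "u \<in> E" using in_closed_iff_infdist_zero[of E u] E compact_imp_closed by blast
      obtain y where y: "y \<in> {l..r}" "Z (y, t) = \<zeta> u" using ch[OF uE t] by blast
      have "\<bar>Im (?z - \<zeta> u)\<bar> \<le> \<bar>Re (?z - \<zeta> u)\<bar> / 3"
        using Re_Im_near(5)[OF x y(1), of t] y(2) t s by simp
      then have "?z = \<zeta> u" using 0(2) by (simp add: complex_eq_iff)
      then show False using notin uE by blast
    qed
    have le: "cmod (H k ?z) \<le> \<kappa> k * (len / (?m u)\<^sup>2)" for k
    proof -
      have "cmod (H k ?z) \<le> (\<kappa> k / (?m u)\<^sup>2) * (i2 - i1)"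
        unfolding H_def
      proof (rule integral_bound[OF _ cH[OF inW[OF x t]]])
        fix v assume v: "v \<in> {i1..i2}"
        have "?m u \<le> K k v + \<bar>Re (?z - \<zeta> v)\<bar> / 3" using u(2)[OF v] K(2)[of v k] by linarith
        then have "(?m u)\<^sup>2 \<le> (K k v + \<bar>Re (?z - \<zeta> v)\<bar> / 3)\<^sup>2" using mpos by (intro power_mono) auto
        also have "\<dots> \<le> cmod (D k ?z v)" by (rule D_lower[OF x t v])
        finally have D_le: "(?m u)\<^sup>2 \<le> cmod (D k ?z v)" .
        have "0 < (?m u)\<^sup>2" using mpos by (rule zero_less_power)
        then show "cmod (of_real (\<kappa> k) / D k ?z v) \<le> \<kappa> k / (?m u)\<^sup>2"
          using D_le \<kappa>[of k] unfolding norm_divide by (intro frac_le) auto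
      qed (use I in simp)
      then show ?thesis by (simp add: len_def)
    qed
    have "(\<lambda>k. \<kappa> k * (len / (?m u)\<^sup>2)) \<longlonglongrightarrow> 0" by (rule \<kappa>_mult)
    then show ?thesis by (rule Lim_null_comparison[OF always_eventually[OF allI[OF le]]])
  qed
  \<comment> \<open>for \<open>\<bar>e - v\<bar> \<le> \<kappa>\<close> both \<open>K\<close> and \<open>\<bar>\<zeta>(e) - \<zeta>(v)\<bar>\<close> are at most \<open>2 \<kappa>\<close>, so that \<open>\<bar>D\<bar> \<le> 104 \<kappa>\<^sup>2\<close>; and \<open>25 / 104\<^sup>2 \<ge> 1 / 500\<close>\<close>
  have H_low: "1 / 500 \<le> Re (H k (\<zeta> e))" if e: "e \<in> E" and small: "\<kappa> k \<le> (i2 - i1) / 2" for e k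
  proof -
    have eI: "e \<in> {i1..i2}" "e \<in> {l..r}" using e E(3) I_sub by auto
    have s0: "0 \<in> {0..s}" using s by simp
    note ce = cH[OF inW[OF eI(2) s0], of k]
    let ?h = "\<lambda>v. Re (of_real (\<kappa> k) / D k (\<zeta> e) v)"
    have ReD: "25 * (K k v)\<^sup>2 \<le> Re (D k (\<zeta> e) v)" if v: "v \<in> {i1..i2}" for v
    proof -
      let ?u = "\<zeta> e - \<zeta> v"
      have "\<bar>Im ?u\<bar> \<le> \<bar>Re ?u\<bar>" using Re_Im_near(5)[OF eI(2) I_sub[OF v] zero_in] by linarith
      then have "(Im ?u)\<^sup>2 \<le> (Re ?u)\<^sup>2" by (simp only: abs_le_square_iff)
      then show ?thesis by (simp add: D_def Re_power2)
    qed
    have Re_h: "?h v = \<kappa> k * Re (D k (\<zeta> e) v) / (cmod (D k (\<zeta> e) v))\<^sup>2" for v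
      by (simp add: Re_divide cmod_def)
    have "(1 / (500 * \<kappa> k)) * \<kappa> k \<le> integral {i1..i2} ?h"
    proof (rule half_interval_le_integral[OF _ _ eI(1) \<kappa> small])
      show "continuous_on {i1..i2} ?h" by (intro continuous_on_Re ce)
      show "0 \<le> ?h v" if "v \<in> {i1..i2}" for v
      proof -
        have "0 \<le> 25 * (K k v)\<^sup>2" by simp
        then have "0 \<le> Re (D k (\<zeta> e) v)" using ReD[OF that] by linarith
        then show ?thesis unfolding Re_h using \<kappa>[of k] by simp
      qed
      show "1 / (500 * \<kappa> k) \<le> ?h v" if v: "v \<in> {i1..i2}" and near: "\<bar>e - v\<bar> \<le> \<kappa> k" for v
      proof -
        let ?u = "\<zeta> e - \<zeta> v"
        have "infdist v E \<le> \<kappa> k" using infdist_le2[OF e, of v "\<kappa> k"] near by (simp add: dist_real_def abs_minus_commute)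
        then have K2: "K k v \<le> 2 * \<kappa> k" by (simp add: K_def)
        have "cmod ?u \<le> 5 / 4 * \<bar>e - v\<bar>" by (rule Re_Im_near(4)[OF eI(2) I_sub[OF v] zero_in])
        moreover have "y \<le> 2 * q" if "y \<le> 5 / 4 * d" "d \<le> q" "0 < q" for y d q :: real using that by linarith
        ultimately have u2: "cmod ?u \<le> 2 * \<kappa> k" using near \<kappa>[of k] by blast
        have "cmod (D k (\<zeta> e) v) \<le> cmod (of_real (25 * (K k v)\<^sup>2)) + cmod (?u\<^sup>2)"
          unfolding D_def by (rule norm_triangle_ineq)
        also have "\<dots> = 25 * (K k v)\<^sup>2 + (cmod ?u)\<^sup>2" by (simp add: norm_power)
        also have "\<dots> \<le> 25 * (2 * \<kappa> k)\<^sup>2 + (2 * \<kappa> k)\<^sup>2"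
          using K2 u2 K(1)[of k v] by (intro add_mono mult_left_mono power_mono) auto
        also have "\<dots> = 104 * (\<kappa> k)\<^sup>2" by (simp add: power2_eq_square)
        finally have D_up: "cmod (D k (\<zeta> e) v) \<le> 104 * (\<kappa> k)\<^sup>2" .
        have ReD': "25 * (\<kappa> k)\<^sup>2 \<le> Re (D k (\<zeta> e) v)"
          using ReD[OF v] power_mono[OF K(3)[of k v], of 2] \<kappa>[of k] by simp
        have Dpos: "0 < (cmod (D k (\<zeta> e) v))\<^sup>2"
        proof -
          have "0 < 25 * (\<kappa> k)\<^sup>2" using \<kappa>[of k] by simp
          then have "0 < Re (D k (\<zeta> e) v)" using ReD' by linarith
          then have "D k (\<zeta> e) v \<noteq> 0" by auto
          then show ?thesis by simp
        qed
        have "1 / (500 * \<kappa> k) \<le> \<kappa> k * (25 * (\<kappa> k)\<^sup>2) / (104 * (\<kappa> k)\<^sup>2)\<^sup>2"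
          using \<kappa>[of k] by (simp add: field_simps power2_eq_square)
        also have "\<dots> \<le> \<kappa> k * Re (D k (\<zeta> e) v) / (cmod (D k (\<zeta> e) v))\<^sup>2"
        proof (intro frac_le mult_left_mono power_mono Dpos ReD' D_up)
          have "0 \<le> 25 * (\<kappa> k)\<^sup>2" by simp
          from order_trans[OF this ReD'] show "0 \<le> \<kappa> k * Re (D k (\<zeta> e) v)" using \<kappa>[of k] by simp
        qed (use \<kappa>[of k] in simp_all)
        finally show ?thesis unfolding Re_h .
      qed
    qed
    also have "integral {i1..i2} ?h = Re (H k (\<zeta> e))"
      unfolding H_def using integral_linear[OF integrable_continuous_real[OF ce] bounded_linear_Re]
      by (simp add: o_def)
    finally show ?thesis using \<kappa>[of k] by simp
  qed
  define N where "N = {x \<in> {l..r}. Z (x, s) \<in> \<zeta> ` E}"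
  have N: "negligible N"
  proof -
    have sT: "s \<in> {0..T}" and ss: "s \<in> {0..s}" using s by auto
    define f where "f e = (SOME y. y \<in> {l..r} \<and> Z (y, s) = \<zeta> e)" for e
    have f: "f e \<in> {l..r}" "Z (f e, s) = \<zeta> e" if "e \<in> E" for e
    proof -
      have "\<exists>y. y \<in> {l..r} \<and> Z (y, s) = \<zeta> e" using ch[OF that ss] by blast
      from someI_ex[OF this] show "f e \<in> {l..r}" "Z (f e, s) = \<zeta> e" unfolding f_def by simp_all
    qed
    have lip: "\<bar>f y - f x\<bar> \<le> 2 * \<bar>y - x\<bar>" if "x \<in> E" "y \<in> E" for x y
    proof -
      have "3 / 4 * \<bar>f y - f x\<bar> \<le> \<bar>Re (Z (f y, s) - Z (f x, s))\<bar>"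
        by (rule Re_Im_near(3)[OF f(1)[OF that(2)] f(1)[OF that(1)] sT])
      also have "\<dots> \<le> cmod (\<zeta> y - \<zeta> x)" unfolding f(2)[OF that(1)] f(2)[OF that(2)] by (rule abs_Re_le_cmod)
      also have "\<dots> \<le> 5 / 4 * \<bar>y - x\<bar>" using that E(3) I_sub by (intro Re_Im_near(4) zero_in) auto
      finally have "3 / 4 * \<bar>f y - f x\<bar> \<le> 5 / 4 * \<bar>y - x\<bar>" .
      moreover have "p \<le> 2 * d" if "3 / 4 * p \<le> 5 / 4 * d" "0 \<le> d" for p d :: real using that by linarith
      ultimately show ?thesis using abs_ge_zero by blast
    qed
    have "negligible (f ` E)"
    proof (rule negligible_locally_Lipschitz_image[OF _ E(4)])
      fix x assume "x \<in> E"
      then show "\<exists>T B. open T \<and> x \<in> T \<and> (\<forall>y\<in>E \<inter> T. norm (f y - f x) \<le> B * norm (y - x))"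
        using lip by (intro exI[of _ UNIV] exI[of _ 2]) auto
    qed simp
    moreover have "N \<subseteq> f ` E"
    proof
      fix x assume "x \<in> N"
      then obtain e where e: "e \<in> E" "x \<in> {l..r}" "Z (x, s) = \<zeta> e" by (auto simp: N_def)
      have "3 / 4 * \<bar>x - f e\<bar> \<le> \<bar>Re (Z (x, s) - Z (f e, s))\<bar>"
        by (rule Re_Im_near(3)[OF e(2) f(1)[OF e(1)] sT])
      then have "x = f e" using e(3) f(2)[OF e(1)] by simp
      then show "x \<in> f ` E" using e(1) by blast
    qed
    ultimately show ?thesis by (rule negligible_subset)
  qed
  have s0: "0 \<in> {0..s}" "s \<in> {0..s}" using s by auto
  show ?thesis
  proof (rule peaks_of_half_plane[OF g L X _ _ _ _ _ sideW _ _ N _ \<eta>, where C = "8 * pi" and s = s and e = 1 and \<Theta> = "\<lambda>k. 0" and c = "1 / 500"])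
    show "admissible (H k) (W k) s 1 0" for k
      unfolding admissible_def using hol s inW m by auto
    have low: "- (8 * pi) \<le> Re (H k (Z (x, t)))" if "x \<in> {l..r}" "t \<in> {0..s}" for k x t
      using H_bound[OF that, of k] abs_Re_le_cmod[of "H k (Z (x, t))"] by linarith
    show "- (8 * pi) \<le> Re (H k (\<zeta> x))" if "x \<in> {l..r}" for k x by (rule low[OF that s0(1)])
    show "- (8 * pi) \<le> Re (H k (Z (x, s)))" if "x \<in> {l..r}" for k x by (rule low[OF that s0(2)])
    show "(\<lambda>k. H k (Z (x, s))) \<longlonglongrightarrow> 0" if "x \<in> {l..r} - N" for x
      using that by (intro H0 s0) (auto simp: N_def)
    show "(\<lambda>k. H k (\<zeta> x)) \<longlonglongrightarrow> 0" if x: "x \<in> {l..r} - E" for x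
    proof (rule H0[OF _ s0(1)])
      show "\<zeta> x \<notin> \<zeta> ` E"
      proof
        assume "\<zeta> x \<in> \<zeta> ` E"
        then obtain e where e: "e \<in> E" "\<zeta> x = \<zeta> e" by blast
        have "3 / 4 * \<bar>x - e\<bar> \<le> \<bar>Re (\<zeta> x - \<zeta> e)\<bar>" using x e E(3) I_sub by (intro Re_Im_near(3) zero_in) auto
        then show False using e x by simp
      qed
    qed (use x in simp)
    have "\<forall>\<^sub>F k in sequentially. \<kappa> k < (i2 - i1) / 2"
      using I by (intro order_tendstoD(2)[OF \<kappa>_lim]) simp
    then show "\<forall>\<^sub>F k in sequentially. \<forall>x\<in>E. 1 / 500 \<le> Re (H k (\<zeta> x))"
      by eventually_elim (use H_low in auto)
    show "(\<lambda>k. \<kappa> k * (len / (\<rho> / 2)\<^sup>2)) \<longlonglongrightarrow> 0" by (rule \<kappa>_mult)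
  qed simp_all
qed

end

section \<open>Peaks at points that a level curve avoids\<close>

lemma vector_derivative_bound:
  fixes f :: "real \<Rightarrow> 'b::real_normed_vector"
  assumes "convex S" and f: "\<And>x. x \<in> S \<Longrightarrow> (f has_vector_derivative f' x) (at x within S)"
    and B: "\<And>x. x \<in> S \<Longrightarrow> norm (f' x) \<le> B" and "x \<in> S" "y \<in> S"
  shows "norm (f x - f y) \<le> B * \<bar>x - y\<bar>"
proof -
  have "norm (f x - f y) \<le> B * norm (x - y)"
  proof (rule differentiable_bound[OF assms(1)])
    show "(f has_derivative (\<lambda>h. h *\<^sub>R f' x)) (at x within S)" if "x \<in> S" for x
      using f[OF that] by (simp add: has_vector_derivative_def)
    show "onorm (\<lambda>h. h *\<^sub>R f' x) \<le> B" if "x \<in> S" for x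
    proof (rule onorm_le)
      show "norm (h *\<^sub>R f' x) \<le> B * norm h" for h
        using mult_left_mono[OF B[OF that] abs_ge_zero[of h]] by (simp add: mult.commute)
    qed
  qed fact+
  then show ?thesis by simp
qed

lemma cone_bound:
  fixes p d q :: real
  assumes "p - d / 4 \<le> q" "3 / 4 * d \<le> q" "0 \<le> d"
  shows "(p + d) / 4 \<le> q"
  using assms by (simp add: field_simps)

context flat_strip
begin

lemma zeta_Taylor:
  obtains M where "M \<ge> 0" "\<And>x v. x \<in> {l..r} \<Longrightarrow> v \<in> {l..r} \<Longrightarrow> cmod (\<zeta> x - \<zeta> v - of_real (x - v) * \<zeta>' v) \<le> M * (x - v)\<^sup>2"
proof -
  obtain M where M: "M > 0" "\<And>x t. x \<in> {l..r} \<Longrightarrow> t \<in> {0..T} \<Longrightarrow> cmod (px (px Z) (x, t)) \<le> M"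
    using bounded_rect[OF smooth_on_px[OF smooth_on_px[OF smooth_Z]]] by metis
  have d1: "(\<zeta> has_vector_derivative \<zeta>' x) (at x within S)" and
    d2: "(\<zeta>' has_vector_derivative px (px Z) (x, 0)) (at x within S)" if "x \<in> {l..r}" for x S
    using inV[OF that zero_in]
    by (intro has_vector_derivative_px smooth_on_imp_differentiable[OF smooth_Z] smooth_on_imp_differentiable[OF smooth_on_px[OF smooth_Z]]; simp)+
  have lip: "cmod (\<zeta>' x - \<zeta>' v) \<le> M * \<bar>x - v\<bar>" if "x \<in> {l..r}" "v \<in> {l..r}" for x v
    by (rule vector_derivative_bound[where S = "{l..r}" and f' = "\<lambda>x. px (px Z) (x, 0)"])
      (use d2 M(2) zero_in that in auto)
  have "cmod (\<zeta> x - \<zeta> v - of_real (x - v) * \<zeta>' v) \<le> M * (x - v)\<^sup>2" if x: "x \<in> {l..r}" and v: "v \<in> {l..r}" for x v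
  proof -
    have seg: "y \<in> {l..r}" "\<bar>y - v\<bar> \<le> \<bar>x - v\<bar>" if "y \<in> closed_segment v x" for y
      using that x v by (auto simp: closed_segment_eq_real_ivl split: if_splits)
    have "norm (\<zeta> x - \<zeta> v - (x - v) *\<^sub>R \<zeta>' v) \<le> norm (x - v) * (M * \<bar>x - v\<bar>)"
    proof (rule vector_differentiable_bound_linearization[where f = \<zeta> and f' = \<zeta>' and S = "closed_segment v x"])
      show "(\<zeta> has_vector_derivative \<zeta>' y) (at y within closed_segment v x)" if "y \<in> closed_segment v x" for y
        by (rule d1[OF seg(1)[OF that]])
      show "cmod (\<zeta>' y - \<zeta>' v) \<le> M * \<bar>x - v\<bar>" if "y \<in> closed_segment v x" for y
        using lip[OF seg(1)[OF that] v] mult_left_mono[OF seg(2)[OF that], of M] M(1) by linarith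
    qed auto
    also have "norm (x - v) * (M * \<bar>x - v\<bar>) = M * (x - v)\<^sup>2"
      using power2_abs[of "x - v"] unfolding power2_eq_square real_norm_def by (simp only: mult.left_commute)
    finally show ?thesis by (simp only: scaleR_conv_of_real)
  qed
  then show ?thesis by (rule that[OF less_imp_le[OF M(1)]])
qed

text \<open>The curve at level \<open>s\<close>, even when moved further in the direction \<open>\<i> \<sigma>\<close>, avoids the points \<open>\<zeta>(v)\<close>. The Cauchy
  kernels \<open>\<zeta>'(v) / (\<kappa> - \<i> \<sigma> (z - \<zeta>(v)))\<close> have their poles at \<open>\<zeta>(v) - \<i> \<sigma> \<kappa>\<close>, just off the lowest
  curve on the side away from level \<open>s\<close>, and a shift in direction \<open>\<i> \<sigma>\<close> moves everything away from them. Thanks to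
  the numerator \<open>\<zeta>'(v)\<close>, the real part on the lowest curve is at least a Poisson kernel minus a constant. The weights \<open>w\<close> equal \<open>1\<close> on \<open>E\<close> and tend to \<open>0\<close> elsewhere,
  so their total \<open>Wk\<close> tends to \<open>0\<close> because \<open>E\<close> is a null set; this kills the constant, as well as \<open>H\<close>
  at level \<open>s\<close> and near the sides, where the kernels are bounded.\<close>

lemma peaks_one_sided:
  fixes \<sigma> :: real
  assumes g: "solution g gx" "tame n g" and L: "has_trace X g L" and X: "{l..r} \<subseteq> X"
    and J: "i1 \<le> j1" "j1 < j2" "j2 \<le> i2"
    and E: "compact E" "E \<noteq> {}" "E \<subseteq> {j1..j2}" "negligible E" and s: "0 < s" "s \<le> T"
    and \<sigma>: "\<sigma> = 1 \<or> \<sigma> = - 1"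
    and sep: "\<And>x v \<theta>. x \<in> {l..r} \<Longrightarrow> v \<in> {j1..j2} \<Longrightarrow> 0 \<le> \<theta> \<Longrightarrow> Z (x, s) + \<i> * of_real \<sigma> * of_real \<theta> \<noteq> \<zeta> v"
    and \<eta>: "\<eta> > 0"
  shows "peaks X L E \<eta>"
proof -
  define len where "len = j2 - j1"
  have len: "len > 0" using J by (simp add: len_def)
  have J_sub: "v \<in> {j1..j2} \<Longrightarrow> v \<in> {i1..i2}" "v \<in> {j1..j2} \<Longrightarrow> v \<in> {l..r}" for v
    using J I_sub[of v] by auto
  define \<kappa> where "\<kappa> k = 1 / real (Suc k)" for k
  have \<kappa>: "\<kappa> k > 0" "\<kappa> k \<le> 1" for k by (simp_all add: \<kappa>_def)
  have \<kappa>_lim: "\<kappa> \<longlonglongrightarrow> 0" unfolding \<kappa>_def using LIMSEQ_inverse_real_of_nat by (simp add: inverse_eq_divide)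
  define w where "w k v = (\<kappa> k / (\<kappa> k + infdist v E))\<^sup>2" for k v
  have den_pos: "0 < \<kappa> k + infdist v E" for k v using \<kappa>(1)[of k] infdist_nonneg[of v E] by linarith
  have w01: "0 \<le> w k v" "w k v \<le> 1" for k v
    using den_pos[of k v] \<kappa>(1)[of k] infdist_nonneg[of v E] by (simp_all add: w_def power_le_one)
  have cw: "continuous_on {j1..j2} (w k)" for k
    unfolding w_def using den_pos[of k] by (intro continuous_intros) (auto simp: less_imp_neq[symmetric])
  define Wk where "Wk k = integral {j1..j2} (w k)" for k
  have w_int: "w k integrable_on {j1..j2}" for k by (rule integrable_continuous_real[OF cw])
  have Wk0: "0 \<le> Wk k" for k unfolding Wk_def by (intro integral_nonneg w_int w01)
  have Wk_le: "Wk k \<le> len" for k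
  proof -
    have "Wk k \<le> integral {j1..j2} (\<lambda>v. 1)" unfolding Wk_def by (intro integral_le w_int w01) auto
    then show ?thesis using J by (simp add: len_def)
  qed
  have Wk_lim: "Wk \<longlonglongrightarrow> 0"
  proof -
    have spike: "Wk k = integral ({j1..j2} - E) (w k)" for k
      unfolding Wk_def by (rule integral_spike_set) (auto intro: negligible_subset[OF E(4)])
    have int: "f integrable_on {j1..j2} - E" if "f integrable_on {j1..j2}" for f :: "real \<Rightarrow> real"
      using that by (rule integrable_spike_set) (auto intro: negligible_subset[OF E(4)])
    have "(\<lambda>k. integral ({j1..j2} - E) (w k)) \<longlonglongrightarrow> integral ({j1..j2} - E) (\<lambda>v. 0)"
    proof (rule dominated_convergence(2)[where h = "\<lambda>v. 1"])
      show "w k integrable_on {j1..j2} - E" for k by (rule int[OF w_int])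
      show "(\<lambda>v. 1 :: real) integrable_on {j1..j2} - E" by (rule int) (rule integrable_const_ivl)
      show "norm (w k v) \<le> 1" for k v using w01[of k v] by simp
      show "(\<lambda>k. w k v) \<longlonglongrightarrow> 0" if v: "v \<in> {j1..j2} - E" for v
      proof -
        have "infdist v E \<noteq> 0" using in_closed_iff_infdist_zero[of E v] E(1,2) compact_imp_closed v by blast
        then have "(\<lambda>k. w k v) \<longlonglongrightarrow> (0 / (0 + infdist v E))\<^sup>2"
          unfolding w_def by (intro tendsto_intros \<kappa>_lim) simp
        then show ?thesis by simp
      qed
    qed
    then show ?thesis unfolding spike by simp
  qed
  define D where "D k z v = of_real (\<kappa> k) - \<i> * of_real \<sigma> * (z - \<zeta> v)" for k z v
  define H where "H k z = integral {j1..j2} (\<lambda>v. of_real (w k v) * \<zeta>' v / D k z v)" for k z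
  define W where "W k = {z. \<forall>v\<in>{j1..j2}. D k z v \<noteq> 0}" for k
  have cJ: "continuous_on {j1..j2} \<zeta>" "continuous_on {j1..j2} \<zeta>'"
    using continuous_on_subset[OF continuous_zeta(1)] continuous_on_subset[OF continuous_zeta(2)] J_sub(2) by blast+
  have cq: "continuous_on {j1..j2} (\<lambda>v. of_real (w k v) * \<zeta>' v)" for k
    by (intro continuous_on_mult continuous_on_of_real cw cJ)
  have cD: "continuous_on (UNIV \<times> {j1..j2}) (\<lambda>p. D k (fst p) (snd p))" for k
  proof -
    have "continuous_on (UNIV \<times> {j1..j2}) (\<lambda>p :: complex \<times> real. \<zeta> (snd p))"
      by (rule continuous_on_compose2[OF cJ(1) continuous_on_snd[OF continuous_on_id]]) auto
    then show ?thesis unfolding D_def by (intro continuous_intros)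
  qed
  have D': "((\<lambda>z. D k z v) has_field_derivative - (\<i> * of_real \<sigma>)) (at z)" for k z v
    unfolding D_def by (auto intro!: derivative_eq_intros)
  have hol: "open (W k)" "H k holomorphic_on W k" for k
    using kernel_integral_holomorphic[where D = "D k", OF cq cD D' continuous_on_const]
    by (simp_all add: W_def H_def[abs_def])
  have cDz: "continuous_on {j1..j2} (\<lambda>v. D k z v)" for k z
    unfolding D_def by (intro continuous_intros cJ)
  have cH: "continuous_on {j1..j2} (\<lambda>v. of_real (w k v) * \<zeta>' v / D k z v)" if "z \<in> W k" for k z
    using that cDz cq by (intro continuous_on_divide) (auto simp: W_def)
  have norm_\<zeta>': "cmod (\<zeta>' v - 1) \<le> 1 / 4" "cmod (\<zeta>' v) \<le> 5 / 4" "3 / 4 \<le> Re (\<zeta>' v)" if "v \<in> {l..r}" for v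
  proof -
    show 1: "cmod (\<zeta>' v - 1) \<le> 1 / 4" using Zx_near[OF that zero_in] eps by linarith
    show "cmod (\<zeta>' v) \<le> 5 / 4" using norm_triangle_ineq[of "\<zeta>' v - 1" 1] 1 by simp
    show "3 / 4 \<le> Re (\<zeta>' v)" using abs_Re_le_cmod[of "\<zeta>' v - 1"] 1 by simp
  qed
  have H_le: "cmod (H k z) \<le> 5 / 4 / c * Wk k"
    if zW: "z \<in> W k" and c: "0 < c" "\<And>v. v \<in> {j1..j2} \<Longrightarrow> c \<le> cmod (D k z v)" for k z c
  proof -
    have "cmod (H k z) \<le> integral {j1..j2} (\<lambda>v. 5 / 4 / c * w k v)"
      unfolding H_def
    proof (rule integral_norm_bound_integral[OF integrable_continuous_real[OF cH[OF zW]]])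
      show "(\<lambda>v. 5 / 4 / c * w k v) integrable_on {j1..j2}" by (intro integrable_continuous_real continuous_on_mult continuous_on_const cw)
      fix v assume v: "v \<in> {j1..j2}"
      have "cmod (\<zeta>' v) / cmod (D k z v) \<le> 5 / 4 / c"
        using norm_\<zeta>'(2)[OF J_sub(2)[OF v]] c(1) c(2)[OF v] by (intro frac_le) auto
      from mult_right_mono[OF this w01(1)[of k v]]
      show "cmod (of_real (w k v) * \<zeta>' v / D k z v) \<le> 5 / 4 / c * w k v"
        using w01(1)[of k v] by (simp add: norm_mult norm_divide mult_ac)
    qed
    then show ?thesis by (simp add: Wk_def)
  qed
  have \<sigma>2: "of_real \<sigma> * of_real \<sigma> = (1 :: complex)" using \<sigma> by auto
  have D_0: "z + \<i> * of_real \<sigma> * of_real (\<kappa> k) = \<zeta> v" if "D k z v = 0" for k z v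
  proof -
    have "\<i> * of_real \<sigma> * D k z v = \<i> * of_real \<sigma> * of_real (\<kappa> k) + (of_real \<sigma> * of_real \<sigma>) * (z - \<zeta> v)"
      by (simp add: D_def algebra_simps)
    then show ?thesis using that \<sigma>2 by (simp add: algebra_simps)
  qed
  have D_shift: "D k (z + \<i> * of_real \<sigma> * of_real \<theta>) v = of_real (\<kappa> k + \<theta>) - \<i> * of_real \<sigma> * (z - \<zeta> v)" for k z v \<theta>
  proof -
    have "D k (z + \<i> * of_real \<sigma> * of_real \<theta>) v = of_real (\<kappa> k) + (of_real \<sigma> * of_real \<sigma>) * of_real \<theta> - \<i> * of_real \<sigma> * (z - \<zeta> v)"
      by (simp add: D_def algebra_simps)
    then show ?thesis using \<sigma>2 by simp
  qed
  have ReD: "Re (D k z v) = \<kappa> k + \<sigma> * Im (z - \<zeta> v)" and ImD: "\<bar>Im (D k z v)\<bar> = \<bar>Re (z - \<zeta> v)\<bar>" for k z v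
    using \<sigma> by (auto simp: D_def abs_minus_commute)
  have sideW: "z \<in> W k \<and> cmod (H k z) \<le> 5 / 4 / (\<rho> / 2) * Wk k"
    if z: "\<And>v. v \<in> {i1..i2} \<Longrightarrow> \<rho> / 2 \<le> \<bar>Re (z - \<zeta> v)\<bar>" for k z
  proof -
    have D_le: "\<rho> / 2 \<le> cmod (D k z v)" if "v \<in> {j1..j2}" for v
      using z[OF J_sub(1)[OF that]] abs_Im_le_cmod[of "D k z v"] ImD[of k z v] by linarith
    have zW: "z \<in> W k" using D_le rho by (force simp: W_def)
    then show ?thesis using H_le[OF zW _ D_le] rho by simp
  qed
  have botD: "(\<kappa> k + \<theta> + \<bar>x - v\<bar>) / 4 \<le> cmod (D k (\<zeta> x + \<i> * of_real \<sigma> * of_real \<theta>) v)"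
    if x: "x \<in> {l..r}" and v: "v \<in> {j1..j2}" and \<theta>: "0 \<le> \<theta>" for k x v \<theta>
  proof -
    let ?D = "D k (\<zeta> x + \<i> * of_real \<sigma> * of_real \<theta>) v"
    note near = Re_Im_near[OF x J_sub(2)[OF v] zero_in]
    have "Re ?D = \<kappa> k + \<theta> + \<sigma> * Im (\<zeta> x - \<zeta> v)" unfolding D_shift by simp
    moreover have "- (\<bar>x - v\<bar> / 4) \<le> \<sigma> * Im (\<zeta> x - \<zeta> v)" 
    proof (cases "\<sigma> = 1")
      case True
      then show ?thesis using abs_le_D2[OF near(2)] by simp
    next
      case False
      then show ?thesis using \<sigma> abs_le_D1[OF near(2)] by simp
    qed
    ultimately have 1: "\<kappa> k + \<theta> - \<bar>x - v\<bar> / 4 \<le> cmod ?D" using abs_Re_le_cmod[of ?D] by linarith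
    have "\<bar>Im ?D\<bar> = \<bar>Re (\<zeta> x - \<zeta> v)\<bar>" unfolding D_shift using \<sigma> by (auto simp: abs_minus_commute)
    then have 2: "3 / 4 * \<bar>x - v\<bar> \<le> cmod ?D" using abs_Im_le_cmod[of ?D] near(3) by linarith
    from cone_bound[OF 1 2] show ?thesis using \<kappa>(1)[of k] \<theta> by simp
  qed
  have botD0: "(\<kappa> k + \<bar>x - v\<bar>) / 4 \<le> cmod (D k (\<zeta> x) v)" if "x \<in> {l..r}" "v \<in> {j1..j2}" for k x v
    using botD[OF that, of 0 k] by simp
  have botW: "\<zeta> x + \<i> * of_real \<sigma> * of_real \<theta> \<in> W k" if "x \<in> {l..r}" "0 \<le> \<theta>" for k x \<theta>
  proof -
    have "D k (\<zeta> x + \<i> * of_real \<sigma> * of_real \<theta>) v \<noteq> 0" if v: "v \<in> {j1..j2}" for v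
    proof -
      have "0 < (\<kappa> k + \<theta> + \<bar>x - v\<bar>) / 4" using \<kappa>(1)[of k] \<open>0 \<le> \<theta>\<close> by simp
      then show ?thesis using botD[OF \<open>x \<in> {l..r}\<close> v \<open>0 \<le> \<theta>\<close>, of k] by auto
    qed
    then show ?thesis by (simp add: W_def)
  qed
  have topW: "Z (x, s) + \<i> * of_real \<sigma> * of_real \<theta> \<in> W k" if x: "x \<in> {l..r}" "0 \<le> \<theta>" for k x \<theta>
  proof -
    have "D k (Z (x, s) + \<i> * of_real \<sigma> * of_real \<theta>) v \<noteq> 0" if v: "v \<in> {j1..j2}" for v
    proof
      assume "D k (Z (x, s) + \<i> * of_real \<sigma> * of_real \<theta>) v = 0"
      from D_0[OF this] have "Z (x, s) + \<i> * of_real \<sigma> * of_real (\<theta> + \<kappa> k) = \<zeta> v" by (simp add: algebra_simps)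
      moreover have "0 \<le> \<theta> + \<kappa> k" using x(2) \<kappa>(1)[of k] by simp
      ultimately show False using sep[OF x(1) v] by blast
    qed
    then show ?thesis by (simp add: W_def)
  qed
  \<comment> \<open>compactness, with \<open>\<kappa>\<close> replaced by a parameter in \<open>[0, 1]\<close>\<close>
  obtain c1 where c1: "0 < c1" "\<And>k x v. x \<in> {l..r} \<Longrightarrow> v \<in> {j1..j2} \<Longrightarrow> c1 \<le> cmod (D k (Z (x, s)) v)"
  proof -
    let ?K = "{l..r} \<times> {j1..j2} \<times> {0..1 :: real}"
    let ?f = "\<lambda>p. cmod (of_real (snd (snd p)) - \<i> * of_real \<sigma> * (Z (fst p, s) - \<zeta> (fst (snd p))))"
    have sT: "s \<in> {0..T}" using s by auto
    have 1: "continuous_on ?K (\<lambda>p. Z (fst p, s))"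
      by (rule continuous_on_compose2[OF smooth_slice[OF smooth_Z sT] continuous_on_fst[OF continuous_on_id]]) auto
    have 2: "continuous_on ?K (\<lambda>p. \<zeta> (fst (snd p)))"
      by (rule continuous_on_compose2[OF cJ(1) continuous_on_fst[OF continuous_on_snd[OF continuous_on_id]]]) auto
    have "continuous_on ?K ?f"
      by (intro continuous_on_norm continuous_on_diff continuous_on_mult continuous_on_const 1 2 continuous_on_of_real
          continuous_on_snd continuous_on_id)
    moreover have "compact ?K" by (intro compact_Times compact_Icc)
    moreover have "?K \<noteq> {}" using J l_less_r by auto
    ultimately have "\<exists>p\<in>?K. \<forall>q\<in>?K. ?f p \<le> ?f q" by (intro continuous_attains_inf)
    then obtain p where p: "p \<in> ?K" "\<And>q. q \<in> ?K \<Longrightarrow> ?f p \<le> ?f q" by blast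
    have "0 < ?f p"
    proof -
      obtain x v q where xvq: "p = (x, v, q)" "x \<in> {l..r}" "v \<in> {j1..j2}" "0 \<le> q" using p(1) by auto
      have "of_real q - \<i> * of_real \<sigma> * (Z (x, s) - \<zeta> v) \<noteq> 0"
      proof
        assume 0: "of_real q - \<i> * of_real \<sigma> * (Z (x, s) - \<zeta> v) = 0"
        have "\<i> * of_real \<sigma> * (of_real q - \<i> * of_real \<sigma> * (Z (x, s) - \<zeta> v))
          = \<i> * of_real \<sigma> * of_real q + (of_real \<sigma> * of_real \<sigma>) * (Z (x, s) - \<zeta> v)" by (simp add: algebra_simps)
        then have "\<i> * of_real \<sigma> * of_real q + (Z (x, s) - \<zeta> v) = 0" unfolding 0 \<sigma>2 by simp
        moreover have "\<i> * of_real \<sigma> * of_real q + (Z (x, s) - \<zeta> v) = Z (x, s) + \<i> * of_real \<sigma> * of_real q - \<zeta> v"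
          by simp
        ultimately have "Z (x, s) + \<i> * of_real \<sigma> * of_real q = \<zeta> v" by simp
        then show False using sep[OF xvq(2-4)] by blast
      qed
      then show ?thesis unfolding xvq(1) by simp
    qed
    moreover have "?f p \<le> cmod (D k (Z (x, s)) v)" if "x \<in> {l..r}" "v \<in> {j1..j2}" for k x v
      using p(2)[of "(x, v, \<kappa> k)"] that \<kappa>[of k] by (simp add: D_def)
    ultimately show ?thesis by (rule that)
  qed
  have tW0: "Z (x, s) \<in> W k" if "x \<in> {l..r}" for x k using topW[OF that, of 0 k] by simp
  have topH: "cmod (H k (Z (x, s))) \<le> 5 / 4 / c1 * Wk k" if "x \<in> {l..r}" for k x
    by (rule H_le[OF tW0[OF that] c1(1) c1(2)[OF that]])
  obtain M where M: "M \<ge> 0" "\<And>x v. x \<in> {l..r} \<Longrightarrow> v \<in> {l..r} \<Longrightarrow> cmod (\<zeta> x - \<zeta> v - of_real (x - v) * \<zeta>' v) \<le> M * (x - v)\<^sup>2"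
    using zeta_Taylor by blast
  have bW0: "\<zeta> x \<in> W k" if "x \<in> {l..r}" for x k using botW[OF that, of 0 k] by simp
  \<comment> \<open>the real part of the kernel is at least a multiple of the Poisson kernel minus a constant\<close>
  have kernel: "3 / 4 * \<kappa> k / (cmod (D k (\<zeta> x) v))\<^sup>2 - 20 * M \<le> Re (\<zeta>' v / D k (\<zeta> x) v)"
    if x: "x \<in> {l..r}" and v: "v \<in> {j1..j2}" for k x v
  proof -
    let ?D = "D k (\<zeta> x) v" and ?h = "x - v"
    define R where "R = \<zeta> x - \<zeta> v - of_real ?h * \<zeta>' v"
    have R: "cmod R \<le> M * ?h\<^sup>2" unfolding R_def by (rule M(2)[OF x J_sub(2)[OF v]])
    have D_eq: "?D = of_real (\<kappa> k) - \<i> * of_real \<sigma> * (of_real ?h * \<zeta>' v + R)" by (simp add: D_def R_def)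
    have "\<zeta>' v * cnj ?D = of_real (\<kappa> k) * \<zeta>' v + \<i> * of_real (\<sigma> * ?h) * (\<zeta>' v * cnj (\<zeta>' v)) + \<i> * of_real \<sigma> * (\<zeta>' v * cnj R)"
      unfolding D_eq by (simp add: algebra_simps)
    also have "\<zeta>' v * cnj (\<zeta>' v) = of_real ((cmod (\<zeta>' v))\<^sup>2)" by (simp add: complex_norm_square[symmetric])
    finally have Re_eq: "Re (\<zeta>' v * cnj ?D) = \<kappa> k * Re (\<zeta>' v) + Re (\<i> * of_real \<sigma> * (\<zeta>' v * cnj R))"
      by simp
    have "cmod (\<i> * of_real \<sigma> * (\<zeta>' v * cnj R)) = cmod (\<zeta>' v) * cmod R"
      using \<sigma> by (auto simp: norm_mult)
    also have "\<dots> \<le> 5 / 4 * (M * ?h\<^sup>2)" using R norm_\<zeta>'(2)[OF J_sub(2)[OF v]] by (intro mult_mono) auto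
    finally have "- (5 / 4 * (M * ?h\<^sup>2)) \<le> Re (\<i> * of_real \<sigma> * (\<zeta>' v * cnj R))"
      using abs_Re_le_cmod[of "\<i> * of_real \<sigma> * (\<zeta>' v * cnj R)"] by linarith
    moreover have "3 / 4 * \<kappa> k \<le> \<kappa> k * Re (\<zeta>' v)" using norm_\<zeta>'(3)[OF J_sub(2)[OF v]] \<kappa>(1)[of k] by simp
    ultimately have num: "3 / 4 * \<kappa> k - 5 / 4 * M * ?h\<^sup>2 \<le> Re (\<zeta>' v * cnj ?D)" using Re_eq by linarith
    have "\<bar>?h\<bar> / 4 \<le> (\<kappa> k + \<bar>?h\<bar>) / 4" "0 < (\<kappa> k + \<bar>?h\<bar>) / 4" using \<kappa>(1)[of k] by simp_all
    with botD0[OF x v, of k] have D_low: "\<bar>?h\<bar> / 4 \<le> cmod ?D" and D_pos: "0 < cmod ?D"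
      by (blast intro: order_trans less_le_trans)+
    have "(\<bar>?h\<bar> / 4)\<^sup>2 \<le> (cmod ?D)\<^sup>2" using D_low by (intro power_mono) auto
    then have "?h\<^sup>2 \<le> 16 * (cmod ?D)\<^sup>2" by (simp add: power_divide)
    then have "M * ?h\<^sup>2 \<le> M * (16 * (cmod ?D)\<^sup>2)" using M(1) by (rule mult_left_mono)
    then have "3 / 4 * \<kappa> k - 20 * M * (cmod ?D)\<^sup>2 \<le> Re (\<zeta>' v * cnj ?D)" using num by linarith
    then have "(3 / 4 * \<kappa> k - 20 * M * (cmod ?D)\<^sup>2) / (cmod ?D)\<^sup>2 \<le> Re (\<zeta>' v * cnj ?D) / (cmod ?D)\<^sup>2"
      by (intro divide_right_mono) auto
    moreover have "Re (\<zeta>' v / ?D) = Re (\<zeta>' v * cnj ?D) / (cmod ?D)\<^sup>2"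
      by (simp add: complex_div_cnj[of "\<zeta>' v" ?D] flip: of_real_power)
    moreover have "(3 / 4 * \<kappa> k - 20 * M * (cmod ?D)\<^sup>2) / (cmod ?D)\<^sup>2 = 3 / 4 * \<kappa> k / (cmod ?D)\<^sup>2 - 20 * M"
      using D_pos by (simp add: diff_divide_distrib)
    ultimately show ?thesis by simp
  qed
  have Re_H: "Re (H k z) = integral {j1..j2} (\<lambda>v. w k v * Re (\<zeta>' v / D k z v))"
    and Re_int: "(\<lambda>v. w k v * Re (\<zeta>' v / D k z v)) integrable_on {j1..j2}" if "z \<in> W k" for k z
  proof -
    have eq: "Re (of_real (w k v) * \<zeta>' v / D k z v) = w k v * Re (\<zeta>' v / D k z v)" for v
    proof -
      have "of_real (w k v) * \<zeta>' v / D k z v = w k v *\<^sub>R (\<zeta>' v / D k z v)" by (simp add: scaleR_conv_of_real)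
      then show ?thesis by (simp only: scaleR_complex.simps)
    qed
    note int = integrable_continuous_real[OF cH[OF that]]
    show "Re (H k z) = integral {j1..j2} (\<lambda>v. w k v * Re (\<zeta>' v / D k z v))"
      unfolding H_def using integral_linear[OF int bounded_linear_Re] by (simp add: o_def eq)
    show "(\<lambda>v. w k v * Re (\<zeta>' v / D k z v)) integrable_on {j1..j2}"
      using integrable_linear[OF int bounded_linear_Re] by (simp add: o_def eq)
  qed
  define P where "P k x v = w k v * (3 / 4 * \<kappa> k / (cmod (D k (\<zeta> x) v))\<^sup>2)" for k x v
  have P0: "0 \<le> P k x v" for k x v unfolding P_def using w01(1) \<kappa>(1)[of k] by simp
  have cP: "continuous_on {j1..j2} (P k x)" if "x \<in> {l..r}" for k x
    unfolding P_def using bW0[OF that, of k] by (intro continuous_intros cw cDz) (auto simp: W_def)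
  have Re_low: "integral {j1..j2} (P k x) - 20 * M * Wk k \<le> Re (H k (\<zeta> x))" if x: "x \<in> {l..r}" for k x
  proof -
    have "integral {j1..j2} (\<lambda>v. P k x v - 20 * M * w k v) \<le> Re (H k (\<zeta> x))"
      unfolding Re_H[OF bW0[OF x]]
    proof (rule integral_le)
      show "(\<lambda>v. P k x v - 20 * M * w k v) integrable_on {j1..j2}"
        by (intro integrable_continuous_real continuous_intros cP x cw)
      show "(\<lambda>v. w k v * Re (\<zeta>' v / D k (\<zeta> x) v)) integrable_on {j1..j2}" by (rule Re_int[OF bW0[OF x]])
      fix v assume v: "v \<in> {j1..j2}"
      show "P k x v - 20 * M * w k v \<le> w k v * Re (\<zeta>' v / D k (\<zeta> x) v)"
        using mult_left_mono[OF kernel[OF x v, of k] w01(1)[of k v]] by (simp add: P_def right_diff_distrib mult_ac)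
    qed
    moreover have "integral {j1..j2} (\<lambda>v. P k x v - 20 * M * w k v) = integral {j1..j2} (P k x) - 20 * M * Wk k"
      unfolding Wk_def
      by (subst integral_diff) (auto intro!: integrable_continuous_real cP x cw continuous_intros)
    ultimately show ?thesis by simp
  qed
  have P_int0: "0 \<le> integral {j1..j2} (P k x)" if "x \<in> {l..r}" for k x
    by (intro integral_nonneg integrable_continuous_real cP that P0)
  \<comment> \<open>for \<open>\<bar>e - v\<bar> \<le> \<kappa>\<close> the weight is at least \<open>1 / 4\<close> and \<open>\<bar>D\<bar> \<le> 9/4 \<kappa>\<close>\<close>
  have E_low: "1 / 32 \<le> integral {j1..j2} (P k e)" if e: "e \<in> E" and small: "\<kappa> k \<le> (j2 - j1) / 2" for e k
  proof -
    have eJ: "e \<in> {j1..j2}" "e \<in> {l..r}" using e E(3) J_sub(2) by auto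
    have "1 / (32 * \<kappa> k) * \<kappa> k \<le> integral {j1..j2} (P k e)"
    proof (rule half_interval_le_integral[OF cP[OF eJ(2)] P0 eJ(1) \<kappa>(1) small])
      fix v assume v: "v \<in> {j1..j2}" and near: "\<bar>e - v\<bar> \<le> \<kappa> k"
      have inf: "infdist v E \<le> \<kappa> k" using infdist_le2[OF e, of v "\<kappa> k"] near by (simp add: dist_real_def abs_minus_commute)
      have "1 / 2 \<le> \<kappa> k / (\<kappa> k + infdist v E)" using inf den_pos[of k v] by (simp add: field_simps)
      from power_mono[OF this, of 2] have w_low: "1 / 4 \<le> w k v" by (simp add: w_def power_divide)
      have "cmod (\<zeta> e - \<zeta> v) \<le> 5 / 4 * \<bar>e - v\<bar>" by (rule Re_Im_near(4)[OF eJ(2) J_sub(2)[OF v] zero_in])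
      moreover have "y \<le> 5 / 4 * q" if "y \<le> 5 / 4 * d" "d \<le> q" for y d q :: real using that by linarith
      ultimately have u: "cmod (\<zeta> e - \<zeta> v) \<le> 5 / 4 * \<kappa> k" using near by blast
      have "cmod (D k (\<zeta> e) v) \<le> cmod (of_real (\<kappa> k)) + cmod (\<i> * of_real \<sigma> * (\<zeta> e - \<zeta> v))"
        unfolding D_def by (rule norm_triangle_ineq4)
      also have "\<dots> = \<kappa> k + cmod (\<zeta> e - \<zeta> v)" using \<sigma> \<kappa>(1)[of k] by (auto simp: norm_mult)
      finally have D_up: "cmod (D k (\<zeta> e) v) \<le> 9 / 4 * \<kappa> k" using u by linarith
      have "0 < (\<kappa> k + \<bar>e - v\<bar>) / 4" using \<kappa>(1)[of k] by simp
      then have D_pos: "0 < cmod (D k (\<zeta> e) v)" using botD0[OF eJ(2) v, of k] by linarith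
      have "1 / (8 * \<kappa> k) \<le> 3 / 4 * \<kappa> k / (9 / 4 * \<kappa> k)\<^sup>2"
        using \<kappa>(1)[of k] by (simp add: field_simps power2_eq_square)
      also have "\<dots> \<le> 3 / 4 * \<kappa> k / (cmod (D k (\<zeta> e) v))\<^sup>2"
        using D_up D_pos \<kappa>(1)[of k] by (intro frac_le power_mono) auto
      finally have "1 / 4 * (1 / (8 * \<kappa> k)) \<le> P k e v"
        unfolding P_def using w_low w01(1)[of k v] \<kappa>(1)[of k] by (intro mult_mono) auto
      then show "1 / (32 * \<kappa> k) \<le> P k e v" by simp
    qed
    then show ?thesis using \<kappa>(1)[of k] by simp
  qed
  have H0: "(\<lambda>k. H k (\<zeta> x)) \<longlonglongrightarrow> 0" if x: "x \<in> {l..r} - E" for x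
  proof -
    define d where "d = infdist x E"
    have "d \<noteq> 0" using in_closed_iff_infdist_zero[of E x] E(1,2) compact_imp_closed x by (auto simp: d_def)
    then have d: "0 < d" using infdist_nonneg[of x E] by (simp add: d_def)
    have xJ: "x \<in> {l..r}" using x by simp
    have le: "cmod (H k (\<zeta> x)) \<le> 20 * len / d\<^sup>2 * \<kappa> k + 10 / d * Wk k" for k
    proof -
      have "cmod (H k (\<zeta> x)) \<le> integral {j1..j2} (\<lambda>v. 5 * (4 * \<kappa> k / d\<^sup>2 + 2 / d * w k v))"
        unfolding H_def
      proof (rule integral_norm_bound_integral[OF integrable_continuous_real[OF cH[OF bW0[OF xJ]]]])
        show "(\<lambda>v. 5 * (4 * \<kappa> k / d\<^sup>2 + 2 / d * w k v)) integrable_on {j1..j2}"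
          by (intro integrable_continuous_real continuous_on_mult continuous_on_add continuous_on_const cw)
        fix v assume v: "v \<in> {j1..j2}"
        let ?q = "\<kappa> k + \<bar>x - v\<bar>"
        have q: "0 < ?q" using \<kappa>(1)[of k] by simp
        have "w k v / ?q \<le> 4 * \<kappa> k / d\<^sup>2 + 2 / d * w k v"
        proof (cases "d / 2 \<le> infdist v E")
          case True
          have "\<kappa> k / (\<kappa> k + infdist v E) \<le> \<kappa> k / (d / 2)"
            using True d \<kappa>(1)[of k] by (intro divide_left_mono mult_pos_pos den_pos) auto
          from power_mono[OF this, of 2] have "w k v \<le> 4 * (\<kappa> k)\<^sup>2 / d\<^sup>2"
            using \<kappa>(1)[of k] den_pos[of k v] by (simp add: w_def power_divide power_mult_distrib mult.commute)
          then have "w k v / ?q \<le> 4 * (\<kappa> k)\<^sup>2 / d\<^sup>2 / \<kappa> k"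
            using \<kappa>(1)[of k] w01(1)[of k v] by (intro frac_le) auto
          also have "\<dots> = 4 * \<kappa> k / d\<^sup>2" using \<kappa>(1)[of k] by (simp add: power2_eq_square)
          finally show ?thesis using w01(1)[of k v] d by (simp add: add_increasing2)
        next
          case False
          have "d \<le> infdist v E + dist x v" unfolding d_def by (rule infdist_triangle)
          then have "d / 2 \<le> ?q" using False \<kappa>(1)[of k] by (simp add: dist_real_def)
          then have "w k v / ?q \<le> w k v / (d / 2)" using d w01(1)[of k v] by (intro frac_le) auto
          moreover have "0 \<le> 4 * \<kappa> k / d\<^sup>2" using \<kappa>(1)[of k] by simp
          ultimately show ?thesis by (simp add: mult.commute)
        qed
        from mult_left_mono[OF this, of 5] have "5 * (w k v / ?q) \<le> 5 * (4 * \<kappa> k / d\<^sup>2 + 2 / d * w k v)" by simp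
        moreover have "cmod (of_real (w k v) * \<zeta>' v / D k (\<zeta> x) v) \<le> 5 * (w k v / ?q)"
        proof -
          have "cmod (\<zeta>' v) / cmod (D k (\<zeta> x) v) \<le> (5 / 4) / (?q / 4)"
            using norm_\<zeta>'(2)[OF J_sub(2)[OF v]] botD0[OF xJ v, of k] q by (intro frac_le) auto
          from mult_left_mono[OF this w01(1)[of k v]] show ?thesis
            using w01(1)[of k v] by (simp add: norm_mult norm_divide mult_ac)
        qed
        ultimately show "cmod (of_real (w k v) * \<zeta>' v / D k (\<zeta> x) v) \<le> 5 * (4 * \<kappa> k / d\<^sup>2 + 2 / d * w k v)"
          by (rule order_trans[rotated])
      qed
      also have "\<dots> = 5 * (4 * \<kappa> k / d\<^sup>2 * len + 2 / d * Wk k)"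
      proof -
        have "integral {j1..j2} (\<lambda>v. 4 * \<kappa> k / d\<^sup>2 + 2 / d * w k v) = integral {j1..j2} (\<lambda>v. 4 * \<kappa> k / d\<^sup>2) + integral {j1..j2} (\<lambda>v. 2 / d * w k v)"
          by (intro integral_add integrable_continuous_real continuous_on_const continuous_on_mult cw)
        also have "\<dots> = 4 * \<kappa> k / d\<^sup>2 * len + 2 / d * Wk k" using J by (simp add: Wk_def len_def)
        finally show ?thesis by (simp only: integral_mult_right)
      qed
      finally show ?thesis by (simp add: algebra_simps)
    qed
    have "(\<lambda>k. 20 * len / d\<^sup>2 * \<kappa> k + 10 / d * Wk k) \<longlonglongrightarrow> 20 * len / d\<^sup>2 * 0 + 10 / d * 0"
      by (intro tendsto_add tendsto_mult tendsto_const \<kappa>_lim Wk_lim)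
    then have "(\<lambda>k. 20 * len / d\<^sup>2 * \<kappa> k + 10 / d * Wk k) \<longlonglongrightarrow> 0" by simp
    then show ?thesis by (rule Lim_null_comparison[OF always_eventually[OF allI[OF le]]])
  qed
  have Wk_mult: "(\<lambda>k. y * Wk k) \<longlonglongrightarrow> 0" for y
    using tendsto_mult_left[OF Wk_lim, of y] by (simp only: mult_zero_right)
  define C where "C = max (20 * M * len) (5 / 4 / c1 * len)"
  obtain B where B: "B > 0" "\<And>x t. x \<in> {l..r} \<Longrightarrow> t \<in> {0..T} \<Longrightarrow> cmod (Z (x, t)) \<le> B"
    using bounded_rect[OF smooth_Z] by metis
  note B' = B(2)
  have B0: "0 \<le> B" using B(1) by simp
  \<comment> \<open>a shift longer than the diameter of the image of the rectangle\<close>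
  define \<Theta> where "\<Theta> = 2 * B + 1"
  have \<Theta>: "0 \<le> \<Theta>" using B0 by (simp add: \<Theta>_def)
  have farW: "Z (x, t) + \<i> * of_real \<sigma> * of_real \<Theta> \<in> W k" if x: "x \<in> {l..r}" and t: "t \<in> {0..T}" for k x t
  proof -
    have "D k (Z (x, t) + \<i> * of_real \<sigma> * of_real \<Theta>) v \<noteq> 0" if v: "v \<in> {j1..j2}" for v
    proof
      assume "D k (Z (x, t) + \<i> * of_real \<sigma> * of_real \<Theta>) v = 0"
      then have "of_real (\<kappa> k + \<Theta>) = \<i> * of_real \<sigma> * (Z (x, t) - \<zeta> v)" unfolding D_shift by simp
      then have "cmod (of_real (\<kappa> k + \<Theta>)) = cmod (Z (x, t) - \<zeta> v)" using \<sigma> by (auto simp: norm_mult)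
      then have "\<bar>\<kappa> k + \<Theta>\<bar> = cmod (Z (x, t) - \<zeta> v)" by (simp only: norm_of_real)
      moreover have "cmod (Z (x, t) - \<zeta> v) \<le> B + B"
        using norm_triangle_ineq4[of "Z (x, t)" "\<zeta> v"] B'[OF x t] B'[OF J_sub(2)[OF v] zero_in] by linarith
      ultimately show False using \<kappa>(1)[of k] B0 by (simp add: \<Theta>_def)
    qed
    then show ?thesis by (simp add: W_def)
  qed
  have side_shift: "Z (x, t) + \<i> * of_real \<sigma> * of_real \<theta> \<in> W k"
    if "x \<in> {l..m1} \<union> {m2..r}" "t \<in> {0..T}" for k x t \<theta>
  proof -
    have "\<rho> / 2 \<le> \<bar>Re (Z (x, t) + \<i> * of_real \<sigma> * of_real \<theta> - \<zeta> v)\<bar>" if "v \<in> {i1..i2}" for v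
      using side_sep[OF \<open>x \<in> _\<close> \<open>t \<in> _\<close> that] rho by simp
    then show ?thesis using sideW by blast
  qed
  show ?thesis
  proof (rule peaks_of_half_plane[OF g L X _ _ _ _ _ sideW _ _ negligible_empty _ \<eta>, where C = C and s = s and e = "\<i> * of_real \<sigma>" and \<Theta> = "\<lambda>k. \<Theta>" and c = "1 / 64"])
    show "admissible (H k) (W k) s (\<i> * of_real \<sigma>) \<Theta>" for k
      unfolding admissible_def
    proof (intro conjI hol s \<Theta> ballI)
      show "cmod (\<i> * of_real \<sigma>) = 1" using \<sigma> by (auto simp: norm_mult)
    qed (use botW topW side_shift farW s in auto)
    show "- C \<le> Re (H k (\<zeta> x))" if x: "x \<in> {l..r}" for k x
    proof -
      have "20 * M * Wk k \<le> 20 * M * len" using Wk_le[of k] M(1) by (intro mult_left_mono) auto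
      then show ?thesis using Re_low[OF x, of k] P_int0[OF x, of k] unfolding C_def by linarith
    qed
    show "- C \<le> Re (H k (Z (x, s)))" if x: "x \<in> {l..r}" for k x
    proof -
      have "5 / 4 / c1 * Wk k \<le> 5 / 4 / c1 * len" using Wk_le[of k] c1(1) by (intro mult_left_mono) auto
      then show ?thesis using topH[OF x, of k] abs_Re_le_cmod[of "H k (Z (x, s))"] unfolding C_def by linarith
    qed
    show "(\<lambda>k. H k (Z (x, s))) \<longlonglongrightarrow> 0" if "x \<in> {l..r} - {}" for x
      using topH that by (intro Lim_null_comparison[OF always_eventually[OF allI] Wk_mult[of "5 / 4 / c1"]]) simp
    show "(\<lambda>k. H k (\<zeta> x)) \<longlonglongrightarrow> 0" if "x \<in> {l..r} - E" for x by (rule H0[OF that])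
    have "\<forall>\<^sub>F k in sequentially. \<kappa> k < (j2 - j1) / 2" using J by (intro order_tendstoD(2)[OF \<kappa>_lim]) simp
    moreover have "\<forall>\<^sub>F k in sequentially. 20 * M * Wk k < 1 / 64" by (rule order_tendstoD(2)[OF Wk_mult]) simp
    ultimately show "\<forall>\<^sub>F k in sequentially. \<forall>x\<in>E. 1 / 64 \<le> Re (H k (\<zeta> x))"
    proof eventually_elim
      case (elim k)
      show ?case
      proof
        fix x assume x: "x \<in> E"
        have xl: "x \<in> {l..r}" using x E(3) J_sub(2) by auto
        have "1 / 32 \<le> integral {j1..j2} (P k x)" using elim(1) by (intro E_low[OF x]) simp
        then show "1 / 64 \<le> Re (H k (\<zeta> x))" using Re_low[OF xl, of k] elim(2) by linarith
      qed
    qed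
    show "(\<lambda>k. 5 / 4 / (\<rho> / 2) * Wk k) \<longlonglongrightarrow> 0" by (rule Wk_mult)
  qed simp_all
qed

end

section \<open>Complex Radon measures\<close>

text \<open>An upper bound for the total variation of \<open>\<mu>\<close>, possibly strict because the four components need not be
  mutually singular.\<close>

definition total_mass :: "(nat \<Rightarrow> real measure) \<Rightarrow> real set \<Rightarrow> real" where
  "total_mass \<mu> B = (\<Sum>k<4. measure (\<mu> k) B)"

lemma norm_i_sum_le:
  fixes z :: "nat \<Rightarrow> complex"
  assumes "\<And>k. k < 4 \<Longrightarrow> cmod (z k) \<le> b k"
  shows "cmod (\<Sum>k<4. \<i> ^ k * z k) \<le> (\<Sum>k<4. b k)"
proof -
  have "cmod (\<Sum>k<4. \<i> ^ k * z k) \<le> (\<Sum>k<4. cmod (\<i> ^ k * z k))" by (rule norm_sum)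
  also have "\<dots> \<le> (\<Sum>k<4. b k)" using assms by (intro sum_mono) (simp add: norm_mult norm_power)
  finally show ?thesis .
qed

locale radon_family =
  fixes X :: "real set" and \<mu> :: "nat \<Rightarrow> real measure"
  assumes open_X: "open X" and radon: "complex_radon_measure_on X \<mu>"
begin

lemma sets_\<mu>: "k < 4 \<Longrightarrow> sets (\<mu> k) = sets (restrict_space borel X)"
  and finite_\<mu>: "k < 4 \<Longrightarrow> compact K \<Longrightarrow> K \<subseteq> X \<Longrightarrow> emeasure (\<mu> k) K < \<infinity>"
  using radon unfolding complex_radon_measure_on_def radon_measure_on_def by blast+

lemma space_\<mu>: "k < 4 \<Longrightarrow> space (\<mu> k) = X"
  using sets_eq_imp_space_eq[OF sets_\<mu>, of k] by (simp add: space_restrict_space)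

lemma in_sets_\<mu>: "k < 4 \<Longrightarrow> B \<in> sets borel \<Longrightarrow> B \<subseteq> X \<Longrightarrow> B \<in> sets (\<mu> k)"
  using open_X by (simp add: sets_\<mu> sets_restrict_space_iff)

lemma borel_of_compact: "compact K \<Longrightarrow> K \<in> sets borel" for K :: "real set"
  by (simp add: borel_closed compact_imp_closed)

lemma finite_\<mu>_subset:
  assumes k: "k < 4" and B: "B \<in> sets borel" "compact (closure B)" "closure B \<subseteq> X"
  shows "emeasure (\<mu> k) B < \<infinity>"
proof -
  have "emeasure (\<mu> k) B \<le> emeasure (\<mu> k) (closure B)"
    using B in_sets_\<mu>[OF k borel_of_compact[OF B(2)] B(3)] by (intro emeasure_mono closure_subset)
  then show ?thesis using finite_\<mu>[OF k B(2,3)] by (rule le_less_trans)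
qed

lemma integrable_\<mu>:
  fixes \<phi> :: "real \<Rightarrow> complex"
  assumes k: "k < 4" and \<phi>: "\<phi> \<in> borel_measurable borel" and K: "compact K" "K \<subseteq> X"
    and le: "\<And>x. cmod (\<phi> x) \<le> c * indicator K x"
  shows "integrable (\<mu> k) \<phi>"
proof (rule Bochner_Integration.integrable_bound)
  show "integrable (\<mu> k) (\<lambda>x. c * indicator K x :: real)"
    using finite_\<mu>[OF k K] in_sets_\<mu>[OF k borel_of_compact[OF K(1)] K(2)]
    by (intro integrable_mult_right integrable_real_indicator)
  show "\<phi> \<in> borel_measurable (\<mu> k)"
    using measurable_restrict_space1[OF \<phi>] by (simp add: measurable_cong_sets[OF sets_\<mu>[OF k] refl])
  show "AE x in \<mu> k. norm (\<phi> x) \<le> norm (c * indicator K x :: real)"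
  proof (rule AE_I2)
    fix x show "norm (\<phi> x) \<le> norm (c * indicator K x :: real)"
      using le[of x] abs_ge_self[of "c * indicator K x :: real"] unfolding real_norm_def by (rule order_trans)
  qed
qed

text \<open>Dominated convergence removes the part of the integrals off \<open>E\<close>; on \<open>E\<close> the integrands are within \<open>q\<close> of
  \<open>1\<close>.\<close>

lemma cmeasure_le_of_peaks:
  fixes \<phi> :: "nat \<Rightarrow> real \<Rightarrow> complex"
  assumes K: "compact K" "K \<subseteq> X" and E: "compact E" "E \<subseteq> K"
    and meas: "\<And>j. \<phi> j \<in> borel_measurable borel"
    and bound: "\<And>j x. cmod (\<phi> j x) \<le> c * indicator K x"
    and off: "\<And>x. x \<in> K - E \<Longrightarrow> (\<lambda>j. \<phi> j x) \<longlonglongrightarrow> 0"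
    and on: "\<forall>\<^sub>F j in sequentially. \<forall>x\<in>E. cmod (\<phi> j x - 1) \<le> q"
    and lim: "(\<lambda>j. cintegral \<mu> (\<phi> j)) \<longlonglongrightarrow> 0"
  shows "cmod (cmeasure \<mu> E) \<le> q * total_mass \<mu> E"
proof -
  have EX: "E \<subseteq> X" using E K by blast
  note Eb = borel_of_compact[OF E(1)]
  let ?e = "\<lambda>x. indicator E x :: complex"
  define A where "A j k = (LINT x|\<mu> k. ?e x * \<phi> j x)" for j k
  define B where "B j k = (LINT x|\<mu> k. indicator (- E) x * \<phi> j x)" for j k
  have c0: "0 \<le> c * indicator K x" for x using order_trans[OF norm_ge_zero bound] .
  have ind_bound: "cmod (indicator A x * \<phi> j x) \<le> c * indicator K x" for A j x
  proof -
    have "cmod (indicator A x * \<phi> j x) \<le> cmod (\<phi> j x)" by (cases "x \<in> A") simp_all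
    then show ?thesis using bound[of j x] by (rule order_trans)
  qed
  have int: "integrable (\<mu> k) (\<lambda>x. ?e x * \<phi> j x)" "integrable (\<mu> k) (\<lambda>x. indicator (- E) x * \<phi> j x)" if "k < 4" for j k
  proof -
    have [measurable]: "\<phi> j \<in> borel_measurable borel" "E \<in> sets borel" using meas Eb by auto
    show "integrable (\<mu> k) (\<lambda>x. ?e x * \<phi> j x)"
      by (rule integrable_\<mu>[OF that _ K ind_bound]) measurable
    show "integrable (\<mu> k) (\<lambda>x. indicator (- E) x * \<phi> j x)"
      by (rule integrable_\<mu>[OF that _ K ind_bound]) measurable
  qed
  have split: "cintegral \<mu> (\<phi> j) = (\<Sum>k<4. \<i> ^ k * A j k) + (\<Sum>k<4. \<i> ^ k * B j k)" for j
  proof -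
    have "(LINT x|\<mu> k. \<phi> j x) = A j k + B j k" if "k < 4" for k
    proof -
      have "(LINT x|\<mu> k. \<phi> j x) = (LINT x|\<mu> k. ?e x * \<phi> j x + indicator (- E) x * \<phi> j x)"
        by (intro Bochner_Integration.integral_cong) (auto simp: indicator_def)
      then show ?thesis using int[OF that] by (simp add: A_def B_def)
    qed
    then show ?thesis by (simp add: cintegral_def sum.distrib[symmetric] distrib_left)
  qed
  have B_lim: "(\<lambda>j. B j k) \<longlonglongrightarrow> 0" if k: "k < 4" for k
  proof -
    have "(\<lambda>j. LINT x|\<mu> k. indicator (- E) x * \<phi> j x) \<longlonglongrightarrow> (LINT x|\<mu> k. 0)"
    proof (rule integral_dominated_convergence[where w = "\<lambda>x. c * indicator K x"])
      show "integrable (\<mu> k) (\<lambda>x. c * indicator K x :: real)"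
        using finite_\<mu>[OF k K] in_sets_\<mu>[OF k borel_of_compact[OF K(1)] K(2)]
        by (intro integrable_mult_right integrable_real_indicator)
      show "(\<lambda>x. indicator (- E) x * \<phi> j x) \<in> borel_measurable (\<mu> k)" for j
        using int(2)[OF k] by (rule borel_measurable_integrable)
      show "AE x in \<mu> k. norm (indicator (- E) x * \<phi> j x) \<le> c * indicator K x" for j
        by (intro AE_I2 ind_bound)
      show "AE x in \<mu> k. (\<lambda>j. indicator (- E) x * \<phi> j x) \<longlonglongrightarrow> 0"
      proof (rule AE_I2)
        fix x
        consider "x \<in> E" | "x \<in> K - E" | "x \<notin> K" by blast
        then show "(\<lambda>j. indicator (- E) x * \<phi> j x) \<longlonglongrightarrow> 0"
        proof cases
          case 2
          then show ?thesis using off[OF 2] by simp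
        next
          case 3
          then have "\<phi> j x = 0" for j using bound[of j x] by simp
          then show ?thesis by simp
        qed simp
      qed
    qed simp
    then show ?thesis by (simp add: B_def)
  qed
  have "(\<lambda>j. \<Sum>k<4. \<i> ^ k * B j k) \<longlonglongrightarrow> (\<Sum>k<4. \<i> ^ k * 0)"
    by (intro tendsto_sum tendsto_mult tendsto_const B_lim) simp
  then have "(\<lambda>j. cintegral \<mu> (\<phi> j) - (\<Sum>k<4. \<i> ^ k * B j k)) \<longlonglongrightarrow> 0 - 0"
    by (intro tendsto_diff lim) simp
  then have A_lim: "(\<lambda>j. \<Sum>k<4. \<i> ^ k * A j k) \<longlonglongrightarrow> 0" unfolding split by simp
  have A_near: "\<forall>\<^sub>F j in sequentially. cmod (cmeasure \<mu> E) \<le> cmod (\<Sum>k<4. \<i> ^ k * A j k) + q * total_mass \<mu> E"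
    using on
  proof eventually_elim
    case (elim j)
    have "cmod (of_real (measure (\<mu> k) E) - A j k) \<le> q * measure (\<mu> k) E" if k: "k < 4" for k
    proof -
      have Es: "E \<in> sets (\<mu> k)" by (rule in_sets_\<mu>[OF k Eb EX])
      have fin: "emeasure (\<mu> k) E < \<infinity>" by (rule finite_\<mu>[OF k E(1) EX])
      have i2: "integrable (\<mu> k) (indicator E :: real \<Rightarrow> real)" using Es fin by (rule integrable_real_indicator)
      have e: "?e = (\<lambda>x. complex_of_real (indicator E x))" by (simp add: fun_eq_iff indicator_def)
      have i1: "integrable (\<mu> k) ?e" unfolding e by (rule integrable_of_real[OF i2])
      have m: "(LINT x|\<mu> k. (indicator E x :: real)) = measure (\<mu> k) E"
        using EX by (simp add: space_\<mu>[OF k] Int_absorb2)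
      have "of_real (measure (\<mu> k) E) = (LINT x|\<mu> k. ?e x)" by (simp only: e integral_complex_of_real m)
      then have "of_real (measure (\<mu> k) E) - A j k = (LINT x|\<mu> k. ?e x - ?e x * \<phi> j x)"
        using i1 int(1)[OF k] by (simp add: A_def)
      also have "cmod \<dots> \<le> (LINT x|\<mu> k. q * indicator E x)"
      proof (rule Bochner_Integration.integral_norm_bound_integral)
        show "integrable (\<mu> k) (\<lambda>x. ?e x - ?e x * \<phi> j x)" using i1 int(1)[OF k] by simp
        show "integrable (\<mu> k) (\<lambda>x. q * indicator E x)" using i2 by simp
        show "cmod (?e x - ?e x * \<phi> j x) \<le> q * indicator E x" for x
          using elim by (cases "x \<in> E") (simp_all add: norm_minus_commute)
      qed
      also have "\<dots> = q * measure (\<mu> k) E" using m by simp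
      finally show ?thesis .
    qed
    from norm_i_sum_le[OF this]
    have "cmod (\<Sum>k<4. \<i> ^ k * (of_real (measure (\<mu> k) E) - A j k)) \<le> q * total_mass \<mu> E"
      by (simp add: total_mass_def sum_distrib_left)
    moreover have eq: "cmeasure \<mu> E = (\<Sum>k<4. \<i> ^ k * A j k) + (\<Sum>k<4. \<i> ^ k * (of_real (measure (\<mu> k) E) - A j k))"
      by (simp add: cmeasure_def sum.distrib[symmetric] distrib_left[symmetric])
    have "cmod (cmeasure \<mu> E) \<le> cmod (\<Sum>k<4. \<i> ^ k * A j k) + cmod (\<Sum>k<4. \<i> ^ k * (of_real (measure (\<mu> k) E) - A j k))"
      unfolding eq by (rule norm_triangle_ineq)
    ultimately show ?case by (meson add_left_mono order_trans)
  qed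
  have "(\<lambda>j. cmod (\<Sum>k<4. \<i> ^ k * A j k) + q * total_mass \<mu> E) \<longlonglongrightarrow> 0 + q * total_mass \<mu> E"
    by (intro tendsto_add tendsto_const tendsto_norm_zero A_lim)
  from tendsto_lowerbound[OF this A_near] show ?thesis by simp
qed

text \<open>The estimate that is local and countably additive in \<open>A\<close>, and implies absolute continuity as \<open>\<epsilon> \<rightarrow> 0\<close>.\<close>

definition small_on :: "real \<Rightarrow> real set \<Rightarrow> bool" where
  "small_on \<epsilon> A \<longleftrightarrow> A \<in> sets borel \<and> (\<forall>B\<in>sets borel. B \<subseteq> A \<and> compact (closure B) \<and> closure B \<subseteq> X \<and> emeasure lborel B = 0
    \<longrightarrow> cmod (cmeasure \<mu> B) \<le> \<epsilon> * total_mass \<mu> B)"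

text \<open>Restricting \<open>\<mu> k\<close> to the compact closure of \<open>B\<close> gives a finite Borel measure \<open>\<nu>\<close> on the line, which is inner
  regular.\<close>

lemma inner_regular_\<mu>:
  assumes k: "k < 4" and B: "B \<in> sets borel" "compact (closure B)" "closure B \<subseteq> X" and e: "e > 0"
  obtains K where "compact K" "K \<subseteq> B" "measure (\<mu> k) (B - K) < e"
proof -
  let ?C = "closure B"
  define \<nu> where "\<nu> = distr (density (\<mu> k) (indicator ?C)) borel (\<lambda>x. x)"
  have C: "?C \<in> sets (\<mu> k)" by (rule in_sets_\<mu>[OF k borel_of_compact[OF B(2)] B(3)])
  have id: "(\<lambda>x. x) \<in> measurable (density (\<mu> k) (indicator ?C)) borel"
    using measurable_restrict_space1[of "\<lambda>x :: real. x" borel borel X]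
    by (simp add: measurable_cong_sets[OF sets_\<mu>[OF k] refl])
  have \<nu>: "emeasure \<nu> A = emeasure (\<mu> k) (A \<inter> ?C)" if "A \<in> sets borel" for A
  proof -
    have s: "A \<inter> X \<in> sets (\<mu> k)" using open_X that by (intro in_sets_\<mu>[OF k]) auto
    have "emeasure \<nu> A = emeasure (density (\<mu> k) (indicator ?C)) (A \<inter> X)"
      unfolding \<nu>_def using that id by (simp add: emeasure_distr space_\<mu>[OF k])
    also have "\<dots> = emeasure (\<mu> k) (?C \<inter> (A \<inter> X))"
      using emeasure_density[OF borel_measurable_indicator[OF C] s] nn_integral_indicator[OF sets.Int[OF C s]]
      by (simp only: indicator_inter_arith)
    also have "?C \<inter> (A \<inter> X) = A \<inter> ?C" using B(3) by blast
    finally show ?thesis .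
  qed
  have BC: "B \<subseteq> ?C" by (rule closure_subset)
  have fin: "emeasure \<nu> (space \<nu>) \<noteq> \<infinity>"
    using \<nu>[of UNIV] finite_\<mu>[OF k B(2,3)] by (simp add: \<nu>_def)
  have sup: "emeasure \<nu> B = (SUP K\<in>{K. K \<subseteq> B \<and> compact K}. emeasure \<nu> K)"
    by (rule inner_regular[OF _ fin B(1)]) (simp add: \<nu>_def)
  have finB: "emeasure (\<mu> k) B < \<infinity>" by (rule finite_\<mu>_subset[OF k B])
  have \<nu>B: "emeasure \<nu> B = emeasure (\<mu> k) B" using \<nu>[OF B(1)] BC by (simp add: Int_absorb2)
  show ?thesis
  proof (cases "emeasure (\<mu> k) B = 0")
    case True
    then show ?thesis using e by (intro that[of "{}"]) (simp_all add: measure_def)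
  next
    case False
    have "emeasure \<nu> B - ennreal e < emeasure \<nu> B"
      using False finB e \<nu>B by (intro ennreal_between) (auto simp: zero_less_iff_neq_zero)
    then obtain K where K: "K \<subseteq> B" "compact K" "emeasure \<nu> B - ennreal e < emeasure \<nu> K"
      using ord_less_eq_trans[OF _ sup] unfolding less_SUP_iff by blast
    have KX: "K \<subseteq> X" using K(1) BC B(3) by blast
    note Kb = borel_of_compact[OF K(2)]
    have \<nu>K: "emeasure \<nu> K = emeasure (\<mu> k) K" using \<nu>[OF Kb] K(1) BC by (simp add: Int_absorb2 subset_trans)
    have sB: "B \<in> sets (\<mu> k)" and sK: "K \<in> sets (\<mu> k)"
      using in_sets_\<mu>[OF k B(1)] in_sets_\<mu>[OF k Kb KX] BC B(3) by auto
    have "measure (\<mu> k) B - e < measure (\<mu> k) K"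
    proof -
      have mB: "emeasure (\<mu> k) B = ennreal (measure (\<mu> k) B)" using finB by (simp add: emeasure_eq_ennreal_measure)
      have mK: "emeasure (\<mu> k) K = ennreal (measure (\<mu> k) K)"
        using finite_\<mu>[OF k K(2) KX] by (simp add: emeasure_eq_ennreal_measure)
      have "ennreal (measure (\<mu> k) B - e) < ennreal (measure (\<mu> k) K)"
        using K(3) less_imp_le[OF e] unfolding \<nu>B \<nu>K mB mK by (simp only: ennreal_minus)
      then show ?thesis using ennreal_leI[of "measure (\<mu> k) K" "measure (\<mu> k) B - e"] by (meson leD leI)
    qed
    moreover have "measure (\<mu> k) (B - K) = measure (\<mu> k) B - measure (\<mu> k) K"
      using finB sB sK K(1) by (intro measure_Diff) auto
    ultimately show ?thesis by (intro that[OF K(2,1)]) simp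
  qed
qed

lemma measure_split:
  assumes B: "B \<in> sets borel" "compact (closure B)" "closure B \<subseteq> X" and K: "K \<in> sets borel" "K \<subseteq> B" and k: "k < 4"
  shows "measure (\<mu> k) B = measure (\<mu> k) K + measure (\<mu> k) (B - K)"
proof -
  have BX: "B \<subseteq> X" using B(3) closure_subset by (rule order_trans[rotated])
  have "measure (\<mu> k) (B - K) = measure (\<mu> k) B - measure (\<mu> k) K"
  proof (rule measure_Diff)
    show "emeasure (\<mu> k) B \<noteq> \<infinity>" using finite_\<mu>_subset[OF k B] by simp
    show "B \<in> sets (\<mu> k)" using in_sets_\<mu>[OF k B(1) BX] .
    show "K \<in> sets (\<mu> k)" using in_sets_\<mu>[OF k K(1)] K(2) BX by blast
  qed (rule K(2))
  then show ?thesis by simp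
qed

text \<open>\<open>B\<close> is exhausted by a compact subset simultaneously for the four components.\<close>

lemma small_on_of_compact:
  assumes A: "A \<in> sets borel" and \<epsilon>: "0 \<le> \<epsilon>"
    and small: "\<And>E. compact E \<Longrightarrow> E \<subseteq> A \<Longrightarrow> E \<subseteq> X \<Longrightarrow> emeasure lborel E = 0 \<Longrightarrow> cmod (cmeasure \<mu> E) \<le> \<epsilon> * total_mass \<mu> E"
  shows "small_on \<epsilon> A"
  unfolding small_on_def
proof (intro conjI ballI impI)
  fix B assume Bb: "B \<in> sets borel" and "B \<subseteq> A \<and> compact (closure B) \<and> closure B \<subseteq> X \<and> emeasure lborel B = 0"
  then have BA: "B \<subseteq> A" and B: "compact (closure B)" "closure B \<subseteq> X" and null: "emeasure lborel B = 0" by blast+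
  have BX: "B \<subseteq> X" using B(2) closure_subset by (rule order_trans[rotated])
  show "cmod (cmeasure \<mu> B) \<le> \<epsilon> * total_mass \<mu> B"
  proof (rule field_le_epsilon)
    fix e :: real assume "0 < e"
    then have e4: "0 < e / 4" by simp
    have "\<exists>K. compact K \<and> K \<subseteq> B \<and> measure (\<mu> k) (B - K) < e / 4" if "k < 4" for k
      using inner_regular_\<mu>[OF that Bb B e4] by metis
    then obtain K where K: "\<And>k. k < 4 \<Longrightarrow> compact (K k)" "\<And>k. k < 4 \<Longrightarrow> K k \<subseteq> B"
      "\<And>k. k < 4 \<Longrightarrow> measure (\<mu> k) (B - K k) < e / 4" by metis
    define E where "E = (\<Union>k<4. K k)"
    have E: "compact E" "E \<subseteq> B" unfolding E_def using K(1,2) by (auto intro!: compact_UN)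
    note Eb = borel_of_compact[OF E(1)]
    have E0: "emeasure lborel E = 0"
      using emeasure_mono[OF E(2), of lborel] Bb null by simp
    have le: "measure (\<mu> k) (B - E) \<le> e / 4" if k: "k < 4" for k
    proof -
      have Kb: "K k \<in> sets borel" using K(1)[OF k] by (rule borel_of_compact)
      have "measure (\<mu> k) B = measure (\<mu> k) (K k) + measure (\<mu> k) (B - K k)"
        using measure_split[OF Bb B Kb K(2)[OF k] k] .
      moreover have "measure (\<mu> k) B = measure (\<mu> k) E + measure (\<mu> k) (B - E)"
        using measure_split[OF Bb B Eb E(2) k] .
      moreover have "measure (\<mu> k) E = measure (\<mu> k) (K k) + measure (\<mu> k) (E - K k)"
      proof (rule measure_split[OF Eb _ _ Kb _ k])
        have "closure E = E" using E(1) by (simp add: compact_imp_closed)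
        then show "compact (closure E)" "closure E \<subseteq> X" using E BX by auto
        show "K k \<subseteq> E" using k by (auto simp: E_def)
      qed
      moreover have "0 \<le> measure (\<mu> k) (E - K k)" by simp
      ultimately show ?thesis using K(3)[OF k] by linarith
    qed
    have "cmeasure \<mu> B = cmeasure \<mu> E + (\<Sum>k<4. \<i> ^ k * complex_of_real (measure (\<mu> k) (B - E)))"
      unfolding cmeasure_def sum.distrib[symmetric]
      by (intro sum.cong refl) (simp add: measure_split[OF Bb B Eb E(2)] distrib_left)
    moreover have "cmod (\<Sum>k<4. \<i> ^ k * complex_of_real (measure (\<mu> k) (B - E))) \<le> (\<Sum>k<4::nat. e / 4)"
      by (rule norm_i_sum_le) (simp only: norm_of_real abs_of_nonneg[OF measure_nonneg] le)
    moreover have "cmod (cmeasure \<mu> E) \<le> \<epsilon> * total_mass \<mu> E"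
      using small[OF E(1) _ _ E0] E(2) BA BX by blast
    moreover have "total_mass \<mu> E \<le> total_mass \<mu> B"
      unfolding total_mass_def by (intro sum_mono) (simp add: measure_split[OF Bb B Eb E(2)])
    then have "\<epsilon> * total_mass \<mu> E \<le> \<epsilon> * total_mass \<mu> B" using \<epsilon> by (rule mult_left_mono)
    ultimately show "cmod (cmeasure \<mu> B) \<le> \<epsilon> * total_mass \<mu> B + e"
      using norm_triangle_ineq[of "cmeasure \<mu> E" "\<Sum>k<4. \<i> ^ k * complex_of_real (measure (\<mu> k) (B - E))"] by simp
  qed
qed (rule A)

lemma small_on_subset: "small_on \<epsilon> A \<Longrightarrow> C \<in> sets borel \<Longrightarrow> C \<subseteq> A \<Longrightarrow> small_on \<epsilon> C"
  unfolding small_on_def by blast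

lemma small_on_empty: "small_on \<epsilon> {}"
  by (simp add: small_on_def cmeasure_def total_mass_def)

text \<open>On disjoint pieces both sides of the inequality add up.\<close>

lemma small_on_UN:
  fixes A :: "nat \<Rightarrow> real set"
  assumes A: "\<And>i. small_on \<epsilon> (A i)"
  shows "small_on \<epsilon> (\<Union>i. A i)"
  unfolding small_on_def
proof (intro conjI ballI impI)
  have Ab: "A i \<in> sets borel" for i using A[of i] unfolding small_on_def by blast
  then show "(\<Union>i. A i) \<in> sets borel" by blast
  fix B assume Bb: "B \<in> sets borel" and "B \<subseteq> (\<Union>i. A i) \<and> compact (closure B) \<and> closure B \<subseteq> X \<and> emeasure lborel B = 0"
  then have BA: "B \<subseteq> (\<Union>i. A i)" and B: "compact (closure B)" "closure B \<subseteq> X" and null: "emeasure lborel B = 0" by blast+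
  have BX: "B \<subseteq> X" using B(2) closure_subset by (rule order_trans[rotated])
  define D where "D i = B \<inter> disjointed A i" for i
  have DB: "D i \<subseteq> B" for i by (simp add: D_def)
  have Db: "D i \<in> sets borel" for i
    using sets.range_disjointed_sets[of A borel] Ab Bb by (auto simp: D_def)
  have UD: "(\<Union>i. D i) = B" using BA by (simp add: D_def Int_UN_distrib[symmetric] UN_disjointed_eq Int_absorb2)
  have disj: "disjoint_family D"
    using disjoint_family_disjointed[of A] unfolding disjoint_family_on_def D_def by blast
  have m: "(\<lambda>i. measure (\<mu> k) (D i)) sums measure (\<mu> k) B" if k: "k < 4" for k
  proof -
    have "(\<lambda>i. measure (\<mu> k) (D i)) sums measure (\<mu> k) (\<Union>i. D i)"
    proof (rule measure_UNION[OF _ disj])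
      show "range D \<subseteq> sets (\<mu> k)" using in_sets_\<mu>[OF k Db] DB BX by blast
      show "emeasure (\<mu> k) (\<Union>i. D i) \<noteq> \<infinity>" unfolding UD using finite_\<mu>_subset[OF k Bb B] by simp
    qed
    then show ?thesis unfolding UD .
  qed
  have s1: "(\<lambda>i. cmeasure \<mu> (D i)) sums cmeasure \<mu> B"
    unfolding cmeasure_def by (intro sums_sum sums_mult sums_of_real m) simp
  have s2: "(\<lambda>i. \<epsilon> * total_mass \<mu> (D i)) sums (\<epsilon> * total_mass \<mu> B)"
    unfolding total_mass_def by (intro sums_sum sums_mult m) simp
  have le: "cmod (cmeasure \<mu> (D i)) \<le> \<epsilon> * total_mass \<mu> (D i)" for i
  proof -
    have cl: "closure (D i) \<subseteq> closure B" by (rule closure_mono[OF DB])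
    then have "compact (closure (D i))" using B(1) by (meson bounded_subset compact_eq_bounded_closed closed_closure)
    moreover have "closure (D i) \<subseteq> X" using cl B(2) by (rule order_trans)
    moreover have "emeasure lborel (D i) = 0" using emeasure_mono[OF DB, of lborel i] Bb null by simp
    moreover have "D i \<subseteq> A i" unfolding D_def using disjointed_subset[of A i] by blast
    ultimately show ?thesis using A[of i] Db[of i] unfolding small_on_def by blast
  qed
  show "cmod (cmeasure \<mu> B) \<le> \<epsilon> * total_mass \<mu> B" by (rule norm_sums_le[OF s1 s2 le])
qed

lemma small_on_locally:
  assumes A: "A \<in> sets borel" and loc: "\<And>x. x \<in> A \<Longrightarrow> \<exists>W. open W \<and> x \<in> W \<and> small_on \<epsilon> W"
  shows "small_on \<epsilon> A"
proof -
  define \<F> where "\<F> = {W. open W \<and> small_on \<epsilon> W}"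
  obtain \<G> where \<G>: "\<G> \<subseteq> \<F>" "countable \<G>" "\<Union>\<G> = \<Union>\<F>"
    using Lindelof[of \<F>] unfolding \<F>_def by blast
  have AG: "A \<subseteq> \<Union>\<G>" unfolding \<G>(3) \<F>_def using loc by blast
  have "small_on \<epsilon> (\<Union>\<G>)"
  proof (cases "\<G> = {}")
    case True
    then show ?thesis by (simp add: small_on_empty)
  next
    case False
    have "small_on \<epsilon> (from_nat_into \<G> i)" for i
      using from_nat_into[OF False, of i] \<G>(1) unfolding \<F>_def by blast
    from small_on_UN[of \<epsilon> "from_nat_into \<G>", OF this] show ?thesis using range_from_nat_into[OF False \<G>(2)] by simp
  qed
  then show ?thesis using A AG by (rule small_on_subset)
qed

end

section \<open>Points of the two kinds cover a neighbourhood\<close>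

lemma negligible_of_lborel: "B \<in> sets borel \<Longrightarrow> emeasure lborel B = 0 \<Longrightarrow> negligible B" for B :: "real set"
  by (simp add: negligible_iff_null_sets null_sets_completionI null_setsI)

context flat_strip
begin

text \<open>On \<open>E\<close> the trace test function is \<open>G(\<zeta>) \<zeta>'\<close>, with \<open>G\<close> close to \<open>1\<close> and \<open>\<zeta>'\<close> within \<open>\<epsilon>\<close> of \<open>1\<close>.\<close>

lemma small_of_peaks:
  assumes \<mu>: "radon_family X \<mu>" and L: "distribution_given_by X L \<mu>" and X: "{l..r} \<subseteq> X"
    and E: "compact E" "E \<subseteq> {i1..i2}" and peaks: "peaks X L E (\<epsilon> / 2)"
  shows "cmod (cmeasure \<mu> E) \<le> 2 * \<epsilon> * total_mass \<mu> E"
proof -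
  interpret radon_family X \<mu> by fact
  obtain G M where tf: "\<And>k. test_function X (trace_test (G k))"
    and lim: "(\<lambda>k. L (trace_test (G k))) \<longlonglongrightarrow> 0"
    and bound: "\<And>k x. x \<in> {l..r} \<Longrightarrow> cmod (G k (\<zeta> x)) \<le> M"
    and off: "\<And>x. x \<in> {l..r} - E \<Longrightarrow> (\<lambda>k. G k (\<zeta> x)) \<longlonglongrightarrow> 0"
    and on: "\<forall>\<^sub>F k in sequentially. \<forall>x\<in>E. cmod (G k (\<zeta> x) - 1) \<le> \<epsilon> / 2"
    using peaks unfolding peaks_def by blast
  have \<zeta>': "cmod (\<zeta>' x) \<le> 5 / 4" "cmod (\<zeta>' x - 1) \<le> \<epsilon>" if "x \<in> {l..r}" for x
    using Zx_near[OF that zero_in] norm_triangle_ineq[of "\<zeta>' x - 1" 1] eps by simp_all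
  have sub: "E \<subseteq> {l..r}" using E(2) I_sub by blast
  show ?thesis
  proof (rule cmeasure_le_of_peaks[where K = "{l..r}" and \<phi> = "\<lambda>k. trace_test (G k)" and c = "M * (5 / 4)"])
    show "trace_test (G k) \<in> borel_measurable borel" for k
      using tf[of k] unfolding test_function_def
      by (intro borel_measurable_continuous_onI smooth_on_imp_continuous_on) blast
    show "cmod (trace_test (G k) x) \<le> M * (5 / 4) * indicator {l..r} x" for k x
    proof (cases "x \<in> {l..r}")
      case True
      have "cmod (trace_test (G k) x) = cmod (\<psi> x) * (cmod (G k (\<zeta> x)) * cmod (\<zeta>' x))"
        by (simp add: trace_test_def norm_mult)
      also have "\<dots> \<le> 1 * (M * (5 / 4))"
        using cutoff_le[of x] bound[OF True, of k] \<zeta>'(1)[OF True] order_trans[OF norm_ge_zero bound[OF True, of k]]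
        by (intro mult_mono) simp_all
      finally show ?thesis using True by simp
    next
      case False
      then show ?thesis using cutoff_0[of x] by (auto simp: trace_test_def)
    qed
    show "(\<lambda>k. trace_test (G k) x) \<longlonglongrightarrow> 0" if "x \<in> {l..r} - E" for x
      using tendsto_mult[OF tendsto_const[of "\<psi> x"] tendsto_mult[OF off[OF that] tendsto_const[of "\<zeta>' x"]]]
      by (simp add: trace_test_def)
    show "\<forall>\<^sub>F k in sequentially. \<forall>x\<in>E. cmod (trace_test (G k) x - 1) \<le> 2 * \<epsilon>"
      using on
    proof eventually_elim
      case (elim k)
      show ?case
      proof
        fix x assume x: "x \<in> E"
        then have xl: "x \<in> {l..r}" and "\<psi> x = 1" using sub E(2) I cutoff_1[of x] by auto
        then have "trace_test (G k) x - 1 = (G k (\<zeta> x) - 1) * \<zeta>' x + (\<zeta>' x - 1)"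
          by (simp add: trace_test_def algebra_simps)
        also have "cmod \<dots> \<le> cmod (G k (\<zeta> x) - 1) * cmod (\<zeta>' x) + cmod (\<zeta>' x - 1)"
          using norm_triangle_ineq by (simp add: norm_mult[symmetric])
        also have "\<dots> \<le> \<epsilon> / 2 * (5 / 4) + \<epsilon>"
          using elim x \<zeta>'[OF xl] eps(1) by (intro add_mono mult_mono) auto
        also have "\<dots> \<le> 2 * \<epsilon>" using eps(1) by simp
        finally show "cmod (trace_test (G k) x - 1) \<le> 2 * \<epsilon>" .
      qed
    qed
    show "(\<lambda>k. cintegral \<mu> (trace_test (G k))) \<longlonglongrightarrow> 0"
      using lim L tf unfolding distribution_given_by_def by simp
  qed (use X E(1) sub in auto)
qed

text \<open>Let \<open>d\<close> be the distance of \<open>\<zeta>(e0)\<close> from the curve at level \<open>s\<close>, and \<open>x'\<close> the parameter where this curve is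
  horizontally nearest to \<open>\<zeta>(e0)\<close>. By the slope bound the curve stays on the same side of \<open>\<zeta>(e0)\<close> as its point at \<open>x'\<close>
  as long as it is horizontally close to \<open>\<zeta>(e0)\<close>, and so it passes all \<open>\<zeta>(v)\<close> with \<open>v\<close> near \<open>e0\<close> on that side.\<close>

lemma one_sided_nbhd:
  assumes e0: "e0 \<in> {i1..i2}" and s: "s \<in> {0..T}" and miss: "\<zeta> e0 \<notin> (\<lambda>x. Z (x, s)) ` {l..r}"
  obtains \<sigma> \<delta> :: real where "\<sigma> = 1 \<or> \<sigma> = - 1" "\<delta> > 0"
    "\<And>x v \<theta>. x \<in> {l..r} \<Longrightarrow> v \<in> {i1..i2} \<Longrightarrow> \<bar>v - e0\<bar> \<le> \<delta> \<Longrightarrow> 0 \<le> \<theta> \<Longrightarrow> Z (x, s) + \<i> * of_real \<sigma> * of_real \<theta> \<noteq> \<zeta> v"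
proof -
  have c: "continuous_on {l..r} (\<lambda>x. Z (x, s))" by (rule smooth_slice[OF smooth_Z s])
  have ne: "{l..r} \<noteq> {}" using l_less_r by simp
  define K where "K = (\<lambda>x. Z (x, s)) ` {l..r}"
  define d where "d = infdist (\<zeta> e0) K"
  have K: "compact K" "K \<noteq> {}" unfolding K_def using ne by (simp_all add: compact_continuous_image[OF c])
  have d: "d > 0" unfolding d_def using in_closed_iff_infdist_zero[OF compact_imp_closed[OF K(1)] K(2)] miss
    infdist_nonneg[of "\<zeta> e0" K] by (fastforce simp: K_def)
  have "continuous_on {l..r} (\<lambda>x. \<bar>Re (Z (x, s) - \<zeta> e0)\<bar>)" by (intro continuous_intros c)
  from continuous_attains_inf[OF compact_Icc ne this]
  obtain x' where x': "x' \<in> {l..r}" and min: "\<And>x. x \<in> {l..r} \<Longrightarrow> \<bar>Re (Z (x', s) - \<zeta> e0)\<bar> \<le> \<bar>Re (Z (x, s) - \<zeta> e0)\<bar>"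
    by blast
  \<comment> \<open>the side of \<open>\<zeta>(e0)\<close> on which the curve passes\<close>
  define \<sigma> :: real where "\<sigma> = (if 0 \<le> Im (Z (x', s) - \<zeta> e0) then 1 else - 1)"
  have \<sigma>_cases: "\<sigma> = 1 \<or> \<sigma> = - 1" by (simp add: \<sigma>_def)
  have dist: "d \<le> \<bar>Re (Z (x', s) - \<zeta> e0)\<bar> + \<sigma> * Im (Z (x', s) - \<zeta> e0)"
  proof -
    have "d \<le> cmod (Z (x', s) - \<zeta> e0)"
      unfolding d_def using infdist_le[of "Z (x', s)" K "\<zeta> e0"] x' by (simp add: K_def dist_norm norm_minus_commute)
    also have "\<dots> \<le> \<bar>Re (Z (x', s) - \<zeta> e0)\<bar> + \<bar>Im (Z (x', s) - \<zeta> e0)\<bar>" by (rule cmod_le)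
    finally show ?thesis by (cases "0 \<le> Im (Z (x', s) - \<zeta> e0)") (simp_all add: \<sigma>_def)
  qed
  show thesis
  proof (rule that[OF \<sigma>_cases, of "d / 10"])
    fix x v \<theta> :: real
    assume x: "x \<in> {l..r}" and v: "v \<in> {i1..i2}" "\<bar>v - e0\<bar> \<le> d / 10" and \<theta>: "0 \<le> \<theta>"
    show "Z (x, s) + \<i> * of_real \<sigma> * of_real \<theta> \<noteq> \<zeta> v"
    proof
      assume eq: "Z (x, s) + \<i> * of_real \<sigma> * of_real \<theta> = \<zeta> v"
      have re: "Re (Z (x, s)) = Re (\<zeta> v)" and im: "Im (Z (x, s)) + \<sigma> * \<theta> = Im (\<zeta> v)"
        using arg_cong[OF eq, of Re] arg_cong[OF eq, of Im] by simp_all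
      have v_e: "cmod (\<zeta> v - \<zeta> e0) \<le> d / 8"
        by (rule order_trans[OF Re_Im_near(4)[OF I_sub[OF v(1)] I_sub[OF e0] zero_in]]) (use v(2) in simp)
      note re_v = order_trans[OF abs_Re_le_cmod v_e] and im_v = order_trans[OF abs_Im_le_cmod v_e]
      have contra: False if "\<bar>p\<bar> \<le> d / 8" "\<bar>p'\<bar> \<le> d / 8" "\<bar>q - q'\<bar> \<le> \<bar>p - p'\<bar> / 3" "d \<le> \<bar>p'\<bar> + \<sigma> * q'"
          "\<bar>u\<bar> \<le> d / 8" "q + \<sigma> * \<theta> = u" for p p' q q' u :: real
      proof -
        have "\<sigma> * q' = q' \<and> \<sigma> * \<theta> = \<theta> \<or> \<sigma> * q' = - q' \<and> \<sigma> * \<theta> = - \<theta>" using \<sigma>_cases by auto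
        moreover have "\<bar>q - q'\<bar> \<le> d / 12" using that(1-3) abs_triangle_ineq4[of p p'] by simp
        moreover have "7 / 8 * d \<le> \<sigma> * q'" using that(2,4) by simp
        ultimately show False using that(5,6) d \<theta> unfolding abs_le_iff by (elim disjE conjE) simp_all
      qed
      have 1: "\<bar>Re (Z (x, s) - \<zeta> e0)\<bar> \<le> d / 8" using re re_v by simp
      show False
      proof (rule contra[OF 1 order_trans[OF min[OF x] 1] _ dist im_v])
        show "\<bar>Im (Z (x, s) - \<zeta> e0) - Im (Z (x', s) - \<zeta> e0)\<bar> \<le> \<bar>Re (Z (x, s) - \<zeta> e0) - Re (Z (x', s) - \<zeta> e0)\<bar> / 3"
          using Re_Im_near(5)[OF x x' s] by simp
      qed (use im in simp)
    qed
  qed (use d in simp)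
qed

text \<open>\<open>N\<close> collects the points that some level curve avoids. It is open, since the curves are compact.\<close>

lemma small_near_center:
  assumes \<mu>: "radon_family X \<mu>" and dist: "distribution_given_by X L \<mu>" and X: "{l..r} \<subseteq> X"
    and g: "solution g gx" "tame n g" and L: "has_trace X g L"
  shows "radon_family.small_on X \<mu> (2 * \<epsilon>) {i1<..<i2}"
proof -
  interpret radon_family X \<mu> by fact
  define N where "N = {e \<in> {i1<..<i2}. \<exists>t\<in>{0<..T}. \<zeta> e \<notin> (\<lambda>x. Z (x, t)) ` {l..r}}"
  have N_open: "open N"
  proof -
    have "open ({i1<..<i2} \<inter> \<zeta> -` (- (\<lambda>x. Z (x, t)) ` {l..r}))" if "t \<in> {0<..T}" for t
    proof (rule continuous_open_preimage)
      show "continuous_on {i1<..<i2} \<zeta>"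
        using continuous_zeta(1) by (rule continuous_on_subset) (use I_sub in auto)
      have "t \<in> {0..T}" using that by simp
      then show "open (- (\<lambda>x. Z (x, t)) ` {l..r})"
        by (intro open_Compl compact_imp_closed compact_continuous_image smooth_slice[OF smooth_Z] compact_Icc)
    qed simp
    then have "open (\<Union>t\<in>{0<..T}. {i1<..<i2} \<inter> \<zeta> -` (- (\<lambda>x. Z (x, t)) ` {l..r}))" by blast
    also have "(\<Union>t\<in>{0<..T}. {i1<..<i2} \<inter> \<zeta> -` (- (\<lambda>x. Z (x, t)) ` {l..r})) = N"
      unfolding N_def by blast
    finally show ?thesis .
  qed
  have \<epsilon>0: "0 \<le> 2 * \<epsilon>" and \<epsilon>2: "\<epsilon> / 2 > 0" using eps(1) by simp_all
  have small: "cmod (cmeasure \<mu> E) \<le> 2 * \<epsilon> * total_mass \<mu> E"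
    if "compact E" "E \<subseteq> {i1..i2}" "E \<noteq> {} \<Longrightarrow> peaks X L E (\<epsilon> / 2)" for E
  proof (cases "E = {}")
    case True
    then show ?thesis by (simp add: cmeasure_def total_mass_def)
  next
    case False
    show ?thesis by (rule small_of_peaks[OF \<mu> dist X that(1,2) that(3)[OF False]])
  qed
  have two: "small_on (2 * \<epsilon>) ({i1<..<i2} - N)"
  proof (rule small_on_of_compact[OF _ \<epsilon>0])
    fix E assume E: "compact E" "E \<subseteq> {i1<..<i2} - N" "emeasure lborel E = 0"
    have sub: "E \<subseteq> {i1..i2}" using E(2) by auto
    show "cmod (cmeasure \<mu> E) \<le> 2 * \<epsilon> * total_mass \<mu> E"
    proof (rule small[OF E(1) sub])
      assume ne: "E \<noteq> {}"
      show "peaks X L E (\<epsilon> / 2)"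
      proof (rule peaks_two_sided[OF g L X E(1) ne sub negligible_of_lborel[OF borel_of_compact[OF E(1)] E(3)] T_pos order_refl _ \<epsilon>2])
        fix e t assume e: "e \<in> E" and t: "t \<in> {0..T}"
        show "\<exists>y\<in>{l..r}. Z (y, t) = \<zeta> e"
        proof (cases "t = 0")
          case True
          then show ?thesis using e sub I_sub by blast
        next
          case False
          then have "t \<in> {0<..T}" using t by simp
          moreover have "e \<in> {i1<..<i2}" "e \<notin> N" using e E(2) by blast+
          ultimately have "\<zeta> e \<in> (\<lambda>x. Z (x, t)) ` {l..r}" unfolding N_def by blast
          then show ?thesis by (auto simp: image_iff)
        qed
      qed
    qed
  qed (use N_open in simp)
  have one: "small_on (2 * \<epsilon>) N"
  proof (rule small_on_locally)
    fix e0 assume "e0 \<in> N"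
    then obtain s where e0: "e0 \<in> {i1<..<i2}" and s: "s \<in> {0<..T}" and miss: "\<zeta> e0 \<notin> (\<lambda>x. Z (x, s)) ` {l..r}"
      unfolding N_def by blast
    have e0': "e0 \<in> {i1..i2}" and s': "s \<in> {0..T}" "0 < s" "s \<le> T" using e0 s by simp_all
    obtain \<sigma> \<delta> :: real where \<sigma>: "\<sigma> = 1 \<or> \<sigma> = - 1" and \<delta>: "\<delta> > 0" and
      sep: "\<And>x v \<theta>. x \<in> {l..r} \<Longrightarrow> v \<in> {i1..i2} \<Longrightarrow> \<bar>v - e0\<bar> \<le> \<delta> \<Longrightarrow> 0 \<le> \<theta> \<Longrightarrow>
        Z (x, s) + \<i> * of_real \<sigma> * of_real \<theta> \<noteq> \<zeta> v"
      by (rule one_sided_nbhd[OF e0' s'(1) miss]) blast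
    define j1 j2 where "j1 = max i1 (e0 - \<delta>)" and "j2 = min i2 (e0 + \<delta>)"
    have J: "i1 \<le> j1" "j1 < e0" "e0 < j2" "j2 \<le> i2" using e0 \<delta> by (auto simp: j1_def j2_def)
    have J': "j1 < j2" using J by linarith
    have near: "v \<in> {i1..i2} \<and> \<bar>v - e0\<bar> \<le> \<delta>" if "v \<in> {j1..j2}" for v
      using that by (auto simp: j1_def j2_def)
    have "small_on (2 * \<epsilon>) {j1<..<j2}"
    proof (rule small_on_of_compact[OF _ \<epsilon>0])
      fix E assume E: "compact E" "E \<subseteq> {j1<..<j2}" "emeasure lborel E = 0"
      have sub: "E \<subseteq> {j1..j2}" "E \<subseteq> {i1..i2}" using E(2) J by auto
      show "cmod (cmeasure \<mu> E) \<le> 2 * \<epsilon> * total_mass \<mu> E"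
      proof (rule small[OF E(1) sub(2)])
        assume ne: "E \<noteq> {}"
        show "peaks X L E (\<epsilon> / 2)"
        proof (rule peaks_one_sided[OF g L X J(1) J' J(4) E(1) ne sub(1)
              negligible_of_lborel[OF borel_of_compact[OF E(1)] E(3)] s'(2,3) \<sigma> _ \<epsilon>2])
          fix x v \<theta> :: real assume "x \<in> {l..r}" "v \<in> {j1..j2}" "0 \<le> \<theta>"
          then show "Z (x, s) + \<i> * of_real \<sigma> * of_real \<theta> \<noteq> \<zeta> v" using sep near by blast
        qed
      qed
    qed simp
    then show "\<exists>W. open W \<and> e0 \<in> W \<and> small_on (2 * \<epsilon>) W" using J by (intro exI[of _ "{j1<..<j2}"]) simp
  qed (use N_open in simp)
  have "small_on (2 * \<epsilon>) (\<Union>i::nat. if i = 0 then N else {i1<..<i2} - N)"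
    by (rule small_on_UN) (simp add: one two)
  moreover have "(\<Union>i::nat. if i = 0 then N else {i1<..<i2} - N) = {i1<..<i2}"
    by (auto simp: N_def split: if_splits)
  ultimately show ?thesis by simp
qed

end

section \<open>Rectifying coordinates and conclusion\<close>

lemma Ck_on_1_D:
  fixes f :: "real \<times> real \<Rightarrow> complex"
  assumes "Ck_on 1 S f"
  shows "p \<in> S \<Longrightarrow> f differentiable (at p)" "continuous_on S f" "continuous_on S (px f)"
proof -
  have *: "\<forall>p\<in>S. f differentiable (at p)" "\<forall>b\<in>Basis. continuous_on S (\<lambda>p. frechet_derivative f (at p) b)"
    using assms unfolding One_nat_def Ck_on.simps by blast+
  show "p \<in> S \<Longrightarrow> f differentiable (at p)" using *(1) by blast
  show "continuous_on S f"
    using *(1) by (intro differentiable_imp_continuous_on differentiable_at_imp_differentiable_on) blast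
  show "continuous_on S (px f)" using *(2) Basis_plane(1) by blast
qed

lemma frechet_derivative_eq_0_plane:
  fixes w :: "real \<times> real \<Rightarrow> complex"
  assumes "w differentiable (at p)" "px w p = 0" "pt w p = 0"
  shows "frechet_derivative w (at p) = (\<lambda>_. 0)"
proof
  fix h :: "real \<times> real"
  have lin: "linear (frechet_derivative w (at p))" by (rule linear_frechet_derivative[OF assms(1)])
  have "h = fst h *\<^sub>R (1, 0) + snd h *\<^sub>R (0, 1)" by (simp add: prod_eq_iff)
  then have "frechet_derivative w (at p) h = frechet_derivative w (at p) (fst h *\<^sub>R (1, 0) + snd h *\<^sub>R (0, 1))" by simp
  then show "frechet_derivative w (at p) h = 0"
    using assms(2,3) by (simp only: linear_add[OF lin] linear_scale[OF lin]) simp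
qed

text \<open>For a field \<open>\<partial>\<^sub>t + a \<partial>\<^sub>x\<close> a zero of \<open>Z\<^sub>x\<close> would be a zero of \<open>dZ\<close>, so \<open>Z\<close> can be divided by \<open>Z\<^sub>x(p)\<close>.\<close>

lemma normalized_first_integral:
  assumes int: "locally_integrable_vf U (\<lambda>p. (a p, 1))" and p: "p \<in> U"
  obtains V Z where "open V" "p \<in> V" "V \<subseteq> U" "smooth_on V Z" "px Z p = 1"
    "\<And>q. q \<in> V \<Longrightarrow> pt Z q = - (a q * px Z q)" "\<And>q. q \<in> V \<Longrightarrow> px Z q \<noteq> 0"
proof -
  obtain V Z where V: "open V" "p \<in> V" "V \<subseteq> U" and Z: "smooth_on V Z"
    and LZ: "\<forall>q\<in>V. vf_apply (\<lambda>p. (a p, 1)) Z q = 0 \<and> frechet_derivative Z (at q) \<noteq> (\<lambda>_. 0)"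
    using int p unfolding locally_integrable_vf_def by blast
  have t: "pt Z q = - (a q * px Z q)" if "q \<in> V" for q
  proof -
    have "vf_apply (\<lambda>p. (a p, 1)) Z q = 0" using LZ that by blast
    then show ?thesis unfolding vf_apply_def by (simp add: eq_neg_iff_add_eq_0 add.commute)
  qed
  have x: "px Z q \<noteq> 0" if q: "q \<in> V" for q
  proof
    assume 0: "px Z q = 0"
    have "pt Z q = 0" using t[OF q] 0 by simp
    from frechet_derivative_eq_0_plane[OF smooth_on_imp_differentiable[OF Z q] 0 this]
    show False using LZ q by blast
  qed
  define c where "c = inverse (px Z p)"
  have c: "c \<noteq> 0" "c * px Z p = 1" using x[OF V(2)] by (simp_all add: c_def)
  have d: "px (\<lambda>q. c * Z q) q = c * px Z q" "pt (\<lambda>q. c * Z q) q = c * pt Z q" if "q \<in> V" for q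
    using px_mult[OF differentiable_const smooth_on_imp_differentiable[OF Z that], of c] by simp_all
  show thesis
  proof (rule that[OF V, of "\<lambda>q. c * Z q"])
    show "smooth_on V (\<lambda>q. c * Z q)" by (rule smooth_on_mult[OF V(1) smooth_on_const Z])
    show "px (\<lambda>q. c * Z q) p = 1" using d(1)[OF V(2)] c(2) by simp
    show "pt (\<lambda>q. c * Z q) q = - (a q * px (\<lambda>q. c * Z q) q)" if "q \<in> V" for q
      using d[OF that] t[OF that] by simp
    show "px (\<lambda>q. c * Z q) q \<noteq> 0" if "q \<in> V" for q using d(1)[OF that] c(1) x[OF that] by simp
  qed
qed

text \<open>A step up at the left minus a step up at the right.\<close>

lemma plateau:
  fixes l m1 m2 r :: real
  assumes "l < m1" "m1 < m2" "m2 < r"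
  obtains \<psi> b1 b2 :: "real \<Rightarrow> complex"
  where "smooth_on UNIV \<psi>" "smooth_on UNIV b1" "smooth_on UNIV b2"
    "\<And>x. (\<psi> has_vector_derivative (b1 x - b2 x)) (at x)"
    "\<And>x. x \<notin> {l<..<m1} \<Longrightarrow> b1 x = 0" "\<And>x. x \<notin> {m2<..<r} \<Longrightarrow> b2 x = 0"
    "\<And>x. x \<notin> {l<..<r} \<Longrightarrow> \<psi> x = 0" "\<And>x. x \<in> {m1..m2} \<Longrightarrow> \<psi> x = 1" "\<And>x. cmod (\<psi> x) \<le> 1"
proof -
  obtain \<sigma>1 b1 :: "real \<Rightarrow> complex" where 1: "smooth_on UNIV \<sigma>1" "smooth_on UNIV b1"
    "\<And>x. (\<sigma>1 has_vector_derivative b1 x) (at x)" "\<And>x. x \<notin> {l<..<m1} \<Longrightarrow> b1 x = 0"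
    "\<And>x. x \<le> l \<Longrightarrow> \<sigma>1 x = 0" "\<And>x. x \<ge> m1 \<Longrightarrow> \<sigma>1 x = 1" "\<And>x. cmod (\<sigma>1 x) \<le> 1" "\<And>x. cmod (1 - \<sigma>1 x) \<le> 1"
    by (rule smooth_step[OF assms(1)]) blast
  obtain \<sigma>2 b2 :: "real \<Rightarrow> complex" where 2: "smooth_on UNIV \<sigma>2" "smooth_on UNIV b2"
    "\<And>x. (\<sigma>2 has_vector_derivative b2 x) (at x)" "\<And>x. x \<notin> {m2<..<r} \<Longrightarrow> b2 x = 0"
    "\<And>x. x \<le> m2 \<Longrightarrow> \<sigma>2 x = 0" "\<And>x. x \<ge> r \<Longrightarrow> \<sigma>2 x = 1" "\<And>x. cmod (\<sigma>2 x) \<le> 1" "\<And>x. cmod (1 - \<sigma>2 x) \<le> 1"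
    by (rule smooth_step[OF assms(3)]) blast
  show thesis
  proof (rule that[of "\<lambda>x. \<sigma>1 x - \<sigma>2 x" b1 b2])
    show "smooth_on UNIV (\<lambda>x. \<sigma>1 x - \<sigma>2 x)" by (rule smooth_on_diff[OF open_UNIV 1(1) 2(1)])
    show "((\<lambda>x. \<sigma>1 x - \<sigma>2 x) has_vector_derivative (b1 x - b2 x)) (at x)" for x
      by (rule has_vector_derivative_diff[OF 1(3) 2(3)])
    show "\<sigma>1 x - \<sigma>2 x = 0" if "x \<notin> {l<..<r}" for x
    proof (cases "x \<le> l")
      case True
      then show ?thesis using 1(5)[of x] 2(5)[of x] assms by simp
    next
      case False
      then show ?thesis using 1(6)[of x] 2(6)[of x] assms that by simp
    qed
    show "\<sigma>1 x - \<sigma>2 x = 1" if "x \<in> {m1..m2}" for x using 1(6)[of x] 2(5)[of x] that by simp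
    show "cmod (\<sigma>1 x - \<sigma>2 x) \<le> 1" for x
    proof (cases "x \<le> m2")
      case True
      then show ?thesis using 1(7)[of x] 2(5)[of x] by simp
    next
      case False
      then show ?thesis using 1(6)[of x] 2(8)[of x] assms by simp
    qed
  qed (use 1(2,4) 2(2,4) in simp_all)
qed

lemma (in strip) powi_le_growth:
  fixes N :: int
  assumes "0 < t" "t \<le> 1"
  shows "t powi (- N) \<le> growth (nat \<bar>N\<bar> + 1) t"
proof -
  have "t powi (- N) = t powr of_int (- N)" using powr_real_of_int'[of t "- N"] assms by simp
  also have "\<dots> \<le> t powr (1 / 2 - real (nat \<bar>N\<bar> + 1))"
    using assms by (intro powr_mono') simp_all
  finally show ?thesis by (simp add: growth_def)
qed

text \<open>Near \<open>x0\<close> everything is arranged in multiples of \<open>R\<close>: the strip has half-width \<open>3 R\<close>, the cutoff is \<open>1\<close> up to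
  distance \<open>2 R\<close>, and the peaks sit within distance \<open>R\<close>. The height \<open>T\<close> is so small that \<open>Z\<close> moves by less than
  \<open>R / 4\<close>; together with the slope bound this leaves the horizontal gap \<open>R / 2\<close> at the sides.\<close>

lemma small_on_nbhd:
  fixes f :: "real \<times> real \<Rightarrow> complex" and \<epsilon> :: real
  assumes a: "smooth_on U a" and U: "open U" and int: "locally_integrable_vf U (\<lambda>p. (a p, 1))"
    and X: "X = {x. (x, 0) \<in> U}"
    and f: "Ck_on 1 {p \<in> U. snd p > 0} f" "\<And>p. p \<in> U \<Longrightarrow> snd p > 0 \<Longrightarrow> vf_apply (\<lambda>p. (a p, 1)) f p = 0"
    and growth: "\<And>K. compact K \<Longrightarrow> K \<subseteq> X \<Longrightarrow> \<exists>C. \<forall>\<^sub>F t in at_right 0. \<forall>x\<in>K. cmod (f (x, t)) \<le> C * t powi (- N)"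
    and tr: "has_trace X f bf" and \<mu>: "radon_family X \<mu>" and dist: "distribution_given_by X bf \<mu>"
    and x0: "x0 \<in> X" and \<epsilon>: "0 < \<epsilon>" "\<epsilon> \<le> 1 / 4"
  shows "\<exists>W. open W \<and> x0 \<in> W \<and> radon_family.small_on X \<mu> (2 * \<epsilon>) W"
proof -
  have p0: "(x0, 0) \<in> U" using x0 X by simp
  obtain V Z where V: "open V" "(x0, 0) \<in> V" "V \<subseteq> U" and Z: "smooth_on V Z" "px Z (x0, 0) = 1"
    and Zt: "\<And>q. q \<in> V \<Longrightarrow> pt Z q = - (a q * px Z q)" and Zx: "\<And>q. q \<in> V \<Longrightarrow> px Z q \<noteq> 0"
    by (rule normalized_first_integral[OF int p0]) blast
  have "open (V \<inter> px Z -` ball 1 \<epsilon>)"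
    by (rule continuous_open_preimage[OF smooth_on_imp_continuous_on[OF smooth_on_px[OF Z(1)]] V(1) open_ball])
  then obtain \<delta> where \<delta>: "\<delta> > 0" "ball (x0, 0) \<delta> \<subseteq> V \<inter> px Z -` ball 1 \<epsilon>"
    using V(2) Z(2) \<epsilon>(1) unfolding open_contains_ball by (metis IntI centre_in_ball vimageI)
  \<comment> \<open>the square of half-side \<open>3 R\<close> lies in the ball of radius \<open>\<delta>\<close>\<close>
  define R where "R = \<delta> / 9"
  have R: "R > 0" using \<delta>(1) by (simp add: R_def)
  have box: "(x, t) \<in> V \<and> cmod (px Z (x, t) - 1) \<le> \<epsilon>" if "\<bar>x - x0\<bar> \<le> 3 * R" "\<bar>t\<bar> \<le> 3 * R" for x t
  proof -
    have "dist (x0, 0) (x, t) \<le> \<bar>x - x0\<bar> + \<bar>t\<bar>"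
      using sqrt_sum_squares_le_sum_abs[of "x0 - x" "t"] by (simp add: dist_Pair_Pair dist_real_def abs_minus_commute)
    also have "\<dots> < \<delta>" using that \<delta>(1) by (simp add: R_def)
    finally have "(x, t) \<in> V \<inter> px Z -` ball 1 \<epsilon>" using \<delta>(2) by auto
    then show ?thesis by (simp add: dist_norm norm_minus_commute less_imp_le)
  qed
  define l r m1 m2 i1 i2 where "l = x0 - 3 * R" and "r = x0 + 3 * R" and "m1 = x0 - 2 * R" and "m2 = x0 + 2 * R"
    and "i1 = x0 - R" and "i2 = x0 + R"
  have lr: "\<bar>x - x0\<bar> \<le> 3 * R" if "x \<in> {l..r}" for x using that by (auto simp: l_def r_def)
  have lrX: "{l..r} \<subseteq> X"
  proof
    fix x assume "x \<in> {l..r}"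
    then have "(x, 0) \<in> V" using box[OF lr, of x 0] R by simp
    then show "x \<in> X" using V(3) X by blast
  qed
  have uc: "uniformly_continuous_on ({l..r} \<times> {0..3 * R}) Z"
  proof (rule compact_uniformly_continuous)
    show "continuous_on ({l..r} \<times> {0..3 * R}) Z"
    proof (rule continuous_on_subset[OF smooth_on_imp_continuous_on[OF Z(1)]], rule subsetI)
      fix p assume "p \<in> {l..r} \<times> {0..3 * R}"
      then show "p \<in> V" using box[OF lr, of "fst p" "snd p"] by (simp add: mem_Times_iff)
    qed
  qed (intro compact_Times compact_Icc)
  have "0 < R / 4" using R by simp
  from uc[unfolded uniformly_continuous_on_def, rule_format, OF this] obtain d1 where d1: "d1 > 0" and Z_move:
    "\<And>p q. p \<in> {l..r} \<times> {0..3 * R} \<Longrightarrow> q \<in> {l..r} \<times> {0..3 * R} \<Longrightarrow> dist q p < d1 \<Longrightarrow> dist (Z q) (Z p) < R / 4"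
    by blast
  obtain C where C: "\<forall>\<^sub>F t in at_right 0. \<forall>x\<in>{l..r}. cmod (f (x, t)) \<le> C * t powi (- N)"
    using growth[OF compact_Icc lrX] by blast
  then obtain d2 where d2: "d2 > 0" and C: "\<And>t x. 0 < t \<Longrightarrow> t < d2 \<Longrightarrow> x \<in> {l..r} \<Longrightarrow> cmod (f (x, t)) \<le> C * t powi (- N)"
    unfolding eventually_at_right_field by blast
  define T where "T = Min {3 * R, d1 / 2, d2 / 2, 1}"
  have T: "0 < T" "T \<le> 3 * R" "T \<le> d1 / 2" "T \<le> d2 / 2" "T \<le> 1"
    unfolding T_def using R d1 d2 by simp_all
  have rect: "(x, t) \<in> V" "cmod (px Z (x, t) - 1) \<le> \<epsilon>" if "x \<in> {l..r}" "t \<in> {0..T}" for x t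
    using box[OF lr[OF that(1)], of t] that(2) T(2) by simp_all
  have near: "cmod (Z (x, t) - Z (y, t) - of_real (x - y)) \<le> \<epsilon> * \<bar>x - y\<bar>"
    if "x \<in> {l..r}" "y \<in> {l..r}" "t \<in> {0..T}" for x y t
  proof -
    have "cmod ((Z (x, t) - of_real x) - (Z (y, t) - of_real y)) \<le> \<epsilon> * \<bar>x - y\<bar>"
    proof (rule vector_derivative_bound[where f = "\<lambda>x. Z (x, t) - of_real x" and f' = "\<lambda>x. px Z (x, t) - 1"])
      show "((\<lambda>x. Z (x, t) - of_real x) has_vector_derivative px Z (x, t) - 1) (at x within {l..r})" if x: "x \<in> {l..r}" for x
      proof (rule has_vector_derivative_diff)
        show "((\<lambda>x. Z (x, t)) has_vector_derivative px Z (x, t)) (at x within {l..r})"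
          by (rule has_vector_derivative_px[OF smooth_on_imp_differentiable[OF Z(1) rect(1)[OF x \<open>t \<in> {0..T}\<close>]]])
        show "(of_real has_vector_derivative (1 :: complex)) (at x within {l..r})"
          by (rule has_vector_derivative_of_real[OF DERIV_ident, simplified])
      qed
    qed (use that rect(2) in simp_all)
    then show ?thesis by (simp add: algebra_simps)
  qed
  have order: "l < m1" "m1 < m2" "m2 < r" "m1 < i1" "i1 < i2" "i2 < m2" "l < r"
    using R by (simp_all add: l_def m1_def m2_def r_def i1_def i2_def)
  have side: "R / 2 \<le> \<bar>Re (Z (x, t) - Z (s, 0))\<bar>"
    if x: "x \<in> {l..m1} \<union> {m2..r}" and t: "t \<in> {0..T}" and s: "s \<in> {i1..i2}" for x t s
  proof -
    have sl: "s \<in> {l..r}" and xl: "x \<in> {l..r}" using s x order by auto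
    have xs: "R \<le> \<bar>x - s\<bar>" using x s by (auto simp: m1_def m2_def i1_def i2_def)
    have "\<bar>Re (Z (x, t) - Z (s, t)) - (x - s)\<bar> \<le> \<epsilon> * \<bar>x - s\<bar>"
      using order_trans[OF abs_Re_le_cmod near[OF xl sl t]] by simp
    also have "\<dots> \<le> 1 / 4 * \<bar>x - s\<bar>" using \<epsilon>(2) by (intro mult_right_mono) simp_all
    also have "1 / 4 * \<bar>x - s\<bar> = \<bar>x - s\<bar> / 4" by simp
    finally have 1: "3 / 4 * \<bar>x - s\<bar> \<le> \<bar>Re (Z (x, t) - Z (s, t))\<bar>" by (rule abs_near)
    have "dist (s, t) (s, 0) < d1" using t T(3) d1 by (simp add: dist_Pair_Pair)
    then have "dist (Z (s, t)) (Z (s, 0)) < R / 4" using t T(2) sl R by (intro Z_move) auto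
    then have 2: "\<bar>Re (Z (s, t) - Z (s, 0))\<bar> \<le> R / 4"
      using abs_Re_le_cmod[of "Z (s, t) - Z (s, 0)"] by (simp add: dist_norm)
    have "R / 2 \<le> \<bar>p + q\<bar>" if "3 / 4 * R \<le> \<bar>p\<bar>" "\<bar>q\<bar> \<le> R / 4" for p q :: real
      using that by (simp add: abs_le_iff abs_real_def split: if_splits)
    from this[of "Re (Z (x, t) - Z (s, t))" "Re (Z (s, t) - Z (s, 0))"] show ?thesis using 1 2 xs by simp
  qed
  obtain \<psi> b1 b2 :: "real \<Rightarrow> complex" where \<psi>: "smooth_on UNIV \<psi>" "smooth_on UNIV b1" "smooth_on UNIV b2"
    "\<And>x. (\<psi> has_vector_derivative (b1 x - b2 x)) (at x)"
    "\<And>x. x \<notin> {l<..<m1} \<Longrightarrow> b1 x = 0" "\<And>x. x \<notin> {m2<..<r} \<Longrightarrow> b2 x = 0"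
    "\<And>x. x \<notin> {l<..<r} \<Longrightarrow> \<psi> x = 0" "\<And>x. x \<in> {m1..m2} \<Longrightarrow> \<psi> x = 1" "\<And>x. cmod (\<psi> x) \<le> 1"
    by (rule plateau[OF order(1-3)]) blast
  have strip: "strip V a Z l r T"
  proof unfold_locales
    show "{l..r} \<times> {0..T} \<subseteq> V" using rect(1) by blast
  qed (fact V(1) order(7) T(1) Z(1) smooth_on_subset[OF a V(3)] Zt Zx)+
  interpret strip V a Z l r T by (rule strip)
  have R2: "0 < R / 2" using R by simp
  have flat: "flat_strip V a Z l r T m1 m2 \<psi> b1 b2 \<epsilon> (R / 2) i1 i2"
    by unfold_locales (fact order \<psi> \<epsilon> near rect(2) side R2)+
  note fD = Ck_on_1_D[OF f(1)]
  have inU: "(x, t) \<in> {p \<in> U. snd p > 0}" if "x \<in> {l..r}" "t \<in> {0<..T}" for x t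
    using inV'[OF that] V(3) that(2) by auto
  have sol: "solution f (px f)"
    unfolding solution_def
  proof (intro conjI ballI)
    have sub: "{l..r} \<times> {0<..T} \<subseteq> {p \<in> U. snd p > 0}" using inU by blast
    show "continuous_on ({l..r} \<times> {0<..T}) f" by (rule continuous_on_subset[OF fD(2) sub])
    show "continuous_on ({l..r} \<times> {0<..T}) (px f)" by (rule continuous_on_subset[OF fD(3) sub])
    fix x t assume xt: "x \<in> {l..r}" "t \<in> {0<..T}"
    note D = fD(1)[OF inU[OF xt]]
    show "((\<lambda>x. f (x, t)) has_vector_derivative px f (x, t)) (at x within {l..r})"
      by (rule has_vector_derivative_px[OF D])
    have "vf_apply (\<lambda>p. (a p, 1)) f (x, t) = 0" using f(2)[of "(x, t)"] inU[OF xt] by simp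
    then have "- (a (x, t) * px f (x, t)) = pt f (x, t)"
      unfolding vf_apply_def by (simp add: neg_eq_iff_add_eq_0)
    then show "((\<lambda>t. f (x, t)) has_vector_derivative - (a (x, t) * px f (x, t))) (at t within {0<..T})"
      using has_vector_derivative_pt[OF D] by simp
  qed
  have "tame (nat \<bar>N\<bar> + 1) f"
    unfolding tame_def
  proof (intro exI[of _ "\<bar>C\<bar>"] ballI)
    fix x t assume xt: "x \<in> {l..r}" "t \<in> {0<..T}"
    have t: "0 < t" "t \<le> 1" "t < d2" using xt(2) T d2 by auto
    have "cmod (f (x, t)) \<le> C * t powi (- N)" by (rule C[OF t(1,3) xt(1)])
    also have "\<dots> \<le> \<bar>C\<bar> * t powi (- N)" using t(1) by (intro mult_right_mono) simp_all
    also have "\<dots> \<le> \<bar>C\<bar> * growth (nat \<bar>N\<bar> + 1) t"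
      by (intro mult_left_mono powi_le_growth t) simp
    finally show "cmod (f (x, t)) \<le> \<bar>C\<bar> * growth (nat \<bar>N\<bar> + 1) t" .
  qed
  from flat_strip.small_near_center[OF flat \<mu> dist lrX sol this tr]
  show ?thesis using R by (intro exI[of _ "{i1<..<i2}"]) (simp add: i1_def i2_def)
qed

theorem theorem1p1:
  fixes U :: "(real \<times> real) set"
    and a f :: "real \<times> real \<Rightarrow> complex"
    and N :: int
    and bf :: "(real \<Rightarrow> complex) \<Rightarrow> complex"
    and \<mu> :: "nat \<Rightarrow> real measure"
  defines "Upos \<equiv> {p \<in> U. snd p > 0}"
    and "X \<equiv> {x. (x, 0) \<in> U}"
    and "L \<equiv> (\<lambda>p. (a p, 1))"
  assumes "open U" and "(0, 0) \<in> U"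
    and "smooth_on U a"
    and "locally_integrable_vf U L"
    and "Ck_on 1 Upos f"
    and "\<forall>p\<in>Upos. vf_apply L f p = 0"
    and "\<forall>K. compact K \<and> K \<subseteq> X \<longrightarrow>
           (\<exists>C. \<forall>\<^sub>F t in at_right 0. \<forall>x\<in>K. cmod (f (x, t)) \<le> C * t powi (- N))"
    and "has_trace X f bf"
    and "complex_radon_measure_on X \<mu>"
    and "distribution_given_by X bf \<mu>"
  shows "abs_continuous_on X \<mu>"
proof -
  have "open ((\<lambda>x :: real. (x, 0 :: real)) -` U)"
    by (intro open_vimage assms(4) continuous_intros)
  then have X: "open X" unfolding X_def by (simp add: vimage_def)
  interpret radon_family X \<mu> by unfold_locales (rule X, rule assms(12))
  have nbhd: "\<exists>W. open W \<and> x \<in> W \<and> small_on (2 * \<epsilon>) W" if "x \<in> X" "0 < \<epsilon>" "\<epsilon> \<le> 1 / 4" for x \<epsilon>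
  proof (rule small_on_nbhd[OF assms(6,4)])
    show "locally_integrable_vf U (\<lambda>p. (a p, 1))" using assms(7) unfolding L_def .
    show "X = {x. (x, 0) \<in> U}" unfolding X_def ..
    show "Ck_on 1 {p \<in> U. snd p > 0} f" using assms(8) unfolding Upos_def .
    show "vf_apply (\<lambda>p. (a p, 1)) f p = 0" if "p \<in> U" "snd p > 0" for p
      using assms(9) that unfolding Upos_def L_def by blast
    show "\<exists>C. \<forall>\<^sub>F t in at_right 0. \<forall>x\<in>K. cmod (f (x, t)) \<le> C * t powi (- N)" if "compact K" "K \<subseteq> X" for K
      using assms(10) that by blast
    show "radon_family X \<mu>" by (rule radon_family_axioms)
  qed (use that assms(11,13) in simp_all)
  show ?thesis
    unfolding abs_continuous_on_def
  proof (intro ballI impI)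
    fix E assume Eb: "E \<in> sets borel" and E: "compact (closure E) \<and> closure E \<subseteq> X \<and> emeasure lborel E = 0"
    have le: "cmod (cmeasure \<mu> E) \<le> 2 * \<epsilon> * total_mass \<mu> E" if "0 < \<epsilon>" "\<epsilon> \<le> 1 / 4" for \<epsilon>
    proof -
      have "small_on (2 * \<epsilon>) X" by (rule small_on_locally) (use X nbhd that in auto)
      moreover have "E \<subseteq> X" using E closure_subset by blast
      ultimately show ?thesis using Eb E unfolding small_on_def by blast
    qed
    have "((\<lambda>\<epsilon>. 2 * \<epsilon> * total_mass \<mu> E) \<longlongrightarrow> 2 * 0 * total_mass \<mu> E) (at_right 0)"
      by (intro tendsto_intros)
    moreover have "\<forall>\<^sub>F \<epsilon> in at_right 0. cmod (cmeasure \<mu> E) \<le> 2 * \<epsilon> * total_mass \<mu> E"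
      unfolding eventually_at_right_field by (intro exI[of _ "1 / 4"]) (use le in auto)
    ultimately have "cmod (cmeasure \<mu> E) \<le> 2 * 0 * total_mass \<mu> E" by (rule tendsto_lowerbound) simp
    then show "cmeasure \<mu> E = 0" by simp
  qed
qed

end
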